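(* Let $r\ge 0$ and let $S\subseteq\{0,1,\ldots,r\}$ be a subset containing $r$. The cofibrant replacement $\pi_r\colon Q_r\mathbb{S}\to R_{(0)}^0$ of the unit satisfies the very strong unit axiom in $(f\mathcal{C})_S$; that is, for every (not necessarily cofibrant) $A\in f\mathcal{C}$ the composite $$Q_r\mathbb{S}\otimes A\xrightarrow{\pi_r\otimes\mathrm{id}}R_{(0)}^0\otimes A\xrightarrow{\cong}A$$ is a weak equivalence in $(f\mathcal{C})_S$, i.e. an $r$-quasi-isomorphism.
   Context: Fix a commutative unital ring $R$. $f\mathcal{C}$ is the category of filtered chain complexes: an object is an unbounded, cohomologically graded chain complex $A$ of $R$-modules (differential $d$ of degree $+1$) with subcomplexes $F_pA$, $p\in\mathbb{Z}$, such that $F_pA\subseteq F_{p+1}A\subseteq A$; a morphism is a chain map $f$ with $f(F_pA)\subseteq F_pB$ for all $p$. For $k\ge 0$ put $Z_k^{p,p+n}(A)=F_pA^n\cap d^{-1}F_{p-k}A^{n+1}$, $B_0^{p,p+n}(A)=F_{p-1}A^n$, and for $k\ge1$, $B_k^{p,p+n}(A)=d\,Z_{k-1}^{p+k-1,p+k-1+n-1}(A)+Z_{k-1}^{p-1,p-1+n}(A)$. The $k$-page is $E_k^{p,p+n}(A)=Z_k^{p,p+n}(A)/B_k^{p,p+n}(A)$. An $r$-quasi-isomorphism is a morphism inducing an isomorphism on $E_{r+1}$; these are the weak equivalences of the model structure $(f\mathcal{C})_S$ on $f\mathcal{C}$, whose fibrations are the morphisms surjective on $Z_s^{p,p+n}$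 for all $p,n\in\mathbb{Z}$, $s\in S$. $R_{(p)}^n$ is the filtered chain complex with a copy of $R$ in degree $n$ and $0$ elsewhere, with $F_q=0$ for $q<p$ and $F_q=R$ for $q\ge p$. The monoidal product is the usual tensor product of complexes, $d(a\otimes b)=da\otimes b+(-1)^{|a|}a\otimes db$, with $F_p(A\otimes B)=\sum_i\operatorname{im}(F_iA\otimes F_{p-i}B\to A\otimes B)$ and unit $R_{(0)}^0$. $Q_r\mathbb{S}$ is the filtered chain complex $\bigoplus_{i\ge0}R_{(-i)}^0\to\bigoplus_{j\ge1}R_{(-r-j)}^1$ (degrees $0$ and $1$) with, writing $1_{(p)}^n$ for the generator of $R_{(p)}^n$, $d1_{(0)}^0=1_{(-r-1)}^1$ and $d1_{(-i)}^0=1_{(-i-r)}^1+1_{(-i-r-1)}^1$ for $i\ge1$; $\pi_r$ is the projection onto the $R_{(0)}^0$ summand. *)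

theory Defs
  imports "HOL.Hull" "HOL-Algebra.Module" "HOL-Algebra.QuotRing"
begin

section \<open>Modules: homomorphisms, quotients, direct sums, tensor products\<close>

text \<open>The record type of modules extends that of rings, so a module carries the fields
  \<open>mult\<close> and \<open>one\<close> as well; they play no role and are left undefined where a module is built.\<close>

definition module_hom ::
  "('r, 'x) ring_scheme \<Rightarrow> ('r, 'a, 'y) module_scheme \<Rightarrow> ('r, 'b, 'z) module_scheme \<Rightarrow> ('a \<Rightarrow> 'b) \<Rightarrow> bool"
  where "module_hom R M N f \<longleftrightarrow>
    f \<in> hom (add_monoid M) (add_monoid N) \<and>
    (\<forall>a\<in>carrier R. \<forall>x\<in>carrier M. f (a \<odot>\<^bsub>M\<^esub> x) = a \<odot>\<^bsub>N\<^esub> f x)"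

definition module_iso ::
  "('r, 'x) ring_scheme \<Rightarrow> ('r, 'a, 'y) module_scheme \<Rightarrow> ('r, 'b, 'z) module_scheme \<Rightarrow> ('a \<Rightarrow> 'b) \<Rightarrow> bool"
  where "module_iso R M N f \<longleftrightarrow> module_hom R M N f \<and> bij_betw f (carrier M) (carrier N)"

definition ring_module :: "('r, 'x) ring_scheme \<Rightarrow> ('r, 'r) module"
  where "ring_module R = \<lparr>carrier = carrier R, mult = mult R, one = one R,
    zero = zero R, add = add R, smult = mult R\<rparr>"

definition zero_module :: "('r, 'x) ring_scheme \<Rightarrow> ('r, 'r) module"
  where "zero_module R = (ring_module R)\<lparr>carrier := {\<zero>\<^bsub>R\<^esub>}\<rparr>"

definition restrict_module :: "('r, 'a) module \<Rightarrow> 'a set \<Rightarrow> ('r, 'a) module"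
  where "restrict_module M N = M\<lparr>carrier := N\<rparr>"

definition quotient_module :: "('r, 'a) module \<Rightarrow> 'a set \<Rightarrow> ('r, 'a set) module"
  where "quotient_module M N =
    \<lparr>carrier = a_rcosets\<^bsub>M\<^esub> N, mult = undefined, one = undefined,
     zero = N, add = set_add M, smult = (\<lambda>a X. \<Union>x\<in>X. N +>\<^bsub>M\<^esub> (a \<odot>\<^bsub>M\<^esub> x))\<rparr>"

definition direct_sum :: "'i set \<Rightarrow> ('i \<Rightarrow> ('r, 'a) module) \<Rightarrow> ('r, 'i \<Rightarrow> 'a) module"
  where "direct_sum I M =
    \<lparr>carrier = {u \<in> (\<Pi>\<^sub>E i\<in>I. carrier (M i)). finite {i\<in>I. u i \<noteq> \<zero>\<^bsub>M i\<^esub>}},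
     mult = undefined, one = undefined,
     zero = (\<lambda>i\<in>I. \<zero>\<^bsub>M i\<^esub>),
     add = (\<lambda>u v. \<lambda>i\<in>I. u i \<oplus>\<^bsub>M i\<^esub> v i),
     smult = (\<lambda>a u. \<lambda>i\<in>I. a \<odot>\<^bsub>M i\<^esub> u i)\<rparr>"

definition single :: "'i set \<Rightarrow> ('i \<Rightarrow> ('r, 'a) module) \<Rightarrow> 'i \<Rightarrow> 'a \<Rightarrow> 'i \<Rightarrow> 'a"
  where "single I M j x = (\<lambda>i\<in>I. if i = j then x else \<zero>\<^bsub>M i\<^esub>)"

definition free_module :: "('r, 'x) ring_scheme \<Rightarrow> 'i set \<Rightarrow> ('r, 'i \<Rightarrow> 'r) module"
  where "free_module R X = direct_sum X (\<lambda>_. ring_module R)"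

definition free_gen :: "('r, 'x) ring_scheme \<Rightarrow> 'i set \<Rightarrow> 'i \<Rightarrow> 'i \<Rightarrow> 'r"
  where "free_gen R X z = single X (\<lambda>_. ring_module R) z \<one>\<^bsub>R\<^esub>"

text \<open>\<open>M \<otimes>\<^sub>R N\<close> is the free module on \<open>M \<times> N\<close> modulo the submodule generated by the
  bilinearity relations.\<close>

definition tensor_relations ::
  "('r, 'x) ring_scheme \<Rightarrow> ('r, 'a) module \<Rightarrow> ('r, 'b) module \<Rightarrow> ('a \<times> 'b \<Rightarrow> 'r) set"
  where "tensor_relations R M N =
    (let F = free_module R (carrier M \<times> carrier N);
         g = (\<lambda>x y. free_gen R (carrier M \<times> carrier N) (x, y))
     in {g (x \<oplus>\<^bsub>M\<^esub> x') y \<ominus>\<^bsub>F\<^esub> (g x y \<oplus>\<^bsub>F\<^esub> g x' y) | x x' y.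
            x \<in> carrier M \<and> x' \<in> carrier M \<and> y \<in> carrier N}
      \<union> {g x (y \<oplus>\<^bsub>N\<^esub> y') \<ominus>\<^bsub>F\<^esub> (g x y \<oplus>\<^bsub>F\<^esub> g x y') | x y y'.
            x \<in> carrier M \<and> y \<in> carrier N \<and> y' \<in> carrier N}
      \<union> {g (a \<odot>\<^bsub>M\<^esub> x) y \<ominus>\<^bsub>F\<^esub> a \<odot>\<^bsub>F\<^esub> g x y | a x y.
            a \<in> carrier R \<and> x \<in> carrier M \<and> y \<in> carrier N}
      \<union> {g x (a \<odot>\<^bsub>N\<^esub> y) \<ominus>\<^bsub>F\<^esub> a \<odot>\<^bsub>F\<^esub> g x y | a x y.
            a \<in> carrier R \<and> x \<in> carrier M \<and> y \<in> carrier N})"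

definition tensor_kernel ::
  "('r, 'x) ring_scheme \<Rightarrow> ('r, 'a) module \<Rightarrow> ('r, 'b) module \<Rightarrow> ('a \<times> 'b \<Rightarrow> 'r) set"
  where "tensor_kernel R M N =
    (\<lambda>K. submodule K R (free_module R (carrier M \<times> carrier N))) hull tensor_relations R M N"

definition tensor ::
  "('r, 'x) ring_scheme \<Rightarrow> ('r, 'a) module \<Rightarrow> ('r, 'b) module \<Rightarrow> ('r, ('a \<times> 'b \<Rightarrow> 'r) set) module"
  where "tensor R M N =
    quotient_module (free_module R (carrier M \<times> carrier N)) (tensor_kernel R M N)"

definition tensor_elem ::
  "('r, 'x) ring_scheme \<Rightarrow> ('r, 'a) module \<Rightarrow> ('r, 'b) module \<Rightarrow> 'a \<Rightarrow> 'b \<Rightarrow> ('a \<times> 'b \<Rightarrow> 'r) set"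
  where "tensor_elem R M N x y =
    tensor_kernel R M N +>\<^bsub>free_module R (carrier M \<times> carrier N)\<^esub>
      free_gen R (carrier M \<times> carrier N) (x, y)"

text \<open>The linear map \<open>M \<otimes> N \<rightarrow> P\<close> determined by a bilinear map \<open>\<beta>\<close>: the linear extension of
  \<open>\<beta>\<close> to the free module is constant on each coset, and its value there is taken.\<close>

definition tensor_lift ::
  "('r, 'x) ring_scheme \<Rightarrow> ('r, 'a) module \<Rightarrow> ('r, 'b) module \<Rightarrow> ('r, 'c) module \<Rightarrow>
   ('a \<Rightarrow> 'b \<Rightarrow> 'c) \<Rightarrow> ('a \<times> 'b \<Rightarrow> 'r) set \<Rightarrow> 'c"
  where "tensor_lift R M N P \<beta> X =
    the_elem ((\<lambda>u. \<Oplus>\<^bsub>P\<^esub>z \<in> {z \<in> carrier M \<times> carrier N. u z \<noteq> \<zero>\<^bsub>R\<^esub>}.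
                     u z \<odot>\<^bsub>P\<^esub> \<beta> (fst z) (snd z)) ` X)"

definition tensor_map ::
  "('r, 'x) ring_scheme \<Rightarrow> ('r, 'a) module \<Rightarrow> ('r, 'b) module \<Rightarrow> ('r, 'c) module \<Rightarrow> ('r, 'd) module \<Rightarrow>
   ('a \<Rightarrow> 'c) \<Rightarrow> ('b \<Rightarrow> 'd) \<Rightarrow> ('a \<times> 'b \<Rightarrow> 'r) set \<Rightarrow> ('c \<times> 'd \<Rightarrow> 'r) set"
  where "tensor_map R M N M' N' f g =
    tensor_lift R M N (tensor R M' N') (\<lambda>x y. tensor_elem R M' N' (f x) (g y))"


section \<open>Filtered chain complexes\<close>

text \<open>\<open>piece A n\<close> is \<open>A\<^sup>n\<close>, \<open>differential A n\<close> is \<open>d : A\<^sup>n \<rightarrow> A\<^bsup>n+1\<^esup>\<close>, and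
  \<open>filt A p n\<close> is \<open>F\<^sub>p A\<^sup>n\<close>. That all \<open>A\<^sup>n\<close> have elements of a common type is no restriction,
  as each has its own carrier and its own operations.\<close>

record ('r, 'm) fcomplex =
  piece :: "int \<Rightarrow> ('r, 'm) module"
  differential :: "int \<Rightarrow> 'm \<Rightarrow> 'm"
  filt :: "int \<Rightarrow> int \<Rightarrow> 'm set"

locale filtered_complex = cring R for R :: "('r, 'x) ring_scheme" (structure) +
  fixes A :: "('r, 'm) fcomplex"
  assumes piece_module: "\<And>n. module R (piece A n)"
    and differential_hom: "\<And>n. module_hom R (piece A n) (piece A (n + 1)) (differential A n)"
    and differential_square:
      "\<And>n x. x \<in> carrier (piece A n) \<Longrightarrow>
        differential A (n + 1) (differential A n x) = \<zero>\<^bsub>piece A (n + 1 + 1)\<^esub>"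
    and filt_submodule: "\<And>p n. submodule (filt A p n) R (piece A n)"
    and filt_differential: "\<And>p n. differential A n ` filt A p n \<subseteq> filt A p (n + 1)"
    and filt_mono: "\<And>p n. filt A p n \<subseteq> filt A (p + 1) n"

definition morphism ::
  "('r, 'x) ring_scheme \<Rightarrow> ('r, 'a) fcomplex \<Rightarrow> ('r, 'b) fcomplex \<Rightarrow> (int \<Rightarrow> 'a \<Rightarrow> 'b) \<Rightarrow> bool"
  where "morphism R A B f \<longleftrightarrow>
    filtered_complex R A \<and> filtered_complex R B \<and>
    (\<forall>n. module_hom R (piece A n) (piece B n) (f n)) \<and>
    (\<forall>n. \<forall>x\<in>carrier (piece A n). f (n + 1) (differential A n x) = differential B n (f n x)) \<and>
    (\<forall>p n. f n ` filt A p n \<subseteq> filt B p n)"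

definition compose_morphism ::
  "(int \<Rightarrow> 'b \<Rightarrow> 'c) \<Rightarrow> (int \<Rightarrow> 'a \<Rightarrow> 'b) \<Rightarrow> int \<Rightarrow> 'a \<Rightarrow> 'c"
  where "compose_morphism g f = (\<lambda>n. g n \<circ> f n)"

definition id_morphism :: "int \<Rightarrow> 'a \<Rightarrow> 'a"
  where "id_morphism = (\<lambda>n x. x)"


section \<open>Pages and weak equivalences\<close>

text \<open>The bidegree \<open>(p, p + n)\<close> is represented by the pair \<open>p n\<close>, so that \<open>n\<close> is the degree in
  the complex: \<open>cycles A k p n\<close> is \<open>Z\<^sub>k\<^bsup>p,p+n\<^esup>(A)\<close>, and similarly for \<open>B\<close> and \<open>E\<close>.\<close>

definition cycles :: "('r, 'm) fcomplex \<Rightarrow> nat \<Rightarrow> int \<Rightarrow> int \<Rightarrow> 'm set"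
  where "cycles A k p n = {x \<in> filt A p n. differential A n x \<in> filt A (p - int k) (n + 1)}"

fun boundaries :: "('r, 'm) fcomplex \<Rightarrow> nat \<Rightarrow> int \<Rightarrow> int \<Rightarrow> 'm set"
  where
    "boundaries A 0 p n = filt A (p - 1) n"
  | "boundaries A (Suc k) p n =
       differential A (n - 1) ` cycles A k (p + int k) (n - 1) <+>\<^bsub>piece A n\<^esub> cycles A k (p - 1) n"

definition page :: "('r, 'm) fcomplex \<Rightarrow> nat \<Rightarrow> int \<Rightarrow> int \<Rightarrow> ('r, 'm set) module"
  where "page A k p n =
    quotient_module (restrict_module (piece A n) (cycles A k p n)) (boundaries A k p n)"

text \<open>The map sending the class of \<open>x\<close> to the class of \<open>f x\<close>.\<close>

definition page_map ::
  "('r, 'b) fcomplex \<Rightarrow> (int \<Rightarrow> 'a \<Rightarrow> 'b) \<Rightarrow> nat \<Rightarrow> int \<Rightarrow> int \<Rightarrow> 'a set \<Rightarrow> 'b set"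
  where "page_map B f k p n X = (\<Union>x\<in>X. boundaries B k p n +>\<^bsub>piece B n\<^esub> f n x)"

definition quasi_isomorphism ::
  "('r, 'x) ring_scheme \<Rightarrow> nat \<Rightarrow> ('r, 'a) fcomplex \<Rightarrow> ('r, 'b) fcomplex \<Rightarrow> (int \<Rightarrow> 'a \<Rightarrow> 'b) \<Rightarrow> bool"
  where "quasi_isomorphism R r A B f \<longleftrightarrow> morphism R A B f \<and>
    (\<forall>p n. module_iso R (page A (r + 1) p n) (page B (r + 1) p n) (page_map B f (r + 1) p n))"

text \<open>The weak equivalences of the model structure \<open>(f\<C>)\<^sub>S\<close>, for a finite nonempty set \<open>S\<close>:
  the \<open>r\<close>-quasi-isomorphisms, where \<open>r\<close> is the largest element of \<open>S\<close>.\<close>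

definition weak_equivalence ::
  "('r, 'x) ring_scheme \<Rightarrow> nat set \<Rightarrow> ('r, 'a) fcomplex \<Rightarrow> ('r, 'b) fcomplex \<Rightarrow> (int \<Rightarrow> 'a \<Rightarrow> 'b) \<Rightarrow> bool"
  where "weak_equivalence R S A B f \<longleftrightarrow> quasi_isomorphism R (Max S) A B f"


section \<open>The monoidal structure\<close>

definition graded_tensor ::
  "('r, 'x) ring_scheme \<Rightarrow> (int \<Rightarrow> ('r, 'a) module) \<Rightarrow> (int \<Rightarrow> ('r, 'b) module) \<Rightarrow>
   int \<Rightarrow> ('r, int \<Rightarrow> ('a \<times> 'b \<Rightarrow> 'r) set) module"
  where "graded_tensor R M N n = direct_sum UNIV (\<lambda>i. tensor R (M i) (N (n - i)))"

definition graded_tensor_map ::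
  "('r, 'x) ring_scheme \<Rightarrow> (int \<Rightarrow> ('r, 'a) module) \<Rightarrow> (int \<Rightarrow> ('r, 'b) module) \<Rightarrow>
   (int \<Rightarrow> ('r, 'c) module) \<Rightarrow> (int \<Rightarrow> ('r, 'd) module) \<Rightarrow>
   (int \<Rightarrow> 'a \<Rightarrow> 'c) \<Rightarrow> (int \<Rightarrow> 'b \<Rightarrow> 'd) \<Rightarrow>
   int \<Rightarrow> (int \<Rightarrow> ('a \<times> 'b \<Rightarrow> 'r) set) \<Rightarrow> int \<Rightarrow> ('c \<times> 'd \<Rightarrow> 'r) set"
  where "graded_tensor_map R M N M' N' f g n h =
    (\<lambda>i. tensor_map R (M i) (N (n - i)) (M' i) (N' (n - i)) (f i) (g (n - i)) (h i))"

text \<open>The component of \<open>d(a \<otimes> b) = da \<otimes> b + (-1)\<^bsup>|a|\<^esup> a \<otimes> db\<close> in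
  \<open>A\<^sup>i \<otimes> B\<^bsup>n+1-i\<^esup>\<close> receives \<open>da \<otimes> b\<close> from \<open>A\<^bsup>i-1\<^esup> \<otimes> B\<^bsup>n+1-i\<^esup>\<close> and
  \<open>(-1)\<^sup>i a \<otimes> db\<close> from \<open>A\<^sup>i \<otimes> B\<^bsup>n-i\<^esup>\<close>.\<close>

definition tensor_differential ::
  "('r, 'x) ring_scheme \<Rightarrow> ('r, 'a) fcomplex \<Rightarrow> ('r, 'b) fcomplex \<Rightarrow>
   int \<Rightarrow> (int \<Rightarrow> ('a \<times> 'b \<Rightarrow> 'r) set) \<Rightarrow> int \<Rightarrow> ('a \<times> 'b \<Rightarrow> 'r) set"
  where "tensor_differential R A B n h = (\<lambda>i.
    let T = tensor R (piece A i) (piece B (n + 1 - i));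
        u = tensor_map R (piece A (i - 1)) (piece B (n + 1 - i)) (piece A i) (piece B (n + 1 - i))
              (differential A (i - 1)) (\<lambda>b. b) (h (i - 1));
        v = tensor_map R (piece A i) (piece B (n - i)) (piece A i) (piece B (n + 1 - i))
              (\<lambda>a. a) (differential B (n - i)) (h i)
    in u \<oplus>\<^bsub>T\<^esub> (if even i then v else \<ominus>\<^bsub>T\<^esub> v))"

text \<open>\<open>\<Sum>\<^sub>q im(F\<^sub>q A \<otimes> F\<^bsub>p-q\<^esub> B \<rightarrow> A \<otimes> B)\<close> in degree \<open>n\<close>; the sum of the images is the
  submodule generated by their union.\<close>

definition tensor_filt ::
  "('r, 'x) ring_scheme \<Rightarrow> ('r, 'a) fcomplex \<Rightarrow> ('r, 'b) fcomplex \<Rightarrow>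
   int \<Rightarrow> int \<Rightarrow> (int \<Rightarrow> ('a \<times> 'b \<Rightarrow> 'r) set) set"
  where "tensor_filt R A B p n =
    (\<lambda>K. submodule K R (graded_tensor R (piece A) (piece B) n)) hull
      (\<Union>q. let FA = (\<lambda>k. restrict_module (piece A k) (filt A q k));
               FB = (\<lambda>k. restrict_module (piece B k) (filt B (p - q) k))
           in graded_tensor_map R FA FB (piece A) (piece B) (\<lambda>k a. a) (\<lambda>k b. b) n `
                carrier (graded_tensor R FA FB n))"

definition tensor_complex ::
  "('r, 'x) ring_scheme \<Rightarrow> ('r, 'a) fcomplex \<Rightarrow> ('r, 'b) fcomplex \<Rightarrow>
   ('r, int \<Rightarrow> ('a \<times> 'b \<Rightarrow> 'r) set) fcomplex"
  where "tensor_complex R A B =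
    \<lparr>piece = graded_tensor R (piece A) (piece B),
     differential = tensor_differential R A B,
     filt = tensor_filt R A B\<rparr>"

definition tensor_morphism ::
  "('r, 'x) ring_scheme \<Rightarrow> ('r, 'a) fcomplex \<Rightarrow> ('r, 'b) fcomplex \<Rightarrow> ('r, 'c) fcomplex \<Rightarrow> ('r, 'd) fcomplex \<Rightarrow>
   (int \<Rightarrow> 'a \<Rightarrow> 'c) \<Rightarrow> (int \<Rightarrow> 'b \<Rightarrow> 'd) \<Rightarrow>
   int \<Rightarrow> (int \<Rightarrow> ('a \<times> 'b \<Rightarrow> 'r) set) \<Rightarrow> int \<Rightarrow> ('c \<times> 'd \<Rightarrow> 'r) set"
  where "tensor_morphism R A B A' B' f g =
    graded_tensor_map R (piece A) (piece B) (piece A') (piece B') f g"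

text \<open>\<open>base R p n\<close> is \<open>R\<^bsub>(p)\<^esub>\<^sup>n\<close>.\<close>

definition base :: "('r, 'x) ring_scheme \<Rightarrow> int \<Rightarrow> int \<Rightarrow> ('r, 'r) fcomplex"
  where "base R p n =
    \<lparr>piece = (\<lambda>k. if k = n then ring_module R else zero_module R),
     differential = (\<lambda>k x. \<zero>\<^bsub>R\<^esub>),
     filt = (\<lambda>q k. if k = n \<and> p \<le> q then carrier R else {\<zero>\<^bsub>R\<^esub>})\<rparr>"

text \<open>The unit isomorphism \<open>R\<^bsub>(0)\<^esub>\<^sup>0 \<otimes> A \<cong> A\<close>, \<open>c \<otimes> a \<mapsto> c a\<close>; in degree \<open>n\<close> the only nonzero
  summand of the left side is \<open>R \<otimes> A\<^sup>n\<close>, at index \<open>0\<close>.\<close>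

definition left_unitor ::
  "('r, 'x) ring_scheme \<Rightarrow> ('r, 'm) fcomplex \<Rightarrow> int \<Rightarrow> (int \<Rightarrow> ('r \<times> 'm \<Rightarrow> 'r) set) \<Rightarrow> 'm"
  where "left_unitor R A n h =
    tensor_lift R (ring_module R) (piece A n) (piece A n) (\<lambda>c a. c \<odot>\<^bsub>piece A n\<^esub> a) (h 0)"


section \<open>The cofibrant replacement of the unit\<close>

text \<open>The complex \<open>Q\<^sub>r\<S>\<close> in degree \<open>n\<close> is the direct sum of the \<open>base R (Q_weight r n i) n\<close> over
  \<open>i \<in> Q_index n\<close>. The empty sum, in degrees other than \<open>0\<close> and \<open>1\<close>, is the zero module.\<close>

definition Q_index :: "int \<Rightarrow> nat set"
  where "Q_index n = (if n = 0 then UNIV else if n = 1 then {1..} else {})"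

definition Q_weight :: "nat \<Rightarrow> int \<Rightarrow> nat \<Rightarrow> int"
  where "Q_weight r n i = (if n = 0 then - int i else - int r - int i)"

definition Q_piece :: "('r, 'x) ring_scheme \<Rightarrow> nat \<Rightarrow> int \<Rightarrow> ('r, nat \<Rightarrow> 'r) module"
  where "Q_piece R r n = direct_sum (Q_index n) (\<lambda>i. piece (base R (Q_weight r n i) n) n)"

definition Q_gen :: "('r, 'x) ring_scheme \<Rightarrow> nat \<Rightarrow> int \<Rightarrow> nat \<Rightarrow> nat \<Rightarrow> 'r"
  where "Q_gen R r n j =
    single (Q_index n) (\<lambda>i. piece (base R (Q_weight r n i) n) n) j \<one>\<^bsub>R\<^esub>"

text \<open>\<open>Q_d_gen R r i\<close> is the differential of the generator of \<open>R\<^bsub>(-i)\<^esub>\<^sup>0\<close>.\<close>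

definition Q_d_gen :: "('r, 'x) ring_scheme \<Rightarrow> nat \<Rightarrow> nat \<Rightarrow> nat \<Rightarrow> 'r"
  where "Q_d_gen R r i =
    (if i = 0 then Q_gen R r 1 1 else Q_gen R r 1 i \<oplus>\<^bsub>Q_piece R r 1\<^esub> Q_gen R r 1 (i + 1))"

definition Q_complex :: "('r, 'x) ring_scheme \<Rightarrow> nat \<Rightarrow> ('r, nat \<Rightarrow> 'r) fcomplex"
  where "Q_complex R r =
    \<lparr>piece = Q_piece R r,
     differential = (\<lambda>n u.
       if n = 0
       then \<Oplus>\<^bsub>Q_piece R r 1\<^esub>i \<in> {i. u i \<noteq> \<zero>\<^bsub>R\<^esub>}. u i \<odot>\<^bsub>Q_piece R r 1\<^esub> Q_d_gen R r i
       else \<zero>\<^bsub>Q_piece R r (n + 1)\<^esub>),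
     filt = (\<lambda>p n. {u \<in> carrier (Q_piece R r n).
       \<forall>i\<in>Q_index n. u i \<in> filt (base R (Q_weight r n i) n) p n})\<rparr>"

definition Q_proj :: "('r, 'x) ring_scheme \<Rightarrow> int \<Rightarrow> (nat \<Rightarrow> 'r) \<Rightarrow> 'r"
  where "Q_proj R n u = (if n = 0 then u 0 else \<zero>\<^bsub>R\<^esub>)"

end

theory Submission
  imports Defs
begin

text \<open>In degree \<open>n\<close> an element of \<open>Q\<^sub>r\<S> \<otimes> A\<close> is given by coordinates \<open>\<alpha>\<^sub>j \<in> A\<^sup>n\<close> (\<open>j \<ge> 0\<close>) and
  \<open>\<beta>\<^sub>j \<in> A\<^bsup>n-1\<^esup>\<close> (\<open>j \<ge> 1\<close>), almost all zero. It lies in \<open>F\<^sub>p\<close> if and only if \<open>\<alpha>\<^sub>j \<in> F\<^bsub>p+j\<^esub>\<close> and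
  \<open>\<beta>\<^sub>j \<in> F\<^bsub>p+r+j\<^esub>\<close>, its differential has the coordinates \<open>d\<alpha>\<^sub>j\<close> and \<open>\<alpha>\<^bsub>j-1\<^esub> + \<alpha>\<^sub>j - d\<beta>\<^sub>j\<close>,
  and the map to \<open>A\<close> sends it to \<open>\<alpha>\<^sub>0\<close>. This map is onto on \<open>Z\<^bsub>r+1\<^esub>\<close>, because for a cycle \<open>a\<close> the element
  with \<open>\<alpha>\<^sub>0 = a\<close> and all other coordinates zero is again in \<open>Z\<^bsub>r+1\<^esub>\<close>. If an element of \<open>Z\<^bsub>r+1\<^esub>\<close> has
  \<open>\<alpha>\<^sub>0 = dc + z\<close> in \<open>B\<^bsub>r+1\<^esub>\<close>, let \<open>x\<close> have the coordinates \<open>c, \<beta>\<^sub>1, \<beta>\<^sub>2, \<dots>\<close> in the part coming from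
  degree \<open>0\<close> of \<open>Q\<^sub>r\<S>\<close>, and zeros elsewhere; subtracting \<open>dx\<close> leaves an element of \<open>Z\<^sub>r\<^bsup>p-1\<^esup>\<close>.
  (Solving \<open>x\<^bsub>j-1\<^esub> + x\<^sub>j = \<beta>\<^sub>j\<close> exactly would destroy finite support; the filtration makes it
  unnecessary.)\<close>

section \<open>Module homomorphisms and submodules\<close>

text \<open>Write e_j and f_j for the generators of weight -j in degree 0 and of weight -r-j in
  degree 1. For j >= 1 the leading term of d e_j is f_j, exactly r steps lower, while the tail
  f_{j+1} is one step lower still. So up to one filtration step e_j cancels against f_j. Only e_0
  survives, and its differential f_1 lies r+1 steps lower, just far enough to make e_0 an
  (r+1)-cycle. Taking the \<beta>_j as coordinates of x inverts the leading terms only. The tail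
  leaves an error -x_{j-1} in place of \<beta>_j, and it lies in F_{p-1+r+j}, which is exactly what
  membership in F_{p-1} asks of that coordinate. The technical obstacle is that a tensor is a coset
  of finitely supported functions and F_p is a generated submodule, so neither can be inspected
  directly. Since Q_rS is free in each degree and its filtration is given by weights of the basis
  elements, both turn into conditions on single coordinates, and the remaining argument takes place
  inside A.\<close>

lemma module_homI:
  assumes "\<And>x. x \<in> carrier M \<Longrightarrow> f x \<in> carrier N"
    and "\<And>x y. x \<in> carrier M \<Longrightarrow> y \<in> carrier M \<Longrightarrow> f (x \<oplus>\<^bsub>M\<^esub> y) = f x \<oplus>\<^bsub>N\<^esub> f y"
    and "\<And>a x. a \<in> carrier R \<Longrightarrow> x \<in> carrier M \<Longrightarrow> f (a \<odot>\<^bsub>M\<^esub> x) = a \<odot>\<^bsub>N\<^esub> f x"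
  shows "module_hom R M N f"
  using assms by (auto simp: module_hom_def hom_def)

lemma module_hom_closed: "module_hom R M N f \<Longrightarrow> x \<in> carrier M \<Longrightarrow> f x \<in> carrier N"
  by (auto simp: module_hom_def hom_def)

lemma module_hom_add:
  "module_hom R M N f \<Longrightarrow> x \<in> carrier M \<Longrightarrow> y \<in> carrier M \<Longrightarrow> f (x \<oplus>\<^bsub>M\<^esub> y) = f x \<oplus>\<^bsub>N\<^esub> f y"
  by (auto simp: module_hom_def hom_def)

lemma module_hom_smult:
  "module_hom R M N f \<Longrightarrow> a \<in> carrier R \<Longrightarrow> x \<in> carrier M \<Longrightarrow> f (a \<odot>\<^bsub>M\<^esub> x) = a \<odot>\<^bsub>N\<^esub> f x"
  by (auto simp: module_hom_def)

text \<open>\<open>hom\<close> on the additive monoids demands only closure and additivity, so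
  preservation of zero is derived from scalars: zero is its own multiple by the scalar zero.\<close>

lemma module_hom_zero:
  assumes "module R M" "module R N" "module_hom R M N f"
  shows "f \<zero>\<^bsub>M\<^esub> = \<zero>\<^bsub>N\<^esub>"
proof -
  interpret M: module R M by fact
  interpret N: module R N by fact
  have "f \<zero>\<^bsub>M\<^esub> = f (\<zero>\<^bsub>R\<^esub> \<odot>\<^bsub>M\<^esub> \<zero>\<^bsub>M\<^esub>)"
    by simp
  also have "\<dots> = \<zero>\<^bsub>N\<^esub>"
    using assms(3) by (subst module_hom_smult[OF assms(3)]) (simp_all add: module_hom_closed)
  finally show ?thesis .
qed

lemma module_hom_uminus:
  assumes "module R M" "module R N" "module_hom R M N f" "x \<in> carrier M"
  shows "f (\<ominus>\<^bsub>M\<^esub> x) = \<ominus>\<^bsub>N\<^esub> f x"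
proof -
  interpret M: module R M by fact
  interpret N: module R N by fact
  have "f (\<ominus>\<^bsub>M\<^esub> x) = f ((\<ominus>\<^bsub>R\<^esub> \<one>\<^bsub>R\<^esub>) \<odot>\<^bsub>M\<^esub> x)"
    using assms(4) by (simp add: M.smult_l_minus)
  also have "\<dots> = \<ominus>\<^bsub>N\<^esub> f x"
    using assms(3,4) by (simp add: module_hom_smult module_hom_closed N.smult_l_minus)
  finally show ?thesis .
qed

lemma module_hom_compose:
  "module_hom R M N f \<Longrightarrow> module_hom R N P g \<Longrightarrow> module_hom R M P (\<lambda>x. g (f x))"
  by (rule module_homI) (simp_all add: module_hom_closed module_hom_add module_hom_smult)

lemma module_hom_ident: "module_hom R M M (\<lambda>x. x)"
  by (rule module_homI) auto

lemma module_hom_const_zero: "module R N \<Longrightarrow> module_hom R M N (\<lambda>x. \<zero>\<^bsub>N\<^esub>)"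
proof -
  assume "module R N"
  then interpret module R N .
  show ?thesis by (rule module_homI) simp_all
qed

lemma module_hom_sum:
  assumes "module R N" "module_hom R M N f" "module_hom R M N g"
  shows "module_hom R M N (\<lambda>x. f x \<oplus>\<^bsub>N\<^esub> g x)"
proof -
  interpret module R N by fact
  show ?thesis
    using assms(2,3)
    by (intro module_homI) (simp_all add: module_hom_closed module_hom_add module_hom_smult
        smult_r_distr M.add.m_ac)
qed

lemma module_hom_neg:
  assumes "module R N" "module_hom R M N f"
  shows "module_hom R M N (\<lambda>x. \<ominus>\<^bsub>N\<^esub> f x)"
proof -
  interpret module R N by fact
  show ?thesis
    using assms(2)
    by (intro module_homI) (simp_all add: module_hom_closed module_hom_add module_hom_smult
        smult_r_minus M.minus_add)
qed

lemma module_hom_smult_left: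
  assumes "module R N" "x \<in> carrier N"
  shows "module_hom R (ring_module R) N (\<lambda>a. a \<odot>\<^bsub>N\<^esub> x)"
proof -
  interpret module R N by fact
  show ?thesis
    using assms(2) by (intro module_homI) (simp_all add: ring_module_def smult_l_distr smult_assoc1)
qed

lemma module_hom_smult_right:
  assumes "module R N" "a \<in> carrier R"
  shows "module_hom R N N (\<lambda>x. a \<odot>\<^bsub>N\<^esub> x)"
proof -
  interpret module R N by fact
  show ?thesis
    using assms(2) by (intro module_homI) (simp_all add: smult_r_distr smult_assoc1[symmetric] R.m_comm)
qed

text \<open>Applied to the identity it yields the inclusions of filtration steps, the maps whose
  tensor products generate \<open>tensor_filt\<close>.\<close>

lemma module_hom_restrict:
  "module_hom R M N f \<Longrightarrow> K \<subseteq> carrier M \<Longrightarrow> module_hom R (restrict_module M K) N f"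
  by (intro module_homI) (auto simp: restrict_module_def module_hom_closed module_hom_add
      module_hom_smult subset_iff)

text \<open>Lets a membership condition on the values of a linear map pass from generators to
  everything they generate. The tensor relations, the cycles and the filtration are all treated this
  way.\<close>

lemma submodule_vimage:
  assumes "module R M" "module R N" "module_hom R M N f" "submodule K R N"
  shows "submodule {x \<in> carrier M. f x \<in> K} R M"
proof -
  interpret M: module R M by fact
  interpret N: module R N by fact
  interpret K: submodule K R N by fact
  note K = N.submoduleE[OF assms(4)]
  show ?thesis
    using assms(3) K(3-5) N.submoduleE(2)[OF assms(4)] K.one_closed
    by (intro M.submoduleI)
      (auto simp: module_hom_add module_hom_smult module_hom_zero[OF assms(1-3)]
        module_hom_uminus[OF assms(1-3)])
qed

lemma submodule_zero: "module R M \<Longrightarrow> submodule {\<zero>\<^bsub>M\<^esub>} R M"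
proof -
  assume "module R M"
  then interpret module R M .
  show ?thesis by (rule submoduleI) auto
qed

lemma module_restrict: "module R M \<Longrightarrow> submodule K R M \<Longrightarrow> module R (restrict_module M K)"
  unfolding restrict_module_def by (rule submodule.submodule_is_module)

lemma submodule_hull:
  assumes "module R M" "X \<subseteq> carrier M"
  shows "submodule ((\<lambda>K. submodule K R M) hull X) R M"
proof -
  interpret module R M by fact
  \<comment> \<open>The hull is the intersection of all submodules containing \<open>X\<close>. The
    carrier is one of them, so the intersection is not over an empty family, which would give the
    whole type.\<close>
  have *: "submodule (carrier M) R M" by (rule carrier_is_submodule)
  show ?thesis
  proof (rule submoduleI)
    show "((\<lambda>K. submodule K R M) hull X) \<subseteq> carrier M"
      by (rule hull_minimal) fact+
  qed (auto simp: hull_def submoduleE submodule.smult_closed dest: subgroup.one_closed[OF submodule.axioms(1)])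
qed

text \<open>The explicit \<open>carrier M\<close> keeps the intersection correct when the index set
  is empty, as happens for Q_rS in degrees other than 0 and 1.\<close>

lemma submodule_Collect_ball:
  assumes "module R M" "\<And>i. i \<in> I \<Longrightarrow> submodule {x \<in> carrier M. P i x} R M"
  shows "submodule {x \<in> carrier M. \<forall>i\<in>I. P i x} R M"
proof -
  interpret module R M by fact
  note K = submoduleE[OF assms(2)] subgroup.one_closed[OF submodule.axioms(1)[OF assms(2)]]
  show ?thesis
  proof (rule submoduleI)
    show "\<zero>\<^bsub>M\<^esub> \<in> {x \<in> carrier M. \<forall>i\<in>I. P i x}" using K(7) by auto
    fix x assume x: "x \<in> {x \<in> carrier M. \<forall>i\<in>I. P i x}"
    show "\<ominus>\<^bsub>M\<^esub> x \<in> {x \<in> carrier M. \<forall>i\<in>I. P i x}" using K(3)[of _ x] x by auto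
    show "c \<odot>\<^bsub>M\<^esub> x \<in> {x \<in> carrier M. \<forall>i\<in>I. P i x}" if "c \<in> carrier R" for c
      using K(4)[of _ c x] x that by auto
    show "x \<oplus>\<^bsub>M\<^esub> y \<in> {x \<in> carrier M. \<forall>i\<in>I. P i x}" if "y \<in> {x \<in> carrier M. \<forall>i\<in>I. P i x}" for y
      using K(5)[of _ x y] x that by auto
  qed auto
qed

lemma submodule_Int:
  assumes "module R M" "submodule K R M" "submodule L R M"
  shows "submodule (K \<inter> L) R M"
proof -
  interpret module R M by fact
  have sub: "K \<subseteq> carrier M" "L \<subseteq> carrier M" using submoduleE(1) assms(2,3) by auto
  then have "{x \<in> carrier M. x \<in> N} = N" if "N \<in> {K, L}" for N
    using that by auto
  then have "submodule {x \<in> carrier M. \<forall>N\<in>{K, L}. x \<in> N} R M"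
    using assms by (intro submodule_Collect_ball) auto
  moreover have "{x \<in> carrier M. \<forall>N\<in>{K, L}. x \<in> N} = K \<inter> L"
    using sub by auto
  ultimately show ?thesis by simp
qed

lemma submodule_image:
  assumes "module R M" "module R N" "module_hom R M N f" "submodule K R M"
  shows "submodule (f ` K) R N"
proof -
  interpret M: module R M by fact
  interpret N: module R N by fact
  note K = M.submoduleE[OF assms(4)]
  have sub: "x \<in> carrier M" if "x \<in> K" for x using that K(1) by auto
  show ?thesis
  proof (rule N.submoduleI)
    show "f ` K \<subseteq> carrier N" using sub module_hom_closed[OF assms(3)] by auto
    show "\<zero>\<^bsub>N\<^esub> \<in> f ` K"
      using subgroup.one_closed[OF submodule.axioms(1)[OF assms(4)]] module_hom_zero[OF assms(1-3)]
      by (auto simp: image_iff intro!: bexI[of _ "\<zero>\<^bsub>M\<^esub>"])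
  next
    fix y assume "y \<in> f ` K"
    then obtain x where x: "x \<in> K" "y = f x" by auto
    show "\<ominus>\<^bsub>N\<^esub> y \<in> f ` K"
      using x K(3) sub module_hom_uminus[OF assms(1-3)] by (auto simp: image_iff intro!: bexI[of _ "\<ominus>\<^bsub>M\<^esub> x"])
    show "a \<odot>\<^bsub>N\<^esub> y \<in> f ` K" if "a \<in> carrier R" for a
      using x K(4) sub that module_hom_smult[OF assms(3)] by (auto simp: image_iff intro!: bexI[of _ "a \<odot>\<^bsub>M\<^esub> x"])
    fix y' assume "y' \<in> f ` K"
    then obtain x' where x': "x' \<in> K" "y' = f x'" by auto
    show "y \<oplus>\<^bsub>N\<^esub> y' \<in> f ` K"
      using x x' K(5) sub module_hom_add[OF assms(3)] by (auto simp: image_iff intro!: bexI[of _ "x \<oplus>\<^bsub>M\<^esub> x'"])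
  qed
qed

lemma submodule_set_add:
  assumes "module R M" "submodule K R M" "submodule L R M"
  shows "submodule (K <+>\<^bsub>M\<^esub> L) R M"
proof -
  interpret module R M by fact
  note K = submoduleE[OF assms(2)] and L = submoduleE[OF assms(3)]
  have sub: "x \<in> carrier M" if "x \<in> K \<or> x \<in> L" for x using that K(1) L(1) by auto
  have mem: "z \<in> K <+>\<^bsub>M\<^esub> L \<longleftrightarrow> (\<exists>x\<in>K. \<exists>y\<in>L. z = x \<oplus>\<^bsub>M\<^esub> y)" for z
    by (auto simp: set_add_def')
  show ?thesis
  proof (rule submoduleI)
    show "K <+>\<^bsub>M\<^esub> L \<subseteq> carrier M" using sub by (auto simp: mem)
    show "\<zero>\<^bsub>M\<^esub> \<in> K <+>\<^bsub>M\<^esub> L"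
      unfolding mem using assms(2,3)[THEN submodule.axioms(1), THEN subgroup.one_closed]
      by (auto intro!: bexI[of _ "\<zero>\<^bsub>M\<^esub>"])
  next
    fix z assume "z \<in> K <+>\<^bsub>M\<^esub> L"
    then obtain x y where x: "x \<in> K" and y: "y \<in> L" and z: "z = x \<oplus>\<^bsub>M\<^esub> y" by (auto simp: mem)
    have "\<ominus>\<^bsub>M\<^esub> z = \<ominus>\<^bsub>M\<^esub> x \<oplus>\<^bsub>M\<^esub> \<ominus>\<^bsub>M\<^esub> y"
      using x y sub by (simp add: z M.minus_add)
    then show "\<ominus>\<^bsub>M\<^esub> z \<in> K <+>\<^bsub>M\<^esub> L"
      unfolding mem using K(3)[OF x] L(3)[OF y] by blast
    show "a \<odot>\<^bsub>M\<^esub> z \<in> K <+>\<^bsub>M\<^esub> L" if a: "a \<in> carrier R" for a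
    proof -
      have "a \<odot>\<^bsub>M\<^esub> z = a \<odot>\<^bsub>M\<^esub> x \<oplus>\<^bsub>M\<^esub> a \<odot>\<^bsub>M\<^esub> y"
        using x y sub a by (simp add: z smult_r_distr)
      then show ?thesis unfolding mem using K(4)[OF a x] L(4)[OF a y] by blast
    qed
    fix z' assume "z' \<in> K <+>\<^bsub>M\<^esub> L"
    then obtain x' y' where x': "x' \<in> K" and y': "y' \<in> L" and z': "z' = x' \<oplus>\<^bsub>M\<^esub> y'" by (auto simp: mem)
    have "z \<oplus>\<^bsub>M\<^esub> z' = (x \<oplus>\<^bsub>M\<^esub> x') \<oplus>\<^bsub>M\<^esub> (y \<oplus>\<^bsub>M\<^esub> y')"
      using x y x' y' sub by (simp add: z z' M.add.m_ac)
    then show "z \<oplus>\<^bsub>M\<^esub> z' \<in> K <+>\<^bsub>M\<^esub> L"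
      unfolding mem using K(5)[OF x x'] L(5)[OF y y'] by blast
  qed
qed

lemma submodule_restrict:
  assumes "module R M" "submodule Z R M" "submodule B R M" "B \<subseteq> Z"
  shows "submodule B R (restrict_module M Z)"
proof -
  interpret Z: module R "restrict_module M Z" by (rule module_restrict[OF assms(1,2)])
  have "restrict_module M Z\<lparr>carrier := B\<rparr> = restrict_module M B" by (simp add: restrict_module_def)
  then have "module R (restrict_module M Z\<lparr>carrier := B\<rparr>)"
    using module_restrict[OF assms(1,3)] by simp
  then show ?thesis
    using assms(4) by (intro Z.module_incl_imp_submodule) (simp_all add: restrict_module_def)
qed

text \<open>All module axioms, including the existence of negatives, pass to a structure onto which
  a module maps compatibly with the operations. The structure \<open>Q\<close> need not be known to
  be a group beforehand, which suits the set operations on cosets.\<close>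

lemma module_surj_image:
  assumes "module R M" "carrier Q = q ` carrier M"
    and add: "\<And>x y. x \<in> carrier M \<Longrightarrow> y \<in> carrier M \<Longrightarrow> q x \<oplus>\<^bsub>Q\<^esub> q y = q (x \<oplus>\<^bsub>M\<^esub> y)"
    and smult: "\<And>a x. a \<in> carrier R \<Longrightarrow> x \<in> carrier M \<Longrightarrow> a \<odot>\<^bsub>Q\<^esub> q x = q (a \<odot>\<^bsub>M\<^esub> x)"
    and zero: "\<zero>\<^bsub>Q\<^esub> = q \<zero>\<^bsub>M\<^esub>"
  shows "module R Q"
proof -
  interpret module R M by fact
  show ?thesis
  proof (rule moduleI)
    show "cring R" by (rule R.is_cring)
    show "abelian_group Q"
    proof (rule abelian_groupI)
      fix x assume "x \<in> carrier Q"
      then obtain u where "u \<in> carrier M" "x = q u" using assms(2) by auto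
      then show "\<exists>y\<in>carrier Q. y \<oplus>\<^bsub>Q\<^esub> x = \<zero>\<^bsub>Q\<^esub>"
        using assms(2) by (auto simp: add zero M.l_neg intro!: bexI[of _ "\<ominus>\<^bsub>M\<^esub> u"])
    qed (auto simp: assms(2) add zero M.add.m_ac)
  qed (auto simp: assms(2) add smult smult_l_distr smult_r_distr smult_assoc1)
qed

section \<open>Quotients\<close>

lemma module_coset_eq_iff:
  assumes "module R M" "submodule N R M" "x \<in> carrier M" "y \<in> carrier M"
  shows "N +>\<^bsub>M\<^esub> x = N +>\<^bsub>M\<^esub> y \<longleftrightarrow> x \<ominus>\<^bsub>M\<^esub> y \<in> N"
proof -
  interpret module R M by fact
  interpret N: submodule N R M by fact
  interpret N: abelian_subgroup N M
    by (rule abelian_subgroupI3) (use N.subgroup_axioms in \<open>auto intro: additive_subgroup.intro M.abelian_group_axioms\<close>)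
  show ?thesis
    using N.a_rcos_module[OF assms(4,3)] N.a_repr_independence'[OF _ assms(4)]
      N.a_rcos_self[OF assms(3)] unfolding M.minus_eq by metis
qed

lemma module_coset_add:
  assumes "module R M" "submodule N R M" "x \<in> carrier M" "y \<in> carrier M"
  shows "(N +>\<^bsub>M\<^esub> x) <+>\<^bsub>M\<^esub> (N +>\<^bsub>M\<^esub> y) = N +>\<^bsub>M\<^esub> (x \<oplus>\<^bsub>M\<^esub> y)"
proof -
  interpret module R M by fact
  interpret N: submodule N R M by fact
  interpret N: abelian_subgroup N M
    by (rule abelian_subgroupI3) (use N.subgroup_axioms in \<open>auto intro: additive_subgroup.intro M.abelian_group_axioms\<close>)
  show ?thesis using assms(3,4) by (rule N.a_rcos_sum)
qed

text \<open>The scalar multiple of a coset is encoded as a union over representatives. Its members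
  coincide because a(n + x) - ax = an lies in \<open>N\<close>; as \<open>N\<close> is nonempty, the
  union is that one coset.\<close>

lemma module_coset_smult:
  assumes "module R M" "submodule N R M" "a \<in> carrier R" "x \<in> carrier M"
  shows "(\<Union>z\<in>N +>\<^bsub>M\<^esub> x. N +>\<^bsub>M\<^esub> (a \<odot>\<^bsub>M\<^esub> z)) = N +>\<^bsub>M\<^esub> (a \<odot>\<^bsub>M\<^esub> x)"
proof -
  interpret module R M by fact
  interpret N: submodule N R M by fact
  have sub: "n \<in> carrier M" if "n \<in> N" for n
    using that N.subset by auto
  have "N +>\<^bsub>M\<^esub> (a \<odot>\<^bsub>M\<^esub> (n \<oplus>\<^bsub>M\<^esub> x)) = N +>\<^bsub>M\<^esub> (a \<odot>\<^bsub>M\<^esub> x)" if n: "n \<in> N" for n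
  proof -
    have "a \<odot>\<^bsub>M\<^esub> (n \<oplus>\<^bsub>M\<^esub> x) \<ominus>\<^bsub>M\<^esub> a \<odot>\<^bsub>M\<^esub> x = a \<odot>\<^bsub>M\<^esub> n"
      using n assms(3,4) sub by (simp add: smult_r_distr M.minus_eq M.a_assoc M.r_neg)
    then show ?thesis
      using n assms sub by (subst module_coset_eq_iff[OF assms(1,2)]) auto
  qed
  moreover have "N \<noteq> {}" using submoduleE(2)[OF assms(2)] .
  ultimately show ?thesis
    by (auto simp: a_r_coset_def')
qed

lemma quotient_module_module:
  assumes "module R M" "submodule N R M"
  shows "module R (quotient_module M N)"
proof (rule module_surj_image[OF assms(1), where q = "\<lambda>x. N +>\<^bsub>M\<^esub> x"])
  interpret module R M by fact
  show "\<zero>\<^bsub>quotient_module M N\<^esub> = N +>\<^bsub>M\<^esub> \<zero>\<^bsub>M\<^esub>"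
    using submoduleE(1)[OF assms(2)] by (simp add: quotient_module_def)
qed (auto simp: quotient_module_def A_RCOSETS_def' module_coset_add[OF assms]
    module_coset_smult[OF assms])

lemma quotient_module_hom:
  assumes "module R M" "submodule N R M"
  shows "module_hom R M (quotient_module M N) (\<lambda>x. N +>\<^bsub>M\<^esub> x)"
  by (rule module_homI) (auto simp: quotient_module_def A_RCOSETS_def' module_coset_add[OF assms]
    module_coset_smult[OF assms])

text \<open>The induced map is injective when the preimage of \<open>C\<close> lies in
  \<open>B\<close>. Surjectivity is asked of \<open>f\<close> itself and not only modulo
  \<open>C\<close>, since the projection onto A is already onto on cycles. The union over
  representatives is the shape of \<open>page_map\<close>.\<close>

lemma quotient_map_iso:
  assumes M: "module R M" and N: "module R N" and f: "module_hom R M N f"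
    and B: "submodule B R M" and C: "submodule C R N"
    and fB: "f ` B \<subseteq> C"
    and surj: "\<And>y. y \<in> carrier N \<Longrightarrow> \<exists>x\<in>carrier M. f x = y"
    and inj: "\<And>x. x \<in> carrier M \<Longrightarrow> f x \<in> C \<Longrightarrow> x \<in> B"
  shows "module_iso R (quotient_module M B) (quotient_module N C) (\<lambda>X. \<Union>x\<in>X. C +>\<^bsub>N\<^esub> f x)"
proof -
  interpret M: module R M by fact
  interpret N: module R N by fact
  define F where "F X = (\<Union>x\<in>X. C +>\<^bsub>N\<^esub> f x)" for X
  have fm: "f (x \<ominus>\<^bsub>M\<^esub> y) = f x \<ominus>\<^bsub>N\<^esub> f y" if "x \<in> carrier M" "y \<in> carrier M" for x y
    using that by (simp add: M.M.minus_eq N.M.minus_eq module_hom_add[OF f] module_hom_uminus[OF M N f])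
  have F: "F (B +>\<^bsub>M\<^esub> x) = C +>\<^bsub>N\<^esub> f x" if x: "x \<in> carrier M" for x
  proof -
    have "C +>\<^bsub>N\<^esub> f (b \<oplus>\<^bsub>M\<^esub> x) = C +>\<^bsub>N\<^esub> f x" if b: "b \<in> B" for b
    proof -
      have bM: "b \<in> carrier M" using b M.submoduleE(1)[OF B] by auto
      have "f (b \<oplus>\<^bsub>M\<^esub> x) \<ominus>\<^bsub>N\<^esub> f x = f b"
        using bM x module_hom_closed[OF f] by (simp add: module_hom_add[OF f] N.M.minus_eq N.M.a_assoc N.M.r_neg)
      then show ?thesis
        using b fB bM x module_hom_closed[OF f] by (subst module_coset_eq_iff[OF N C]) auto
    qed
    then show ?thesis using M.submoduleE(2)[OF B] by (auto simp: F_def a_r_coset_def'[of M B])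
  qed
  have car: "carrier (quotient_module M B) = (\<lambda>x. B +>\<^bsub>M\<^esub> x) ` carrier M"
    "carrier (quotient_module N C) = (\<lambda>x. C +>\<^bsub>N\<^esub> x) ` carrier N"
    by (auto simp: quotient_module_def A_RCOSETS_def')
  note q = quotient_module_hom[OF M B] quotient_module_hom[OF N C]
  have Fh: "module_hom R (quotient_module M B) (quotient_module N C) F"
  proof (rule module_homI)
    fix X assume "X \<in> carrier (quotient_module M B)"
    then obtain x where x: "x \<in> carrier M" "X = B +>\<^bsub>M\<^esub> x" using car by auto
    show "F X \<in> carrier (quotient_module N C)"
      unfolding x(2) F[OF x(1)] using car module_hom_closed[OF f x(1)] by auto
    show "F (a \<odot>\<^bsub>quotient_module M B\<^esub> X) = a \<odot>\<^bsub>quotient_module N C\<^esub> F X" if a: "a \<in> carrier R" for a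
      using x a module_hom_closed[OF f x(1)]
      by (simp add: F module_hom_smult[OF q(1), symmetric] module_hom_smult[OF q(2), symmetric] module_hom_smult[OF f])
    fix Y assume "Y \<in> carrier (quotient_module M B)"
    then obtain y where y: "y \<in> carrier M" "Y = B +>\<^bsub>M\<^esub> y" using car by auto
    show "F (X \<oplus>\<^bsub>quotient_module M B\<^esub> Y) = F X \<oplus>\<^bsub>quotient_module N C\<^esub> F Y"
      using x y module_hom_closed[OF f]
      by (simp add: F module_hom_add[OF q(1), symmetric] module_hom_add[OF q(2), symmetric] module_hom_add[OF f])
  qed
  have "inj_on F (carrier (quotient_module M B))"
  proof (rule inj_onI)
    fix X Y assume "X \<in> carrier (quotient_module M B)" "Y \<in> carrier (quotient_module M B)" and eq: "F X = F Y"
    then obtain x y where x: "x \<in> carrier M" "X = B +>\<^bsub>M\<^esub> x" and y: "y \<in> carrier M" "Y = B +>\<^bsub>M\<^esub> y"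
      using car by auto
    have "f (x \<ominus>\<^bsub>M\<^esub> y) \<in> C"
      using eq x y module_coset_eq_iff[OF N C module_hom_closed[OF f x(1)] module_hom_closed[OF f y(1)]]
      by (simp add: F fm)
    then have "x \<ominus>\<^bsub>M\<^esub> y \<in> B" using x y by (intro inj) simp_all
    then show "X = Y" using x y module_coset_eq_iff[OF M B] by simp
  qed
  moreover have "carrier (quotient_module N C) \<subseteq> F ` carrier (quotient_module M B)"
  proof
    fix Y assume "Y \<in> carrier (quotient_module N C)"
    then obtain y where "y \<in> carrier N" "Y = C +>\<^bsub>N\<^esub> y" using car by auto
    then obtain x where "x \<in> carrier M" "Y = F (B +>\<^bsub>M\<^esub> x)" using surj F by metis
    then show "Y \<in> F ` carrier (quotient_module M B)" using car by auto
  qed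
  ultimately have "bij_betw F (carrier (quotient_module M B)) (carrier (quotient_module N C))"
    using module_hom_closed[OF Fh] by (simp add: bij_betw_def subset_antisym image_subsetI)
  with Fh have "module_iso R (quotient_module M B) (quotient_module N C) F"
    unfolding module_iso_def by blast
  then show ?thesis by (simp add: F_def[abs_def])
qed

section \<open>Direct sums\<close>

lemma direct_sum_simps:
  "\<zero>\<^bsub>direct_sum I M\<^esub> = (\<lambda>i\<in>I. \<zero>\<^bsub>M i\<^esub>)"
  "u \<oplus>\<^bsub>direct_sum I M\<^esub> v = (\<lambda>i\<in>I. u i \<oplus>\<^bsub>M i\<^esub> v i)"
  "a \<odot>\<^bsub>direct_sum I M\<^esub> u = (\<lambda>i\<in>I. a \<odot>\<^bsub>M i\<^esub> u i)"
  by (auto simp: direct_sum_def)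

lemma direct_sum_carrier:
  "u \<in> carrier (direct_sum I M) \<longleftrightarrow>
    (\<forall>i\<in>I. u i \<in> carrier (M i)) \<and> u \<in> extensional I \<and> finite {i\<in>I. u i \<noteq> \<zero>\<^bsub>M i\<^esub>}"
  by (auto simp: direct_sum_def PiE_def)

lemma direct_sum_module:
  assumes "cring R" "\<And>i. i \<in> I \<Longrightarrow> module R (M i)"
  shows "module R (direct_sum I M)"
proof (rule moduleI)
  show "cring R" by fact
  have mon: "abelian_group (M i)" if "i \<in> I" for i
    using assms(2)[OF that] by (simp add: module_def)
  have mon': "abelian_monoid (M i)" if "i \<in> I" for i
    using mon[OF that] by (simp add: abelian_group_def)
  show "abelian_group (direct_sum I M)"
  proof (rule abelian_groupI)
    fix u v assume uv: "u \<in> carrier (direct_sum I M)" "v \<in> carrier (direct_sum I M)"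
    have "{i\<in>I. u i \<oplus>\<^bsub>M i\<^esub> v i \<noteq> \<zero>\<^bsub>M i\<^esub>} \<subseteq> {i\<in>I. u i \<noteq> \<zero>\<^bsub>M i\<^esub>} \<union> {i\<in>I. v i \<noteq> \<zero>\<^bsub>M i\<^esub>}"
      using mon' by (auto simp: abelian_monoid.l_zero abelian_monoid.zero_closed)
    then have "finite {i\<in>I. u i \<oplus>\<^bsub>M i\<^esub> v i \<noteq> \<zero>\<^bsub>M i\<^esub>}"
      by (rule finite_subset) (use uv in \<open>auto simp: direct_sum_carrier\<close>)
    then show "u \<oplus>\<^bsub>direct_sum I M\<^esub> v \<in> carrier (direct_sum I M)"
      using uv mon'
      by (simp add: direct_sum_simps direct_sum_carrier abelian_monoid.a_closed cong: conj_cong)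
    show "u \<oplus>\<^bsub>direct_sum I M\<^esub> v = v \<oplus>\<^bsub>direct_sum I M\<^esub> u"
      using uv mon' by (auto simp: direct_sum_simps direct_sum_carrier abelian_monoid.a_comm)
    fix w assume "w \<in> carrier (direct_sum I M)"
    then show "u \<oplus>\<^bsub>direct_sum I M\<^esub> v \<oplus>\<^bsub>direct_sum I M\<^esub> w = u \<oplus>\<^bsub>direct_sum I M\<^esub> (v \<oplus>\<^bsub>direct_sum I M\<^esub> w)"
      using uv mon' by (auto simp: direct_sum_simps direct_sum_carrier abelian_monoid.a_assoc)
  next
    show "\<zero>\<^bsub>direct_sum I M\<^esub> \<in> carrier (direct_sum I M)"
      using mon' by (auto simp: direct_sum_simps direct_sum_carrier abelian_monoid.zero_closed cong: conj_cong)
    fix u assume u: "u \<in> carrier (direct_sum I M)"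
    show "\<zero>\<^bsub>direct_sum I M\<^esub> \<oplus>\<^bsub>direct_sum I M\<^esub> u = u"
      using u mon' by (auto simp: direct_sum_simps direct_sum_carrier abelian_monoid.l_zero
          extensional_def)
    have neg0: "\<ominus>\<^bsub>M i\<^esub> \<zero>\<^bsub>M i\<^esub> = \<zero>\<^bsub>M i\<^esub>" if "i \<in> I" for i
    proof -
      interpret abelian_group "M i" using mon[OF that] .
      show ?thesis by (metis l_neg r_zero zero_closed a_inv_closed)
    qed
    let ?v = "\<lambda>i\<in>I. \<ominus>\<^bsub>M i\<^esub> u i"
    have "{i\<in>I. \<ominus>\<^bsub>M i\<^esub> u i \<noteq> \<zero>\<^bsub>M i\<^esub>} \<subseteq> {i\<in>I. u i \<noteq> \<zero>\<^bsub>M i\<^esub>}"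
      using mon by (auto simp: neg0)
    then have "finite {i\<in>I. \<ominus>\<^bsub>M i\<^esub> u i \<noteq> \<zero>\<^bsub>M i\<^esub>}"
      by (rule finite_subset) (use u in \<open>auto simp: direct_sum_carrier\<close>)
    then have "?v \<in> carrier (direct_sum I M)"
      using u mon by (simp add: direct_sum_carrier abelian_group.a_inv_closed cong: conj_cong)
    moreover have "?v \<oplus>\<^bsub>direct_sum I M\<^esub> u = \<zero>\<^bsub>direct_sum I M\<^esub>"
      using u mon by (auto simp: direct_sum_simps direct_sum_carrier abelian_group.l_neg)
    ultimately show "\<exists>v\<in>carrier (direct_sum I M). v \<oplus>\<^bsub>direct_sum I M\<^esub> u = \<zero>\<^bsub>direct_sum I M\<^esub>" by blast
  qed
next
  fix a u assume a: "a \<in> carrier R" and u: "u \<in> carrier (direct_sum I M)"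
  have "{i\<in>I. a \<odot>\<^bsub>M i\<^esub> u i \<noteq> \<zero>\<^bsub>M i\<^esub>} \<subseteq> {i\<in>I. u i \<noteq> \<zero>\<^bsub>M i\<^esub>}"
    using module.smult_r_null[OF assms(2) a] by auto
  then have "finite {i\<in>I. a \<odot>\<^bsub>M i\<^esub> u i \<noteq> \<zero>\<^bsub>M i\<^esub>}"
    by (rule finite_subset) (use u in \<open>auto simp: direct_sum_carrier\<close>)
  then show "a \<odot>\<^bsub>direct_sum I M\<^esub> u \<in> carrier (direct_sum I M)"
    using a u module.smult_closed[OF assms(2)]
    by (simp add: direct_sum_simps direct_sum_carrier cong: conj_cong)
qed (auto simp: direct_sum_simps direct_sum_carrier module.smult_l_distr[OF assms(2)]
      module.smult_r_distr[OF assms(2)] module.smult_assoc1[OF assms(2)] module.smult_one[OF assms(2)]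
      extensional_def)

lemma single_closed:
  assumes "\<And>i. i \<in> I \<Longrightarrow> module R (M i)" "x \<in> carrier (M j)"
  shows "single I M j x \<in> carrier (direct_sum I M)"
proof -
  have "{i\<in>I. single I M j x i \<noteq> \<zero>\<^bsub>M i\<^esub>} \<subseteq> {j}"
    by (auto simp: single_def)
  moreover have "\<zero>\<^bsub>M i\<^esub> \<in> carrier (M i)" if "i \<in> I" for i
    using assms(1)[OF that] by (simp add: module_def abelian_group_def abelian_monoid.zero_closed)
  ultimately show ?thesis
    using assms(2) finite_subset by (auto simp: direct_sum_carrier single_def)
qed

lemma single_hom:
  assumes "\<And>i. i \<in> I \<Longrightarrow> module R (M i)"
  shows "module_hom R (M j) (direct_sum I M) (single I M j)"
proof (rule module_homI)
  have z: "\<zero>\<^bsub>M i\<^esub> \<oplus>\<^bsub>M i\<^esub> \<zero>\<^bsub>M i\<^esub> = \<zero>\<^bsub>M i\<^esub>" if "i \<in> I" for i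
    using assms[OF that] by (simp add: module_def abelian_group_def abelian_monoid.l_zero abelian_monoid.zero_closed)
  show "single I M j (x \<oplus>\<^bsub>M j\<^esub> y) = single I M j x \<oplus>\<^bsub>direct_sum I M\<^esub> single I M j y" for x y
    using z by (auto simp: direct_sum_simps single_def fun_eq_iff)
  show "single I M j x \<in> carrier (direct_sum I M)" if "x \<in> carrier (M j)" for x
    using assms that by (rule single_closed)
  show "single I M j (a \<odot>\<^bsub>M j\<^esub> x) = a \<odot>\<^bsub>direct_sum I M\<^esub> single I M j x" if "a \<in> carrier R" for a x
    using module.smult_r_null[OF assms] that by (auto simp: direct_sum_simps single_def fun_eq_iff)
qed

lemma direct_sum_component_hom:
  "i \<in> I \<Longrightarrow> module_hom R (direct_sum I M) (M i) (\<lambda>u. u i)"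
  by (rule module_homI) (auto simp: direct_sum_simps direct_sum_carrier)

text \<open>Finite support makes every element a finite sum of \<open>single\<close> elements, so
  linear statements need to be checked only on these.\<close>

lemma direct_sum_induct [consumes 1, case_names module zero add single]:
  assumes u: "u \<in> carrier (direct_sum I M)"
    and M: "\<And>i. i \<in> I \<Longrightarrow> module R (M i)"
    and zero: "P \<zero>\<^bsub>direct_sum I M\<^esub>"
    and add: "\<And>u v. u \<in> carrier (direct_sum I M) \<Longrightarrow> v \<in> carrier (direct_sum I M) \<Longrightarrow>
      P u \<Longrightarrow> P v \<Longrightarrow> P (u \<oplus>\<^bsub>direct_sum I M\<^esub> v)"
    and single: "\<And>i x. i \<in> I \<Longrightarrow> x \<in> carrier (M i) \<Longrightarrow> P (single I M i x)"
  shows "P u"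
proof -
  \<comment> \<open>Passing from the support to an arbitrary finite superset \<open>F\<close> allows
    one index to be removed at a time, whether or not it lies in \<open>I\<close> and whether or not
    the entry there vanishes.\<close>
  have "P u" if "finite F" "{i\<in>I. u i \<noteq> \<zero>\<^bsub>M i\<^esub>} \<subseteq> F" "u \<in> carrier (direct_sum I M)" for F u
    using that
  proof (induction F arbitrary: u)
    case empty
    then have "u = \<zero>\<^bsub>direct_sum I M\<^esub>"
      by (auto simp: direct_sum_simps direct_sum_carrier extensional_def fun_eq_iff)
    then show ?case using zero by simp
  next
    case (insert j F)
    show ?case
    proof (cases "j \<in> I")
      case False
      then show ?thesis using insert by auto
    next
      case True
      have ab: "abelian_monoid (M i)" if "i \<in> I" for i
        using M[OF that] by (simp add: module_def abelian_group_def)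
      define v where "v = (\<lambda>i\<in>I. if i = j then \<zero>\<^bsub>M i\<^esub> else u i)"
      have sub: "{i\<in>I. v i \<noteq> \<zero>\<^bsub>M i\<^esub>} \<subseteq> F"
        using insert.prems by (auto simp: v_def)
      have v: "v \<in> carrier (direct_sum I M)"
        using insert.prems(2) finite_subset[OF sub insert.hyps(1)] ab
        by (auto simp: v_def direct_sum_carrier abelian_monoid.zero_closed)
      have uj: "u j \<in> carrier (M j)"
        using insert.prems(2) True by (auto simp: direct_sum_carrier)
      have "u = single I M j (u j) \<oplus>\<^bsub>direct_sum I M\<^esub> v"
        using insert.prems(2) ab True
        by (auto simp: v_def direct_sum_simps direct_sum_carrier single_def fun_eq_iff extensional_def
            abelian_monoid.l_zero abelian_monoid.r_zero abelian_monoid.zero_closed)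
      moreover have "P (single I M j (u j) \<oplus>\<^bsub>direct_sum I M\<^esub> v)"
        using True uj v sub M by (intro add single insert.IH single_closed)
      ultimately show ?thesis by simp
    qed
  qed
  from this[of "{i\<in>I. u i \<noteq> \<zero>\<^bsub>M i\<^esub>}"] u show ?thesis
    by (auto simp: direct_sum_carrier)
qed

lemma direct_sum_hom_eqI:
  assumes "module R N" "cring R" "\<And>i. i \<in> I \<Longrightarrow> module R (M i)"
    and "module_hom R (direct_sum I M) N f" "module_hom R (direct_sum I M) N g"
    and "\<And>i x. i \<in> I \<Longrightarrow> x \<in> carrier (M i) \<Longrightarrow> f (single I M i x) = g (single I M i x)"
    and "u \<in> carrier (direct_sum I M)"
  shows "f u = g u"
  using assms(7)
proof (induction u rule: direct_sum_induct[where R = R])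
  case zero
  have "module R (direct_sum I M)" using assms(2,3) by (rule direct_sum_module)
  then show ?case using assms(1,4,5) by (simp add: module_hom_zero)
qed (use assms in \<open>auto simp: module_hom_add\<close>)

definition direct_sum_lift ::
  "'i set \<Rightarrow> ('i \<Rightarrow> ('r, 'a) module) \<Rightarrow> ('r, 'b) module \<Rightarrow> ('i \<Rightarrow> 'a \<Rightarrow> 'b) \<Rightarrow> ('i \<Rightarrow> 'a) \<Rightarrow> 'b"
  where "direct_sum_lift I M N g u = (\<Oplus>\<^bsub>N\<^esub>i \<in> {i\<in>I. u i \<noteq> \<zero>\<^bsub>M i\<^esub>}. g i (u i))"

text \<open>The sum defining the lift runs over the support of its argument, and this differs
  between u, v and u + v. Extra indices contribute the image of zero, so one common finite set can
  serve all three; additivity of the lift rests on this.\<close>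

lemma direct_sum_lift_superset:
  assumes "module R N" "\<And>i. i \<in> I \<Longrightarrow> module R (M i)"
    and "\<And>i. i \<in> I \<Longrightarrow> module_hom R (M i) N (g i)" "u \<in> carrier (direct_sum I M)"
    and "finite F" "{i\<in>I. u i \<noteq> \<zero>\<^bsub>M i\<^esub>} \<subseteq> F" "F \<subseteq> I"
  shows "direct_sum_lift I M N g u = (\<Oplus>\<^bsub>N\<^esub>i \<in> F. g i (u i))"
proof -
  interpret module R N by fact
  show ?thesis
    unfolding direct_sum_lift_def
  proof (rule M.add.finprod_mono_neutral_cong_left)
    fix i assume "i \<in> F - {i \<in> I. u i \<noteq> \<zero>\<^bsub>M i\<^esub>}"
    then have i: "i \<in> I" and ui: "u i = \<zero>\<^bsub>M i\<^esub>" using assms(7) by auto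
    show "g i (u i) = \<zero>\<^bsub>N\<^esub>"
      unfolding ui by (rule module_hom_zero[OF assms(2)[OF i] assms(1) assms(3)[OF i]])
  next
    show "(\<lambda>i. g i (u i)) \<in> F \<rightarrow> carrier N"
    proof
      fix i assume "i \<in> F"
      then have i: "i \<in> I" using assms(7) by auto
      then show "g i (u i) \<in> carrier N"
        using assms(4) by (intro module_hom_closed[OF assms(3)[OF i]]) (simp add: direct_sum_carrier)
    qed
  qed (use assms(5,6) in auto)
qed

lemma direct_sum_lift_hom:
  assumes "module R N" "\<And>i. i \<in> I \<Longrightarrow> module R (M i)" "\<And>i. i \<in> I \<Longrightarrow> module_hom R (M i) N (g i)"
  shows "module_hom R (direct_sum I M) N (direct_sum_lift I M N g)"
proof -
  interpret N: module R N by fact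
  interpret S: module R "direct_sum I M"
    using assms(2) by (intro direct_sum_module N.R.is_cring)
  note sup = direct_sum_lift_superset[where M = M and g = g, OF assms]
  have g: "g i (u i) \<in> carrier N" if "u \<in> carrier (direct_sum I M)" "i \<in> I" for i u
    using that module_hom_closed[OF assms(3)] by (auto simp: direct_sum_carrier)
  have fin: "finite {i\<in>I. u i \<noteq> \<zero>\<^bsub>M i\<^esub>}" if "u \<in> carrier (direct_sum I M)" for u
    using that by (auto simp: direct_sum_carrier)
  show ?thesis
  proof (rule module_homI)
    show "direct_sum_lift I M N g u \<in> carrier N" if "u \<in> carrier (direct_sum I M)" for u
      unfolding direct_sum_lift_def using that g by (intro N.M.finsum_closed) auto
  next
    fix u v assume uv: "u \<in> carrier (direct_sum I M)" "v \<in> carrier (direct_sum I M)"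
    then have w: "u \<oplus>\<^bsub>direct_sum I M\<^esub> v \<in> carrier (direct_sum I M)" by simp
    let ?F = "{i\<in>I. u i \<noteq> \<zero>\<^bsub>M i\<^esub>} \<union> {i\<in>I. v i \<noteq> \<zero>\<^bsub>M i\<^esub>} \<union>
      {i\<in>I. (u \<oplus>\<^bsub>direct_sum I M\<^esub> v) i \<noteq> \<zero>\<^bsub>M i\<^esub>}"
    have F: "finite ?F" "?F \<subseteq> I" using fin[OF uv(1)] fin[OF uv(2)] fin[OF w] by auto
    have "direct_sum_lift I M N g (u \<oplus>\<^bsub>direct_sum I M\<^esub> v) = (\<Oplus>\<^bsub>N\<^esub>i \<in> ?F. g i ((u \<oplus>\<^bsub>direct_sum I M\<^esub> v) i))"
      using F w by (intro sup) auto
    also have "\<dots> = (\<Oplus>\<^bsub>N\<^esub>i \<in> ?F. g i (u i) \<oplus>\<^bsub>N\<^esub> g i (v i))"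
    proof (rule N.M.finsum_cong'[OF refl])
      fix i assume "i \<in> ?F"
      then have i: "i \<in> I" by auto
      with uv have "u i \<in> carrier (M i)" "v i \<in> carrier (M i)" by (auto simp: direct_sum_carrier)
      then show "g i ((u \<oplus>\<^bsub>direct_sum I M\<^esub> v) i) = g i (u i) \<oplus>\<^bsub>N\<^esub> g i (v i)"
        using i assms(3)[OF i] by (simp add: direct_sum_simps module_hom_add)
    qed (use uv g in auto)
    also have "\<dots> = (\<Oplus>\<^bsub>N\<^esub>i \<in> ?F. g i (u i)) \<oplus>\<^bsub>N\<^esub> (\<Oplus>\<^bsub>N\<^esub>i \<in> ?F. g i (v i))"
      using uv g by (intro N.M.finsum_addf) auto
    also have "(\<Oplus>\<^bsub>N\<^esub>i \<in> ?F. g i (u i)) = direct_sum_lift I M N g u"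
      using F uv by (intro sup[symmetric]) auto
    also have "(\<Oplus>\<^bsub>N\<^esub>i \<in> ?F. g i (v i)) = direct_sum_lift I M N g v"
      using F uv by (intro sup[symmetric]) auto
    finally show "direct_sum_lift I M N g (u \<oplus>\<^bsub>direct_sum I M\<^esub> v) =
      direct_sum_lift I M N g u \<oplus>\<^bsub>N\<^esub> direct_sum_lift I M N g v" .
  next
    fix a u assume a: "a \<in> carrier R" and u: "u \<in> carrier (direct_sum I M)"
    let ?F = "{i\<in>I. u i \<noteq> \<zero>\<^bsub>M i\<^esub>}"
    have sub: "{i\<in>I. (a \<odot>\<^bsub>direct_sum I M\<^esub> u) i \<noteq> \<zero>\<^bsub>M i\<^esub>} \<subseteq> ?F"
      using module.smult_r_null[OF assms(2) a] by (auto simp: direct_sum_simps)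
    have "direct_sum_lift I M N g (a \<odot>\<^bsub>direct_sum I M\<^esub> u) = (\<Oplus>\<^bsub>N\<^esub>i \<in> ?F. g i ((a \<odot>\<^bsub>direct_sum I M\<^esub> u) i))"
      using fin[OF u] sub u a by (intro sup) auto
    also have "\<dots> = (\<Oplus>\<^bsub>N\<^esub>i \<in> ?F. a \<odot>\<^bsub>N\<^esub> g i (u i))"
    proof (rule N.M.finsum_cong'[OF refl])
      fix i assume "i \<in> ?F"
      then have i: "i \<in> I" by auto
      with u have "u i \<in> carrier (M i)" by (auto simp: direct_sum_carrier)
      then show "g i ((a \<odot>\<^bsub>direct_sum I M\<^esub> u) i) = a \<odot>\<^bsub>N\<^esub> g i (u i)"
        using i a assms(3)[OF i] by (simp add: direct_sum_simps module_hom_smult)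
    qed (use u a g in auto)
    also have "\<dots> = a \<odot>\<^bsub>N\<^esub> direct_sum_lift I M N g u"
      unfolding direct_sum_lift_def using fin[OF u] a u g
      by (intro N.finsum_smult_ldistr[symmetric]) auto
    finally show "direct_sum_lift I M N g (a \<odot>\<^bsub>direct_sum I M\<^esub> u) = a \<odot>\<^bsub>N\<^esub> direct_sum_lift I M N g u" .
  qed
qed

lemma direct_sum_lift_single:
  assumes "module R N" "\<And>i. i \<in> I \<Longrightarrow> module R (M i)"
    and "\<And>i. i \<in> I \<Longrightarrow> module_hom R (M i) N (g i)" "j \<in> I" "x \<in> carrier (M j)"
  shows "direct_sum_lift I M N g (single I M j x) = g j x"
proof -
  interpret module R N by fact
  have x: "g j x \<in> carrier N" using assms(5) by (rule module_hom_closed[OF assms(3)[OF assms(4)]])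
  have "direct_sum_lift I M N g (single I M j x) = (\<Oplus>\<^bsub>N\<^esub>i \<in> {j}. g i (single I M j x i))"
    using assms single_closed[where I = I and M = M and j = j, OF assms(2,5)]
    by (intro direct_sum_lift_superset) (auto simp: single_def)
  also have "\<dots> = g j x"
    using x assms(4) by (simp add: single_def)
  finally show ?thesis .
qed

text \<open>For infinite \<open>F\<close> the sum has the default value zero, which belongs to every
  submodule.\<close>

lemma submodule_finsum:
  assumes "module R M" "submodule K R M" "\<And>i. i \<in> F \<Longrightarrow> g i \<in> K"
  shows "(\<Oplus>\<^bsub>M\<^esub>i \<in> F. g i) \<in> K"
proof -
  interpret module R M by fact
  note K = submoduleE[OF assms(2)]
  have 0: "\<zero>\<^bsub>M\<^esub> \<in> K"
    using subgroup.one_closed[OF submodule.axioms(1)[OF assms(2)]] by simp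
  show ?thesis
  proof (cases "finite F")
    case True
    then show ?thesis
      using assms(3)
    proof (induction F)
      case (insert i F)
      then show ?case using K(1) by (subst M.finsum_insert) (auto intro!: K(5))
    qed (use 0 in simp)
  qed (use 0 in simp)
qed

text \<open>The lift of the inclusions \<open>single I M i\<close> is the identity, as one sees on
  \<open>single\<close> elements; hence \<open>u\<close> is the finite sum of its own entries. This
  is the direction from coordinates back to a generated filtration step.\<close>

lemma direct_sum_mem_submodule:
  assumes M: "\<And>i. i \<in> I \<Longrightarrow> module R (M i)" and "cring R"
    and K: "submodule K R (direct_sum I M)" and u: "u \<in> carrier (direct_sum I M)"
    and "\<And>i. i \<in> I \<Longrightarrow> single I M i (u i) \<in> K"
  shows "u \<in> K"
proof -
  have S: "module R (direct_sum I M)" using assms(2) M by (rule direct_sum_module)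
  have sh: "\<And>i. i \<in> I \<Longrightarrow> module_hom R (M i) (direct_sum I M) (single I M i)"
    using single_hom[where M = M and I = I, OF M] by blast
  have "direct_sum_lift I M (direct_sum I M) (single I M) u = u"
  proof (rule direct_sum_hom_eqI[where M = M and I = I, OF S assms(2) M direct_sum_lift_hom[OF S M sh] module_hom_ident _ u])
    fix i x assume "i \<in> I" "x \<in> carrier (M i)"
    then show "direct_sum_lift I M (direct_sum I M) (single I M) (single I M i x) = single I M i x"
      by (intro direct_sum_lift_single[OF S M sh])
  qed
  moreover have "direct_sum_lift I M (direct_sum I M) (single I M) u \<in> K"
    unfolding direct_sum_lift_def using assms(5) by (intro submodule_finsum[OF S K]) auto
  ultimately show ?thesis by simp
qed

section \<open>Tensor products\<close>

lemma ring_module_module: "cring R \<Longrightarrow> module R (ring_module R)"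
proof -
  assume "cring R"
  then interpret cring R .
  show ?thesis
  proof (rule moduleI[OF is_cring])
    show "abelian_group (ring_module R)"
    proof (rule abelian_groupI)
      fix x assume "x \<in> carrier (ring_module R)"
      then show "\<exists>y\<in>carrier (ring_module R). y \<oplus>\<^bsub>ring_module R\<^esub> x = \<zero>\<^bsub>ring_module R\<^esub>"
        by (auto simp: ring_module_def intro!: bexI[of _ "\<ominus>\<^bsub>R\<^esub> x"] l_neg)
    qed (auto simp: ring_module_def add.m_ac)
  qed (auto simp: ring_module_def l_distr r_distr m_assoc)
qed

lemma free_module_module: "cring R \<Longrightarrow> module R (free_module R X)"
  unfolding free_module_def by (intro direct_sum_module ring_module_module)

lemma free_gen_closed:
  assumes "cring R"
  shows "free_gen R X z \<in> carrier (free_module R X)"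
proof -
  interpret cring R by fact
  show ?thesis
    unfolding free_gen_def free_module_def
    by (rule single_closed[where R = R]) (auto simp: ring_module_module[OF assms], simp add: ring_module_def)
qed

lemma single_ring_module_eq:
  assumes "cring R" "c \<in> carrier R"
  shows "single X (\<lambda>_. ring_module R) z c = c \<odot>\<^bsub>free_module R X\<^esub> free_gen R X z"
proof -
  interpret cring R by fact
  show ?thesis
    using assms(2)
    by (auto simp: free_module_def free_gen_def direct_sum_simps single_def fun_eq_iff ring_module_def)
qed

definition module_bilinear ::
  "('r, 'x) ring_scheme \<Rightarrow> ('r, 'a) module \<Rightarrow> ('r, 'b) module \<Rightarrow> ('r, 'c) module \<Rightarrow> ('a \<Rightarrow> 'b \<Rightarrow> 'c) \<Rightarrow> bool"
  where "module_bilinear R M N P \<beta> \<longleftrightarrow>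
    (\<forall>x\<in>carrier M. module_hom R N P (\<beta> x)) \<and> (\<forall>y\<in>carrier N. module_hom R M P (\<lambda>x. \<beta> x y))"

lemma module_bilinearD:
  assumes "module_bilinear R M N P \<beta>"
  shows "x \<in> carrier M \<Longrightarrow> module_hom R N P (\<beta> x)"
    and "y \<in> carrier N \<Longrightarrow> module_hom R M P (\<lambda>x. \<beta> x y)"
    and "x \<in> carrier M \<Longrightarrow> y \<in> carrier N \<Longrightarrow> \<beta> x y \<in> carrier P"
  using assms by (auto simp: module_bilinear_def module_hom_closed)

lemma tensor_relations_subset:
  assumes "module R M" "module R N"
  shows "tensor_relations R M N \<subseteq> carrier (free_module R (carrier M \<times> carrier N))"
proof -
  interpret M: module R M by fact
  interpret N: module R N by fact
  interpret F: module R "free_module R (carrier M \<times> carrier N)"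
    by (rule free_module_module) (rule M.R.is_cring)
  note gen = free_gen_closed[OF M.R.is_cring, of "carrier M \<times> carrier N"]
  show ?thesis
    unfolding tensor_relations_def Let_def using gen by auto
qed

lemma tensor_kernel_submodule:
  assumes "module R M" "module R N"
  shows "submodule (tensor_kernel R M N) R (free_module R (carrier M \<times> carrier N))"
  unfolding tensor_kernel_def
  using assms by (intro submodule_hull free_module_module tensor_relations_subset) (simp_all add: module_def)

lemma tensor_module:
  assumes "module R M" "module R N"
  shows "module R (tensor R M N)"
  unfolding tensor_def
  using assms by (intro quotient_module_module free_module_module tensor_kernel_submodule) (simp_all add: module_def)

text \<open>Equality of cosets means that the difference lies in the kernel, and the four families
  in \<open>tensor_relations\<close> are precisely the differences that occur in the four
  identities.\<close>

lemma tensor_elem_bilinear: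
  assumes "module R M" "module R N"
  shows "module_bilinear R M N (tensor R M N) (tensor_elem R M N)"
proof -
  interpret M: module R M by fact
  interpret N: module R N by fact
  define X where "X = carrier M \<times> carrier N"
  define F where "F = free_module R X"
  define K where "K = tensor_kernel R M N"
  define g where "g x y = free_gen R X (x, y)" for x y
  have F: "module R F" unfolding F_def by (rule free_module_module) (rule M.R.is_cring)
  interpret F: module R F by (rule F)
  have K: "submodule K R F"
    unfolding K_def F_def X_def using assms by (rule tensor_kernel_submodule)
  have T: "tensor R M N = quotient_module F K"
    unfolding tensor_def F_def K_def X_def ..
  have te: "tensor_elem R M N x y = K +>\<^bsub>F\<^esub> g x y" for x y
    unfolding tensor_elem_def F_def K_def X_def g_def ..
  have g: "g x y \<in> carrier F" for x y
    unfolding g_def F_def by (rule free_gen_closed) (rule M.R.is_cring)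
  have q: "module_hom R F (tensor R M N) (\<lambda>u. K +>\<^bsub>F\<^esub> u)"
    unfolding T by (rule quotient_module_hom[OF F K])
  have rel: "z \<in> K" if "z \<in> tensor_relations R M N" for z
    unfolding K_def tensor_kernel_def using that by (rule hull_inc)
  have eq: "K +>\<^bsub>F\<^esub> u = K +>\<^bsub>F\<^esub> v"
    if "u \<ominus>\<^bsub>F\<^esub> v \<in> tensor_relations R M N" "u \<in> carrier F" "v \<in> carrier F" for u v
    using rel[OF that(1)] module_coset_eq_iff[OF F K that(2,3)] by simp
  have rels: 
    "x \<in> carrier M \<Longrightarrow> x' \<in> carrier M \<Longrightarrow> y \<in> carrier N \<Longrightarrow>
      g (x \<oplus>\<^bsub>M\<^esub> x') y \<ominus>\<^bsub>F\<^esub> (g x y \<oplus>\<^bsub>F\<^esub> g x' y) \<in> tensor_relations R M N"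
    "x \<in> carrier M \<Longrightarrow> y \<in> carrier N \<Longrightarrow> y' \<in> carrier N \<Longrightarrow>
      g x (y \<oplus>\<^bsub>N\<^esub> y') \<ominus>\<^bsub>F\<^esub> (g x y \<oplus>\<^bsub>F\<^esub> g x y') \<in> tensor_relations R M N"
    "a \<in> carrier R \<Longrightarrow> x \<in> carrier M \<Longrightarrow> y \<in> carrier N \<Longrightarrow>
      g (a \<odot>\<^bsub>M\<^esub> x) y \<ominus>\<^bsub>F\<^esub> a \<odot>\<^bsub>F\<^esub> g x y \<in> tensor_relations R M N"
    "a \<in> carrier R \<Longrightarrow> x \<in> carrier M \<Longrightarrow> y \<in> carrier N \<Longrightarrow>
      g x (a \<odot>\<^bsub>N\<^esub> y) \<ominus>\<^bsub>F\<^esub> a \<odot>\<^bsub>F\<^esub> g x y \<in> tensor_relations R M N" for a x x' y y'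
    unfolding tensor_relations_def Let_def g_def F_def X_def by blast+
  show ?thesis
    unfolding module_bilinear_def
  proof (intro conjI ballI module_homI)
    fix x y assume xy: "x \<in> carrier M" "y \<in> carrier N"
    show "tensor_elem R M N x y \<in> carrier (tensor R M N)"
      unfolding te using module_hom_closed[OF q g] .
    show "tensor_elem R M N x y \<in> carrier (tensor R M N)"
      unfolding te using module_hom_closed[OF q g] .
    fix y' assume y': "y' \<in> carrier N"
    show "tensor_elem R M N x (y \<oplus>\<^bsub>N\<^esub> y') = tensor_elem R M N x y \<oplus>\<^bsub>tensor R M N\<^esub> tensor_elem R M N x y'"
      unfolding te module_hom_add[OF q g g, symmetric] by (intro eq rels xy y' g F.M.add.m_closed)
  next
    fix x y a assume xya: "x \<in> carrier M" "y \<in> carrier N" "a \<in> carrier R"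
    show "tensor_elem R M N x (a \<odot>\<^bsub>N\<^esub> y) = a \<odot>\<^bsub>tensor R M N\<^esub> tensor_elem R M N x y"
      "tensor_elem R M N (a \<odot>\<^bsub>M\<^esub> x) y = a \<odot>\<^bsub>tensor R M N\<^esub> tensor_elem R M N x y"
      unfolding te module_hom_smult[OF q xya(3) g, symmetric] using xya
      by - (rule eq[OF rels(4)] eq[OF rels(3)]; simp add: g)+
  next
    fix y x x' assume "y \<in> carrier N" "x \<in> carrier M" "x' \<in> carrier M"
    then show "tensor_elem R M N (x \<oplus>\<^bsub>M\<^esub> x') y = tensor_elem R M N x y \<oplus>\<^bsub>tensor R M N\<^esub> tensor_elem R M N x' y"
      unfolding te module_hom_add[OF q g g, symmetric] by (intro eq rels g F.M.add.m_closed)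
  qed
qed

lemmas tensor_elem_hom = module_bilinearD[OF tensor_elem_bilinear]

text \<open>Scalar multiples require no case of their own: c(x \<otimes> y) = (cx) \<otimes> y is
  again elementary, so sums of elementary tensors exhaust the tensor product.\<close>

lemma tensor_induct [consumes 3, case_names zero add elem]:
  assumes M: "module R M" and N: "module R N"
    and t: "t \<in> carrier (tensor R M N)"
    and zero: "P \<zero>\<^bsub>tensor R M N\<^esub>"
    and add: "\<And>s t. s \<in> carrier (tensor R M N) \<Longrightarrow> t \<in> carrier (tensor R M N) \<Longrightarrow>
      P s \<Longrightarrow> P t \<Longrightarrow> P (s \<oplus>\<^bsub>tensor R M N\<^esub> t)"
    and elem: "\<And>x y. x \<in> carrier M \<Longrightarrow> y \<in> carrier N \<Longrightarrow> P (tensor_elem R M N x y)"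
  shows "P t"
proof -
  interpret M: module R M by fact
  define X where "X = carrier M \<times> carrier N"
  define F where "F = free_module R X"
  define K where "K = tensor_kernel R M N"
  have F: "module R F" unfolding F_def by (rule free_module_module) (rule M.R.is_cring)
  interpret F: module R F by (rule F)
  have K: "submodule K R F"
    unfolding K_def F_def X_def using M N by (rule tensor_kernel_submodule)
  have T: "tensor R M N = quotient_module F K"
    unfolding tensor_def F_def K_def X_def ..
  have q: "module_hom R F (tensor R M N) (\<lambda>u. K +>\<^bsub>F\<^esub> u)"
    unfolding T by (rule quotient_module_hom[OF F K])
  have Tmod: "module R (tensor R M N)" using M N by (rule tensor_module)
  from t obtain u where u: "u \<in> carrier F" and tu: "t = K +>\<^bsub>F\<^esub> u"
    unfolding T by (auto simp: quotient_module_def A_RCOSETS_def')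
  have "P (K +>\<^bsub>F\<^esub> u)"
    using u unfolding F_def free_module_def
  proof (induction u rule: direct_sum_induct[where R = R])
    case (module i)
    show ?case by (rule ring_module_module) (rule M.R.is_cring)
  next
    case zero
    show ?case
      using module_hom_zero[OF F Tmod q] assms(4) by (simp add: F_def free_module_def)
  next
    case (add u v)
    then show ?case
      using module_hom_add[OF q, of u v] assms(5) module_hom_closed[OF q] by (simp add: F_def free_module_def)
  next
    case (single z c)
    obtain x y where z: "z = (x, y)" by (cases z)
    have xy: "x \<in> carrier M" "y \<in> carrier N" using single(1) z by (auto simp: X_def)
    have c: "c \<in> carrier R" using single(2) by (simp add: ring_module_def)
    have g: "free_gen R X z \<in> carrier F"
      unfolding F_def by (rule free_gen_closed) (rule M.R.is_cring)
    have "K +>\<^bsub>F\<^esub> single X (\<lambda>_. ring_module R) z c = c \<odot>\<^bsub>tensor R M N\<^esub> (K +>\<^bsub>F\<^esub> free_gen R X z)"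
      using module_hom_smult[OF q c g] single_ring_module_eq[OF M.R.is_cring c, of X z] by (simp add: F_def)
    also have "\<dots> = c \<odot>\<^bsub>tensor R M N\<^esub> tensor_elem R M N x y"
      by (simp add: tensor_elem_def F_def K_def X_def z)
    also have "\<dots> = tensor_elem R M N (c \<odot>\<^bsub>M\<^esub> x) y"
      by (rule module_hom_smult[OF tensor_elem_hom(2)[OF M N xy(2)] c xy(1), symmetric])
    finally show ?case using xy c elem by (simp add: F_def free_module_def)
  qed
  then show ?thesis using tu by simp
qed

lemma tensor_hom_eqI:
  assumes "module R M" "module R N" "module R P"
    and "module_hom R (tensor R M N) P f" "module_hom R (tensor R M N) P g"
    and "\<And>x y. x \<in> carrier M \<Longrightarrow> y \<in> carrier N \<Longrightarrow>
      f (tensor_elem R M N x y) = g (tensor_elem R M N x y)"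
    and "t \<in> carrier (tensor R M N)"
  shows "f t = g t"
  using assms(1,2,7)
proof (induction rule: tensor_induct)
  case zero
  then show ?case
    using module_hom_zero[OF tensor_module[OF assms(1,2)] assms(3) assms(4)]
      module_hom_zero[OF tensor_module[OF assms(1,2)] assms(3) assms(5)] by simp
qed (use assms(4-6) in \<open>auto simp: module_hom_add\<close>)

text \<open>A bilinear map extends linearly to the free module, and the kernel of the extension
  is a submodule containing the relations; so the extension is constant on cosets.\<close>

lemma
  assumes M: "module R M" and N: "module R N" and P: "module R P"
    and \<beta>: "module_bilinear R M N P \<beta>"
  shows tensor_lift_hom: "module_hom R (tensor R M N) P (tensor_lift R M N P \<beta>)"
    and tensor_lift_elem: "x \<in> carrier M \<Longrightarrow> y \<in> carrier N \<Longrightarrow>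
      tensor_lift R M N P \<beta> (tensor_elem R M N x y) = \<beta> x y"
proof -
  interpret M: module R M by fact
  interpret N: module R N by fact
  interpret P: module R P by fact
  define X where "X = carrier M \<times> carrier N"
  define F where "F = free_module R X"
  define K where "K = tensor_kernel R M N"
  define L where "L = direct_sum_lift X (\<lambda>_. ring_module R) P (\<lambda>z c. c \<odot>\<^bsub>P\<^esub> \<beta> (fst z) (snd z))"
  have cr: "cring R" by (rule M.R.is_cring)
  have F: "module R F" unfolding F_def by (rule free_module_module[OF cr])
  interpret F: module R F by (rule F)
  have K: "submodule K R F"
    unfolding K_def F_def X_def using M N by (rule tensor_kernel_submodule)
  have T: "tensor R M N = quotient_module F K"
    unfolding tensor_def F_def K_def X_def ..
  have bc: "\<beta> x y \<in> carrier P" if "x \<in> carrier M" "y \<in> carrier N" for x y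
    using module_bilinearD(3)[OF \<beta> that] .
  have gh: "module_hom R (ring_module R) P (\<lambda>c. c \<odot>\<^bsub>P\<^esub> \<beta> (fst z) (snd z))" if "z \<in> X" for z
    using that bc by (intro module_hom_smult_left P) (auto simp: X_def)
  have Lh: "module_hom R F P L"
    unfolding F_def free_module_def L_def using gh
    by (intro direct_sum_lift_hom P ring_module_module[OF cr])
  have Lgen: "L (free_gen R X (x, y)) = \<beta> x y" if "x \<in> carrier M" "y \<in> carrier N" for x y
    unfolding L_def free_gen_def
    using direct_sum_lift_single[where M = "\<lambda>_. ring_module R", OF P ring_module_module[OF cr] gh,
        where j = "(x, y)" and x = "\<one>\<^bsub>R\<^esub>"]
      that bc[OF that] by (simp add: X_def ring_module_def)
  have gen: "free_gen R X z \<in> carrier F" for z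
    unfolding F_def by (rule free_gen_closed[OF cr])
  have KL: "L k = \<zero>\<^bsub>P\<^esub>" if "k \<in> K" for k
  proof -
    have "K \<subseteq> {u \<in> carrier F. L u \<in> {\<zero>\<^bsub>P\<^esub>}}"
      unfolding K_def tensor_kernel_def
    proof (rule hull_minimal)
      show "submodule {u \<in> carrier F. L u \<in> {\<zero>\<^bsub>P\<^esub>}} R (free_module R (carrier M \<times> carrier N))"
        using submodule_vimage[OF F P Lh submodule_zero[OF P]] unfolding F_def X_def .
      have Lm: "L (u \<ominus>\<^bsub>F\<^esub> v) = L u \<ominus>\<^bsub>P\<^esub> L v" if "u \<in> carrier F" "v \<in> carrier F" for u v
        using that Lh by (simp add: F.M.minus_eq P.M.minus_eq module_hom_add module_hom_uminus[OF F P Lh])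
      have Pm: "p \<ominus>\<^bsub>P\<^esub> p = \<zero>\<^bsub>P\<^esub>" if "p \<in> carrier P" for p
        using that by (simp add: P.M.minus_eq P.M.r_neg)
      show "tensor_relations R M N \<subseteq> {u \<in> carrier F. L u \<in> {\<zero>\<^bsub>P\<^esub>}}"
        unfolding tensor_relations_def Let_def X_def[symmetric] F_def[symmetric]
        by (intro Un_least; clarify;
            simp add: Lm gen module_hom_add[OF Lh] module_hom_smult[OF Lh] Lgen bc Pm
              module_hom_add[OF module_bilinearD(1)[OF \<beta>]] module_hom_add[OF module_bilinearD(2)[OF \<beta>]]
              module_hom_smult[OF module_bilinearD(1)[OF \<beta>]] module_hom_smult[OF module_bilinearD(2)[OF \<beta>]])
    qed
    with that show ?thesis by auto
  qed
  have lift: "tensor_lift R M N P \<beta> (K +>\<^bsub>F\<^esub> u) = L u" if u: "u \<in> carrier F" for u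
  proof -
    have "(\<lambda>u. \<Oplus>\<^bsub>P\<^esub>z \<in> {z \<in> carrier M \<times> carrier N. u z \<noteq> \<zero>\<^bsub>R\<^esub>}.
                     u z \<odot>\<^bsub>P\<^esub> \<beta> (fst z) (snd z)) = L"
      by (simp add: L_def direct_sum_lift_def X_def ring_module_def fun_eq_iff)
    moreover have "L ` (K +>\<^bsub>F\<^esub> u) = {L u}"
    proof -
      have "L (k \<oplus>\<^bsub>F\<^esub> u) = L u" if "k \<in> K" for k
        using that u F.submoduleE(1)[OF K] module_hom_closed[OF Lh u]
        by (auto simp: module_hom_add[OF Lh] KL subset_iff)
      moreover have "K \<noteq> {}" using F.submoduleE(2)[OF K] .
      ultimately show ?thesis by (auto simp: a_r_coset_def' image_iff)
    qed
    ultimately show ?thesis unfolding tensor_lift_def by (simp only: the_elem_eq)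
  qed
  have q: "module_hom R F (tensor R M N) (\<lambda>u. K +>\<^bsub>F\<^esub> u)"
    unfolding T by (rule quotient_module_hom[OF F K])
  have surj: "\<exists>u\<in>carrier F. t = K +>\<^bsub>F\<^esub> u" if "t \<in> carrier (tensor R M N)" for t
    using that unfolding T by (auto simp: quotient_module_def A_RCOSETS_def')
  show "module_hom R (tensor R M N) P (tensor_lift R M N P \<beta>)"
  proof (rule module_homI)
    fix t assume "t \<in> carrier (tensor R M N)"
    then obtain u where u: "u \<in> carrier F" "t = K +>\<^bsub>F\<^esub> u" using surj by blast
    then show "tensor_lift R M N P \<beta> t \<in> carrier P"
      by (simp add: lift module_hom_closed[OF Lh])
    show "tensor_lift R M N P \<beta> (a \<odot>\<^bsub>tensor R M N\<^esub> t) = a \<odot>\<^bsub>P\<^esub> tensor_lift R M N P \<beta> t"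
      if "a \<in> carrier R" for a
      using u that by (simp add: lift module_hom_smult[OF q, symmetric] module_hom_smult[OF Lh])
    fix s assume "s \<in> carrier (tensor R M N)"
    then obtain v where v: "v \<in> carrier F" "s = K +>\<^bsub>F\<^esub> v" using surj by blast
    show "tensor_lift R M N P \<beta> (t \<oplus>\<^bsub>tensor R M N\<^esub> s) =
      tensor_lift R M N P \<beta> t \<oplus>\<^bsub>P\<^esub> tensor_lift R M N P \<beta> s"
      using u v by (simp add: lift module_hom_add[OF q, symmetric] module_hom_add[OF Lh])
  qed
  assume "x \<in> carrier M" "y \<in> carrier N"
  then show "tensor_lift R M N P \<beta> (tensor_elem R M N x y) = \<beta> x y"
    using lift[OF gen[of "(x, y)"]] Lgen by (simp add: tensor_elem_def F_def K_def X_def)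
qed

lemma
  assumes "module R M" "module R N" "module R M'" "module R N'"
    and f: "module_hom R M M' f" and g: "module_hom R N N' g"
  shows tensor_map_hom: "module_hom R (tensor R M N) (tensor R M' N') (tensor_map R M N M' N' f g)"
    and tensor_map_elem: "x \<in> carrier M \<Longrightarrow> y \<in> carrier N \<Longrightarrow>
      tensor_map R M N M' N' f g (tensor_elem R M N x y) = tensor_elem R M' N' (f x) (g y)"
proof -
  have "module_bilinear R M N (tensor R M' N') (\<lambda>x y. tensor_elem R M' N' (f x) (g y))"
    unfolding module_bilinear_def
    using module_hom_compose[OF g tensor_elem_hom(1)[OF assms(3,4)]]
      module_hom_compose[OF f tensor_elem_hom(2)[OF assms(3,4)]]
    by (auto simp: module_hom_closed[OF f] module_hom_closed[OF g])
  note * = assms(1,2) tensor_module[OF assms(3,4)] this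
  show "module_hom R (tensor R M N) (tensor R M' N') (tensor_map R M N M' N' f g)"
    unfolding tensor_map_def using * by (rule tensor_lift_hom)
  assume "x \<in> carrier M" "y \<in> carrier N"
  then show "tensor_map R M N M' N' f g (tensor_elem R M N x y) = tensor_elem R M' N' (f x) (g y)"
    unfolding tensor_map_def using tensor_lift_elem[OF *] by simp
qed

lemma tensor_elem_zero_left:
  "module R M \<Longrightarrow> module R N \<Longrightarrow> y \<in> carrier N \<Longrightarrow> tensor_elem R M N \<zero>\<^bsub>M\<^esub> y = \<zero>\<^bsub>tensor R M N\<^esub>"
  by (rule module_hom_zero[OF _ tensor_module tensor_elem_hom(2)])

section \<open>Tensoring with a free module\<close>

text \<open>The standard isomorphism from R^(X) \<otimes> M to a sum of copies of M indexed by X;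
  \<open>tensor_of_coords\<close> is its inverse. It replaces cosets of formal sums by families
  whose equality, support and filtration can be read entry by entry.\<close>

definition tensor_coords ::
  "('r, 'x) ring_scheme \<Rightarrow> 'i set \<Rightarrow> ('r, 'm) module \<Rightarrow> (('i \<Rightarrow> 'r) \<times> 'm \<Rightarrow> 'r) set \<Rightarrow> 'i \<Rightarrow> 'm"
  where "tensor_coords R X M =
    tensor_lift R (free_module R X) M (direct_sum X (\<lambda>_. M)) (\<lambda>u a. \<lambda>j\<in>X. u j \<odot>\<^bsub>M\<^esub> a)"

definition tensor_of_coords ::
  "('r, 'x) ring_scheme \<Rightarrow> 'i set \<Rightarrow> ('r, 'm) module \<Rightarrow> ('i \<Rightarrow> 'm) \<Rightarrow> (('i \<Rightarrow> 'r) \<times> 'm \<Rightarrow> 'r) set"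
  where "tensor_of_coords R X M =
    direct_sum_lift X (\<lambda>_. M) (tensor R (free_module R X) M)
      (\<lambda>j. tensor_elem R (free_module R X) M (free_gen R X j))"

lemma free_module_carrier:
  "u \<in> carrier (free_module R X) \<longleftrightarrow>
    (\<forall>j\<in>X. u j \<in> carrier R) \<and> u \<in> extensional X \<and> finite {j\<in>X. u j \<noteq> \<zero>\<^bsub>R\<^esub>}"
  by (simp add: free_module_def direct_sum_carrier ring_module_def)

lemma coords_bilinear:
  assumes "module R M"
  shows "module_bilinear R (free_module R X) M (direct_sum X (\<lambda>_. M)) (\<lambda>u a. \<lambda>j\<in>X. u j \<odot>\<^bsub>M\<^esub> a)"
proof -
  interpret module R M by fact
  have closed: "(\<lambda>j\<in>X. u j \<odot>\<^bsub>M\<^esub> a) \<in> carrier (direct_sum X (\<lambda>_. M))"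
    if u: "u \<in> carrier (free_module R X)" and a: "a \<in> carrier M" for u a
  proof -
    have "{j\<in>X. u j \<odot>\<^bsub>M\<^esub> a \<noteq> \<zero>\<^bsub>M\<^esub>} \<subseteq> {j\<in>X. u j \<noteq> \<zero>\<^bsub>R\<^esub>}"
      using a by auto
    then have "finite {j\<in>X. u j \<odot>\<^bsub>M\<^esub> a \<noteq> \<zero>\<^bsub>M\<^esub>}"
      by (rule finite_subset) (use u in \<open>simp add: free_module_carrier\<close>)
    then show ?thesis
      using u a by (simp add: free_module_carrier direct_sum_carrier cong: conj_cong)
  qed
  have scomm: "b \<odot>\<^bsub>M\<^esub> (c \<odot>\<^bsub>M\<^esub> a) = c \<odot>\<^bsub>M\<^esub> (b \<odot>\<^bsub>M\<^esub> a)"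
    if "b \<in> carrier R" "c \<in> carrier R" "a \<in> carrier M" for a b c
    using that by (metis R.m_comm smult_assoc1)
  show ?thesis
    unfolding module_bilinear_def
    by (intro conjI ballI module_homI closed; assumption?)
      (auto simp: direct_sum_simps free_module_carrier free_module_def[of R X] ring_module_def fun_eq_iff
        direct_sum_carrier smult_l_distr smult_r_distr smult_assoc1 scomm)
qed

lemma
  assumes M: "module R M"
  shows tensor_coords_hom:
      "module_hom R (tensor R (free_module R X) M) (direct_sum X (\<lambda>_. M)) (tensor_coords R X M)"
    and tensor_coords_elem: "u \<in> carrier (free_module R X) \<Longrightarrow> a \<in> carrier M \<Longrightarrow>
      tensor_coords R X M (tensor_elem R (free_module R X) M u a) = (\<lambda>j\<in>X. u j \<odot>\<^bsub>M\<^esub> a)"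
proof -
  interpret module R M by fact
  note * = free_module_module[OF R.is_cring, of X] M direct_sum_module[of R X "\<lambda>_. M", OF R.is_cring M]
    coords_bilinear[OF M]
  show "module_hom R (tensor R (free_module R X) M) (direct_sum X (\<lambda>_. M)) (tensor_coords R X M)"
    unfolding tensor_coords_def by (rule tensor_lift_hom[OF *])
  show "u \<in> carrier (free_module R X) \<Longrightarrow> a \<in> carrier M \<Longrightarrow>
      tensor_coords R X M (tensor_elem R (free_module R X) M u a) = (\<lambda>j\<in>X. u j \<odot>\<^bsub>M\<^esub> a)"
    unfolding tensor_coords_def using tensor_lift_elem[OF *] by simp
qed

lemma
  assumes M: "module R M"
  shows tensor_of_coords_hom:
      "module_hom R (direct_sum X (\<lambda>_. M)) (tensor R (free_module R X) M) (tensor_of_coords R X M)"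
    and tensor_of_coords_single: "j \<in> X \<Longrightarrow> a \<in> carrier M \<Longrightarrow>
      tensor_of_coords R X M (single X (\<lambda>_. M) j a) =
        tensor_elem R (free_module R X) M (free_gen R X j) a"
proof -
  interpret module R M by fact
  have F: "module R (free_module R X)" by (rule free_module_module[OF R.is_cring])
  have h: "module_hom R M (tensor R (free_module R X) M)
      (tensor_elem R (free_module R X) M (free_gen R X j))" for j
    by (rule tensor_elem_hom(1)[OF F M free_gen_closed[OF R.is_cring]])
  show "module_hom R (direct_sum X (\<lambda>_. M)) (tensor R (free_module R X) M) (tensor_of_coords R X M)"
    unfolding tensor_of_coords_def by (intro direct_sum_lift_hom tensor_module F M h)
  assume "j \<in> X" "a \<in> carrier M"
  then show "tensor_of_coords R X M (single X (\<lambda>_. M) j a) =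
        tensor_elem R (free_module R X) M (free_gen R X j) a"
    unfolding tensor_of_coords_def
    using direct_sum_lift_single[where M = "\<lambda>_. M" and I = X, OF tensor_module[OF F M] M h] by simp
qed

lemma tensor_coords_of_coords:
  assumes M: "module R M" and v: "v \<in> carrier (direct_sum X (\<lambda>_. M))"
  shows "tensor_coords R X M (tensor_of_coords R X M v) = v"
proof -
  interpret module R M by fact
  have S: "module R (direct_sum X (\<lambda>_. M))" by (rule direct_sum_module[OF R.is_cring M])
  show ?thesis
  proof (rule direct_sum_hom_eqI[OF S R.is_cring M
        module_hom_compose[OF tensor_of_coords_hom[OF M] tensor_coords_hom[OF M]] module_hom_ident _ v])
    fix j a assume j: "j \<in> X" "a \<in> carrier M"
    then show "tensor_coords R X M (tensor_of_coords R X M (single X (\<lambda>_. M) j a)) = single X (\<lambda>_. M) j a"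
      unfolding tensor_of_coords_single[OF M j] tensor_coords_elem[OF M free_gen_closed[OF R.is_cring] j(2)]
      by (auto simp: single_def free_gen_def ring_module_def fun_eq_iff)
  qed
qed

text \<open>By linearity first in the tensor and then in its left factor, it is enough to treat (c
  e_j) \<otimes> a. Moving the scalar across gives e_j \<otimes> (ca), whose coordinates are
  concentrated at j.\<close>

lemma tensor_of_coords_coords:
  assumes M: "module R M" and t: "t \<in> carrier (tensor R (free_module R X) M)"
  shows "tensor_of_coords R X M (tensor_coords R X M t) = t"
proof -
  interpret module R M by fact
  have F: "module R (free_module R X)" by (rule free_module_module[OF R.is_cring])
  have T: "module R (tensor R (free_module R X) M)" by (rule tensor_module[OF F M])
  note h = module_hom_compose[OF tensor_coords_hom[OF M, of X] tensor_of_coords_hom[OF M, of X]]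
  show ?thesis
  proof (rule tensor_hom_eqI[OF F M T h module_hom_ident _ t])
    fix u a assume u: "u \<in> carrier (free_module R X)" and a: "a \<in> carrier M"
    note eh = tensor_elem_hom(2)[OF F M a]
    show "tensor_of_coords R X M (tensor_coords R X M (tensor_elem R (free_module R X) M u a)) =
        tensor_elem R (free_module R X) M u a"
    proof (rule direct_sum_hom_eqI[OF T R.is_cring, where M = "\<lambda>_. ring_module R" and I = X,
          folded free_module_def, OF ring_module_module[OF R.is_cring] module_hom_compose[OF eh h] eh _ u])
      fix j c assume j: "j \<in> X" and "c \<in> carrier (ring_module R)"
      then have c: "c \<in> carrier R" by (simp add: ring_module_def)
      let ?s = "single X (\<lambda>_. ring_module R) j c"
      have g: "free_gen R X j \<in> carrier (free_module R X)" by (rule free_gen_closed[OF R.is_cring])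
      have s: "?s = c \<odot>\<^bsub>free_module R X\<^esub> free_gen R X j"
        by (rule single_ring_module_eq[OF R.is_cring c])
      have se: "tensor_elem R (free_module R X) M ?s a = tensor_elem R (free_module R X) M (free_gen R X j) (c \<odot>\<^bsub>M\<^esub> a)"
        unfolding s using module_hom_smult[OF eh c g]
          module_hom_smult[OF tensor_elem_hom(1)[OF F M g] c a] by simp
      have "tensor_coords R X M (tensor_elem R (free_module R X) M ?s a) = single X (\<lambda>_. M) j (c \<odot>\<^bsub>M\<^esub> a)"
        unfolding se tensor_coords_elem[OF M g smult_closed[OF c a]] using c a
        by (auto simp: single_def free_gen_def ring_module_def fun_eq_iff)
      then show "tensor_of_coords R X M (tensor_coords R X M (tensor_elem R (free_module R X) M ?s a)) =
        tensor_elem R (free_module R X) M ?s a"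
        using j c a by (simp add: tensor_of_coords_single[OF M] se)
    qed
  qed
qed

lemma tensor_coord_hom:
  assumes "module R M" "j \<in> X"
  shows "module_hom R (tensor R (free_module R X) M) M (\<lambda>t. tensor_coords R X M t j)"
  using module_hom_compose[OF tensor_coords_hom[OF assms(1)] direct_sum_component_hom[OF assms(2)]] .

text \<open>Naturality of the coordinates in the right factor; it produces the terms d\<alpha>_j and
  d\<beta>_j of the differential.\<close>

lemma tensor_coords_map_right:
  assumes M: "module R M" and N: "module R N" and g: "module_hom R M N g"
    and t: "t \<in> carrier (tensor R (free_module R X) M)" and j: "j \<in> X"
  shows "tensor_coords R X N (tensor_map R (free_module R X) M (free_module R X) N (\<lambda>u. u) g t) j =
    g (tensor_coords R X M t j)"
proof -
  interpret module R M by fact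
  have F: "module R (free_module R X)" by (rule free_module_module[OF R.is_cring])
  show ?thesis
  proof (rule tensor_hom_eqI[OF F M N
        module_hom_compose[OF tensor_map_hom[OF F M F N module_hom_ident g] tensor_coord_hom[OF N j]]
        module_hom_compose[OF tensor_coord_hom[OF M j] g] _ t])
    fix u a assume u: "u \<in> carrier (free_module R X)" and a: "a \<in> carrier M"
    then have "u j \<in> carrier R" using j by (simp add: free_module_carrier)
    then show "tensor_coords R X N (tensor_map R (free_module R X) M (free_module R X) N (\<lambda>u. u) g
        (tensor_elem R (free_module R X) M u a)) j =
      g (tensor_coords R X M (tensor_elem R (free_module R X) M u a) j)"
      using u a j by (simp add: tensor_map_elem[OF F M F N module_hom_ident g] tensor_coords_elem[OF M]
          tensor_coords_elem[OF N] module_hom_closed[OF g] module_hom_smult[OF g])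
  qed
qed

text \<open>Disposes of the part of the differential that enters degree 0 of Q_rS from degree
  -1.\<close>

lemma tensor_map_zero_left:
  assumes "module R M" "module R N" "module R M'" "module R N'"
    and f: "module_hom R M M' f" and g: "module_hom R N N' g"
    and "\<And>x. x \<in> carrier M \<Longrightarrow> f x = \<zero>\<^bsub>M'\<^esub>" and t: "t \<in> carrier (tensor R M N)"
  shows "tensor_map R M N M' N' f g t = \<zero>\<^bsub>tensor R M' N'\<^esub>"
proof (rule tensor_hom_eqI[OF assms(1,2) tensor_module[OF assms(3,4)] tensor_map_hom[OF assms(1-4) f g]
      module_hom_const_zero[OF tensor_module[OF assms(3,4)]] _ t])
  fix x y assume "x \<in> carrier M" "y \<in> carrier N"
  then show "tensor_map R M N M' N' f g (tensor_elem R M N x y) = \<zero>\<^bsub>tensor R M' N'\<^esub>"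
    using assms(7) by (simp add: tensor_map_elem[OF assms(1-4) f g] tensor_elem_zero_left[OF assms(3,4)]
        module_hom_closed[OF g])
qed

section \<open>The complex \<open>Q\<^sub>r\<S>\<close>\<close>

lemma Q_piece_free: "Q_piece R r n = free_module R (Q_index n)"
  by (simp add: Q_piece_def free_module_def base_def)

lemma Q_gen_free: "Q_gen R r n j = free_gen R (Q_index n) j"
  by (simp add: Q_gen_def free_gen_def base_def ring_module_def)

lemma Q_complex_simps:
  "piece (Q_complex R r) = (\<lambda>n. free_module R (Q_index n))"
  "filt (Q_complex R r) p n = {u \<in> carrier (free_module R (Q_index n)).
    \<forall>i\<in>Q_index n. p < Q_weight r n i \<longrightarrow> u i = \<zero>\<^bsub>R\<^esub>}"
  by (auto simp: Q_complex_def Q_piece_free fun_eq_iff base_def free_module_carrier)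

text \<open>Recognising the sum over the support as the universal map out of a free module makes the
  differential linear and determined by the generators.\<close>

lemma Q_differential_lift:
  "differential (Q_complex R r) 0 = direct_sum_lift UNIV (\<lambda>_. ring_module R) (free_module R (Q_index 1))
    (\<lambda>i c. c \<odot>\<^bsub>free_module R (Q_index 1)\<^esub> Q_d_gen R r i)"
  by (simp add: Q_complex_def Q_piece_free direct_sum_lift_def fun_eq_iff ring_module_def)

lemma Q_differential_nonzero:
  "n \<noteq> 0 \<Longrightarrow> differential (Q_complex R r) n u = \<zero>\<^bsub>free_module R (Q_index (n + 1))\<^esub>"
  by (simp add: Q_complex_def Q_piece_free)

lemma Q_d_gen_closed:
  assumes "cring R"
  shows "Q_d_gen R r i \<in> carrier (free_module R (Q_index 1))"
proof -
  interpret F: module R "free_module R (Q_index 1)" by (rule free_module_module[OF assms])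
  show ?thesis
    by (simp add: Q_d_gen_def Q_gen_free Q_piece_free free_gen_closed[OF assms])
qed

lemma Q_differential_hom:
  assumes "cring R"
  shows "module_hom R (free_module R (Q_index n)) (free_module R (Q_index (n + 1)))
    (differential (Q_complex R r) n)"
proof (cases "n = 0")
  case True
  then show ?thesis
    using direct_sum_lift_hom[where M = "\<lambda>_. ring_module R" and I = UNIV,
        OF free_module_module[OF assms] ring_module_module[OF assms]
          module_hom_smult_left[OF free_module_module[OF assms] Q_d_gen_closed[OF assms]]]
    by (simp add: Q_differential_lift Q_index_def free_module_def[of R UNIV])
next
  case False
  have "differential (Q_complex R r) n = (\<lambda>u. \<zero>\<^bsub>free_module R (Q_index (n + 1))\<^esub>)"
    using False by (simp add: fun_eq_iff Q_differential_nonzero)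
  then show ?thesis
    by (simp add: module_hom_const_zero[OF free_module_module[OF assms]])
qed

text \<open>The degree 1 generator with index j occurs in the differentials of exactly the degree 0
  generators j - 1 and j. The special value at generator 0 is the general formula with the absent
  degree 1 index 0 dropped, so j = 1 is no exception.\<close>

lemma Q_differential_coord:
  assumes "cring R" "u \<in> carrier (free_module R (Q_index 0))" "1 \<le> j"
  shows "differential (Q_complex R r) 0 u j = u (j - 1) \<oplus>\<^bsub>R\<^esub> u j"
proof -
  interpret cring R by fact
  have j: "j \<in> Q_index 1" using assms(3) by (simp add: Q_index_def)
  have u: "u \<in> carrier (direct_sum UNIV (\<lambda>_::nat. ring_module R))"
    using assms(2) by (simp add: free_module_def Q_index_def)
  note rm = ring_module_module[OF assms(1)]
  have F: "module R (free_module R (Q_index 1))" by (rule free_module_module[OF assms(1)])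
  have g: "module_hom R (ring_module R) (free_module R (Q_index 1))
      (\<lambda>c. c \<odot>\<^bsub>free_module R (Q_index 1)\<^esub> Q_d_gen R r i)" for i
    by (rule module_hom_smult_left[OF F Q_d_gen_closed[OF assms(1)]])
  have d: "module_hom R (direct_sum UNIV (\<lambda>_. ring_module R)) (free_module R (Q_index 1)) (differential (Q_complex R r) 0)"
    using Q_differential_hom[OF assms(1), of 0 r] by (simp add: free_module_def[of R "UNIV :: nat set"] Q_index_def[of 0])
  have pr: "module_hom R (free_module R (Q_index 1)) (ring_module R) (\<lambda>v. v j)"
    unfolding free_module_def by (rule direct_sum_component_hom[OF j])
  have comp: "module_hom R (direct_sum UNIV (\<lambda>_. ring_module R)) (ring_module R) (\<lambda>u. u k)" for k :: nat
    by (rule direct_sum_component_hom) simp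
  have "differential (Q_complex R r) 0 u j = u (j - 1) \<oplus>\<^bsub>ring_module R\<^esub> u j"
  proof (rule direct_sum_hom_eqI[OF rm assms(1) rm module_hom_compose[OF d pr]
        module_hom_sum[OF rm comp comp] _ u])
    fix i c assume "c \<in> carrier (ring_module R)"
    then have c: "c \<in> carrier R" by (simp add: ring_module_def)
    have "differential (Q_complex R r) 0 (single UNIV (\<lambda>_. ring_module R) i c) =
      c \<odot>\<^bsub>free_module R (Q_index 1)\<^esub> Q_d_gen R r i"
      unfolding Q_differential_lift using c
      by (subst direct_sum_lift_single[OF F rm g]) (auto simp: ring_module_def)
    then show "differential (Q_complex R r) 0 (single UNIV (\<lambda>_. ring_module R) i c) j =
      single UNIV (\<lambda>_. ring_module R) i c (j - 1) \<oplus>\<^bsub>ring_module R\<^esub> single UNIV (\<lambda>_. ring_module R) i c j"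
      using c assms(3) by (auto simp: Q_d_gen_def Q_gen_free Q_piece_free free_module_def direct_sum_simps
          free_gen_def single_def ring_module_def Q_index_def r_distr)
  qed
  then show ?thesis by (simp add: ring_module_def)
qed

lemma tensor_coords_Q_differential:
  assumes M: "module R M" and t: "t \<in> carrier (tensor R (free_module R (Q_index 0)) M)" and j: "1 \<le> j"
  shows "tensor_coords R (Q_index 1) M
      (tensor_map R (free_module R (Q_index 0)) M (free_module R (Q_index 1)) M
        (differential (Q_complex R r) 0) (\<lambda>a. a) t) j =
    tensor_coords R (Q_index 0) M t (j - 1) \<oplus>\<^bsub>M\<^esub> tensor_coords R (Q_index 0) M t j"
proof -
  interpret module R M by fact
  have F: "module R (free_module R (Q_index n))" for n by (rule free_module_module[OF R.is_cring])
  have j1: "j \<in> Q_index 1" using j by (simp add: Q_index_def)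
  have j0: "k \<in> Q_index 0" for k by (simp add: Q_index_def)
  have d: "module_hom R (free_module R (Q_index 0)) (free_module R (Q_index 1)) (differential (Q_complex R r) 0)"
    using Q_differential_hom[OF R.is_cring, of 0 r] by simp
  show ?thesis
  proof (rule tensor_hom_eqI[OF F M M
        module_hom_compose[OF tensor_map_hom[OF F M F M d module_hom_ident] tensor_coord_hom[OF M j1]]
        module_hom_sum[OF M tensor_coord_hom[OF M j0] tensor_coord_hom[OF M j0]] _ t])
    fix u a assume u: "u \<in> carrier (free_module R (Q_index 0))" and a: "a \<in> carrier M"
    have "u k \<in> carrier R" for k using u j0 by (simp add: free_module_carrier)
    then show "tensor_coords R (Q_index 1) M
      (tensor_map R (free_module R (Q_index 0)) M (free_module R (Q_index 1)) M
        (differential (Q_complex R r) 0) (\<lambda>a. a) (tensor_elem R (free_module R (Q_index 0)) M u a)) j =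
      tensor_coords R (Q_index 0) M (tensor_elem R (free_module R (Q_index 0)) M u a) (j - 1) \<oplus>\<^bsub>M\<^esub>
      tensor_coords R (Q_index 0) M (tensor_elem R (free_module R (Q_index 0)) M u a) j"
      using u a j0 j1 j
      by (simp add: tensor_map_elem[OF F M F M d module_hom_ident] tensor_coords_elem[OF M]
          module_hom_closed[OF d] Q_differential_coord[OF R.is_cring] smult_l_distr)
  qed
qed

section \<open>The complex \<open>Q\<^sub>r\<S> \<otimes> A\<close> in coordinates\<close>

text \<open>A family over the empty set has no freedom, and coordinates determine the tensor. This
  kills the summands coming from degrees of Q_rS other than 0 and 1.\<close>

lemma tensor_free_empty:
  assumes M: "module R M" and X: "X = {}" and t: "t \<in> carrier (tensor R (free_module R X) M)"
  shows "t = \<zero>\<^bsub>tensor R (free_module R X) M\<^esub>"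
proof -
  interpret module R M by fact
  have S: "module R (direct_sum X (\<lambda>_. M))" by (rule direct_sum_module[OF R.is_cring M])
  have T: "module R (tensor R (free_module R X) M)"
    by (rule tensor_module[OF free_module_module[OF R.is_cring] M])
  have "tensor_coords R X M t \<in> carrier (direct_sum X (\<lambda>_. M))"
    by (rule module_hom_closed[OF tensor_coords_hom[OF M] t])
  then have "tensor_coords R X M t = \<zero>\<^bsub>direct_sum X (\<lambda>_. M)\<^esub>"
    using X by (simp add: direct_sum_carrier direct_sum_simps fun_eq_iff)
  then show ?thesis
    using tensor_of_coords_coords[OF M t] module_hom_zero[OF S T tensor_of_coords_hom[OF M]] by simp
qed

context filtered_complex
begin

abbreviation Q_tensor :: "int \<Rightarrow> ('r, int \<Rightarrow> ((nat \<Rightarrow> 'r) \<times> 'm \<Rightarrow> 'r) set) module"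
  where "Q_tensor \<equiv> graded_tensor R (\<lambda>i. free_module R (Q_index i)) (piece A)"

text \<open>Here \<open>n\<close> is the total degree, \<open>i\<close> the degree in Q_rS and
  \<open>j\<close> the index of the generator. Thus \<open>coord n 0 j\<close> is the overview's
  \<alpha>_j and \<open>coord n 1 j\<close> its \<beta>_j. Values matter only for \<open>j\<close>
  in \<open>Q_index i\<close>.\<close>

definition coord :: "int \<Rightarrow> int \<Rightarrow> nat \<Rightarrow> (int \<Rightarrow> ((nat \<Rightarrow> 'r) \<times> 'm \<Rightarrow> 'r) set) \<Rightarrow> 'm"
  where "coord n i j h = tensor_coords R (Q_index i) (piece A (n - i)) (h i) j"

abbreviation Q_differential :: "nat \<Rightarrow> int \<Rightarrow> (int \<Rightarrow> ((nat \<Rightarrow> 'r) \<times> 'm \<Rightarrow> 'r) set) \<Rightarrow> int \<Rightarrow> ((nat \<Rightarrow> 'r) \<times> 'm \<Rightarrow> 'r) set"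
  where "Q_differential r n h \<equiv> tensor_differential R (Q_complex R r) A n h"

lemma filt_le: "p \<le> q \<Longrightarrow> x \<in> filt A p n \<Longrightarrow> x \<in> filt A q n"
proof (induction q rule: int_ge_induct)
  case (step q)
  then show ?case using filt_mono[of q n] by auto
qed

lemma free_Q_module: "module R (free_module R (Q_index i))"
  by (rule free_module_module[OF is_cring])

lemma tensor_Q_module: "module R (tensor R (free_module R (Q_index i)) (piece A m))"
  by (rule tensor_module[OF free_Q_module piece_module])

lemma Q_tensor_module: "module R (Q_tensor n)"
  unfolding graded_tensor_def by (rule direct_sum_module[OF is_cring tensor_Q_module])

text \<open>Finite support over the degrees \<open>i\<close> is automatic, because only the summands
  at 0 and 1 can be nonzero.\<close>

lemma Q_tensor_carrier:
  "h \<in> carrier (Q_tensor n) \<longleftrightarrow>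
    (\<forall>i. h i \<in> carrier (tensor R (free_module R (Q_index i)) (piece A (n - i))))" (is "_ \<longleftrightarrow> ?R")
proof
  assume h: ?R
  have "h i = \<zero>\<^bsub>tensor R (free_module R (Q_index i)) (piece A (n - i))\<^esub>" if "i \<noteq> 0" "i \<noteq> 1" for i
    using tensor_free_empty[OF piece_module, of "Q_index i" "h i"] h[rule_format, of i] that Q_index_def by simp
  then have "{i. h i \<noteq> \<zero>\<^bsub>tensor R (free_module R (Q_index i)) (piece A (n - i))\<^esub>} \<subseteq> {0, 1}"
    by auto
  then have "finite {i. h i \<noteq> \<zero>\<^bsub>tensor R (free_module R (Q_index i)) (piece A (n - i))\<^esub>}"
    by (rule finite_subset) simp
  then show "h \<in> carrier (Q_tensor n)"
    using h by (simp add: graded_tensor_def direct_sum_carrier)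
qed (simp add: graded_tensor_def direct_sum_carrier)

lemma Q_tensor_component_hom:
  "module_hom R (Q_tensor n) (tensor R (free_module R (Q_index i)) (piece A (n - i))) (\<lambda>h. h i)"
  unfolding graded_tensor_def by (rule direct_sum_component_hom) simp

text \<open>Component maps ordinarily assemble to a map into a product. Here they land in the direct
  sum because all but two summands vanish.\<close>

lemma Q_tensor_hom_into:
  assumes "\<And>i. module_hom R M (tensor R (free_module R (Q_index i)) (piece A (n - i))) (\<lambda>x. f x i)"
  shows "module_hom R M (Q_tensor n) f"
proof (rule module_homI)
  show "f x \<in> carrier (Q_tensor n)" if "x \<in> carrier M" for x
    unfolding Q_tensor_carrier using module_hom_closed[OF assms that] by blast
  show "f (x \<oplus>\<^bsub>M\<^esub> y) = f x \<oplus>\<^bsub>Q_tensor n\<^esub> f y" if "x \<in> carrier M" "y \<in> carrier M" for x y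
    using module_hom_add[OF assms that] by (simp add: graded_tensor_def direct_sum_simps fun_eq_iff)
  show "f (a \<odot>\<^bsub>M\<^esub> x) = a \<odot>\<^bsub>Q_tensor n\<^esub> f x" if "a \<in> carrier R" "x \<in> carrier M" for a x
    using module_hom_smult[OF assms that] by (simp add: graded_tensor_def direct_sum_simps fun_eq_iff)
qed

lemma coord_hom: "j \<in> Q_index i \<Longrightarrow> module_hom R (Q_tensor n) (piece A (n - i)) (coord n i j)"
  unfolding coord_def
  by (rule module_hom_compose[OF Q_tensor_component_hom tensor_coord_hom[OF piece_module]])

lemma coord_finite:
  assumes "h \<in> carrier (Q_tensor n)"
  shows "finite {j\<in>Q_index i. coord n i j h \<noteq> \<zero>\<^bsub>piece A (n - i)\<^esub>}"
  using module_hom_closed[OF tensor_coords_hom[OF piece_module], of "h i"] assms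
  unfolding coord_def Q_tensor_carrier by (simp add: direct_sum_carrier)

lemma coord_eqI:
  assumes "h \<in> carrier (Q_tensor n)" "h' \<in> carrier (Q_tensor n)"
    and "\<And>i j. j \<in> Q_index i \<Longrightarrow> coord n i j h = coord n i j h'"
  shows "h = h'"
proof
  fix i
  let ?c = "tensor_coords R (Q_index i) (piece A (n - i))"
  have t: "h i \<in> carrier (tensor R (free_module R (Q_index i)) (piece A (n - i)))"
    "h' i \<in> carrier (tensor R (free_module R (Q_index i)) (piece A (n - i)))"
    using assms(1,2) by (simp_all add: Q_tensor_carrier)
  have "?c (h i) \<in> extensional (Q_index i)" "?c (h' i) \<in> extensional (Q_index i)"
    using t[THEN module_hom_closed[OF tensor_coords_hom[OF piece_module]]] by (simp_all add: direct_sum_carrier)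
  moreover have "?c (h i) j = ?c (h' i) j" if "j \<in> Q_index i" for j
    using assms(3)[OF that] by (simp add: coord_def)
  ultimately have "?c (h i) = ?c (h' i)" by (rule extensionalityI)
  then show "h i = h' i"
    using t[THEN tensor_of_coords_coords[OF piece_module]] by metis
qed

text \<open>Together with \<open>coord_eqI\<close> this identifies elements of the tensor product
  with families of coordinates of finite support, so witnesses can be prescribed coordinate by
  coordinate.\<close>

lemma coord_exists:
  assumes "\<And>i j. j \<in> Q_index i \<Longrightarrow> v i j \<in> carrier (piece A (n - i))"
    and "\<And>i. finite {j\<in>Q_index i. v i j \<noteq> \<zero>\<^bsub>piece A (n - i)\<^esub>}"
  shows "\<exists>h\<in>carrier (Q_tensor n). \<forall>i. \<forall>j\<in>Q_index i. coord n i j h = v i j"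
proof
  let ?v = "\<lambda>i. restrict (v i) (Q_index i)"
  let ?h = "\<lambda>i. tensor_of_coords R (Q_index i) (piece A (n - i)) (?v i)"
  have v: "?v i \<in> carrier (direct_sum (Q_index i) (\<lambda>_. piece A (n - i)))" for i
    using assms by (simp add: direct_sum_carrier cong: conj_cong)
  show "?h \<in> carrier (Q_tensor n)"
    unfolding Q_tensor_carrier using module_hom_closed[OF tensor_of_coords_hom[OF piece_module] v] by blast
  show "\<forall>i. \<forall>j\<in>Q_index i. coord n i j ?h = v i j"
    by (simp add: coord_def tensor_coords_of_coords[OF piece_module v])
qed

lemma Q_differential_component_homs:
  fixes n i :: int
  shows "module_hom R (tensor R (free_module R (Q_index (i - 1))) (piece A (n + 1 - i)))
      (tensor R (free_module R (Q_index i)) (piece A (n + 1 - i)))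
      (tensor_map R (free_module R (Q_index (i - 1))) (piece A (n + 1 - i))
        (free_module R (Q_index i)) (piece A (n + 1 - i)) (differential (Q_complex R r) (i - 1)) (\<lambda>b. b))"
    and "module_hom R (tensor R (free_module R (Q_index i)) (piece A (n - i)))
      (tensor R (free_module R (Q_index i)) (piece A (n + 1 - i)))
      (tensor_map R (free_module R (Q_index i)) (piece A (n - i))
        (free_module R (Q_index i)) (piece A (n + 1 - i)) (\<lambda>a. a) (differential A (n - i)))"
proof -
  have "module_hom R (free_module R (Q_index (i - 1))) (free_module R (Q_index i))
      (differential (Q_complex R r) (i - 1))"
    using Q_differential_hom[OF is_cring, of "i - 1" r] by simp
  moreover have "module_hom R (piece A (n - i)) (piece A (n + 1 - i)) (differential A (n - i))"
    using differential_hom[of "n - i"] by (simp add: algebra_simps)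
  ultimately show "module_hom R (tensor R (free_module R (Q_index (i - 1))) (piece A (n + 1 - i)))
      (tensor R (free_module R (Q_index i)) (piece A (n + 1 - i)))
      (tensor_map R (free_module R (Q_index (i - 1))) (piece A (n + 1 - i))
        (free_module R (Q_index i)) (piece A (n + 1 - i)) (differential (Q_complex R r) (i - 1)) (\<lambda>b. b))"
    and "module_hom R (tensor R (free_module R (Q_index i)) (piece A (n - i)))
      (tensor R (free_module R (Q_index i)) (piece A (n + 1 - i)))
      (tensor_map R (free_module R (Q_index i)) (piece A (n - i))
        (free_module R (Q_index i)) (piece A (n + 1 - i)) (\<lambda>a. a) (differential A (n - i)))"
    by - (rule tensor_map_hom[OF free_Q_module piece_module free_Q_module piece_module _ module_hom_ident]
        tensor_map_hom[OF free_Q_module piece_module free_Q_module piece_module module_hom_ident], assumption)+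
qed

lemma Q_tensor_differential_hom: "module_hom R (Q_tensor n) (Q_tensor (n + 1)) (Q_differential r n)"
proof (rule Q_tensor_hom_into)
  fix i
  let ?T = "tensor R (free_module R (Q_index i)) (piece A (n + 1 - i))"
  \<comment> \<open>The summand at \<open>i - 1\<close> of total degree \<open>n\<close> and the
    summand at \<open>i\<close> of total degree \<open>n + 1\<close> involve the same piece of A;
    the two ways of writing its degree must be matched before the maps compose.\<close>
  have eq: "n - (i - 1) = n + 1 - i" by simp
  note u = module_hom_compose[OF Q_tensor_component_hom[where n = n and i = "i - 1", unfolded eq]
      Q_differential_component_homs(1)]
  note v = module_hom_compose[OF Q_tensor_component_hom[where n = n and i = i] Q_differential_component_homs(2)]
  show "module_hom R (Q_tensor n) ?T (\<lambda>h. Q_differential r n h i)"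
    unfolding tensor_differential_def Let_def Q_complex_simps
    using module_hom_sum[OF tensor_Q_module u v]
      module_hom_sum[OF tensor_Q_module u module_hom_neg[OF tensor_Q_module v]]
    by (cases "even i") simp_all
qed

text \<open>The contribution from the left factor starts in degree -1 of Q_rS, where the
  differential is zero, and the sign is positive because 0 is even.\<close>

lemma coord_differential_0:
  assumes h: "h \<in> carrier (Q_tensor n)"
  shows "coord (n + 1) 0 j (Q_differential r n h) = differential A n (coord n 0 j h)"
proof -
  interpret T: module R "tensor R (free_module R (Q_index 0)) (piece A (n + 1))" by (rule tensor_Q_module)
  have j: "j \<in> Q_index 0" by (simp add: Q_index_def)
  have h0: "h 0 \<in> carrier (tensor R (free_module R (Q_index 0)) (piece A n))"
    and h1: "h (- 1) \<in> carrier (tensor R (free_module R (Q_index (- 1))) (piece A (n + 1)))"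
    using h[unfolded Q_tensor_carrier, rule_format, of 0] h[unfolded Q_tensor_carrier, rule_format, of "- 1"]
    by simp_all
  have dQ: "module_hom R (free_module R (Q_index (- 1))) (free_module R (Q_index 0)) (differential (Q_complex R r) (- 1))"
    using Q_differential_hom[OF is_cring, of "- 1" r] by simp
  have "tensor_map R (free_module R (Q_index (- 1))) (piece A (n + 1)) (free_module R (Q_index 0)) (piece A (n + 1))
      (differential (Q_complex R r) (- 1)) (\<lambda>b. b) (h (- 1)) =
    \<zero>\<^bsub>tensor R (free_module R (Q_index 0)) (piece A (n + 1))\<^esub>"
    using Q_differential_nonzero[of "- 1" R r]
    by (intro tensor_map_zero_left free_Q_module piece_module dQ module_hom_ident h1) simp
  moreover have "tensor_map R (free_module R (Q_index 0)) (piece A n) (free_module R (Q_index 0)) (piece A (n + 1))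
      (\<lambda>a. a) (differential A n) (h 0) \<in> carrier (tensor R (free_module R (Q_index 0)) (piece A (n + 1)))"
    using module_hom_closed[OF Q_differential_component_homs(2)[of 0 n], of "h 0"] h0 by simp
  ultimately show ?thesis
    using tensor_coords_map_right[OF piece_module piece_module differential_hom h0 j]
    by (simp add: coord_def tensor_differential_def Let_def Q_complex_simps)
qed

text \<open>The first two terms come from the differential of Q_rS. The minus sign is the Koszul
  sign of a left factor of degree 1.\<close>

lemma coord_differential_1:
  assumes h: "h \<in> carrier (Q_tensor n)" and j: "1 \<le> j"
  shows "coord (n + 1) 1 j (Q_differential r n h) =
    coord n 0 (j - 1) h \<oplus>\<^bsub>piece A n\<^esub> coord n 0 j h \<ominus>\<^bsub>piece A n\<^esub> differential A (n - 1) (coord n 1 j h)"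
proof -
  let ?T = "tensor R (free_module R (Q_index 1)) (piece A n)"
  interpret T: module R ?T by (rule tensor_Q_module)
  interpret An: module R "piece A n" by (rule piece_module)
  have j1: "j \<in> Q_index 1" using j by (simp add: Q_index_def)
  have h0: "h 0 \<in> carrier (tensor R (free_module R (Q_index 0)) (piece A n))"
    and h1: "h 1 \<in> carrier (tensor R (free_module R (Q_index 1)) (piece A (n - 1)))"
    using h[unfolded Q_tensor_carrier, rule_format, of 0] h[unfolded Q_tensor_carrier, rule_format, of 1]
    by simp_all
  let ?u = "tensor_map R (free_module R (Q_index 0)) (piece A n) (free_module R (Q_index 1)) (piece A n)
      (differential (Q_complex R r) 0) (\<lambda>b. b) (h 0)"
  let ?v = "tensor_map R (free_module R (Q_index 1)) (piece A (n - 1)) (free_module R (Q_index 1)) (piece A n)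
      (\<lambda>a. a) (differential A (n - 1)) (h 1)"
  have u: "?u \<in> carrier ?T"
    using module_hom_closed[OF Q_differential_component_homs(1)[of 1 n r], of "h 0"] h0 by simp
  have v: "?v \<in> carrier ?T"
    using module_hom_closed[OF Q_differential_component_homs(2)[of 1 n], of "h 1"] h1 by simp
  note c = tensor_coord_hom[OF piece_module[of n] j1]
  have "coord (n + 1) 1 j (Q_differential r n h) =
      tensor_coords R (Q_index 1) (piece A n) (?u \<oplus>\<^bsub>?T\<^esub> \<ominus>\<^bsub>?T\<^esub> ?v) j"
    by (simp add: coord_def tensor_differential_def Let_def Q_complex_simps)
  also have "\<dots> = tensor_coords R (Q_index 1) (piece A n) ?u j \<oplus>\<^bsub>piece A n\<^esub>
      \<ominus>\<^bsub>piece A n\<^esub> tensor_coords R (Q_index 1) (piece A n) ?v j"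
    using module_hom_add[OF c u T.M.a_inv_closed[OF v]]
      module_hom_uminus[OF tensor_Q_module piece_module c v] by simp
  also have "tensor_coords R (Q_index 1) (piece A n) ?u j = coord n 0 (j - 1) h \<oplus>\<^bsub>piece A n\<^esub> coord n 0 j h"
    using tensor_coords_Q_differential[OF piece_module h0 j] by (simp add: coord_def)
  also have "tensor_coords R (Q_index 1) (piece A n) ?v j = differential A (n - 1) (coord n 1 j h)"
    using tensor_coords_map_right[OF piece_module piece_module _ h1 j1, of n "differential A (n - 1)"]
      differential_hom[of "n - 1"] by (simp add: coord_def)
  finally show ?thesis by (simp add: An.M.minus_eq)
qed

end

section \<open>The filtration of the tensor product in coordinates\<close>

context filtered_complex
begin

lemma Q_filt_submodule: "submodule (filt (Q_complex R r) p n) R (free_module R (Q_index n))"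
proof -
  have "submodule {u \<in> carrier (free_module R (Q_index n)).
      \<forall>i\<in>{i\<in>Q_index n. p < Q_weight r n i}. u i \<in> {\<zero>\<^bsub>ring_module R\<^esub>}} R (free_module R (Q_index n))"
    unfolding free_module_def
    by (intro submodule_Collect_ball direct_sum_module ring_module_module is_cring
        submodule_vimage[OF _ _ direct_sum_component_hom submodule_zero]) auto
  then show ?thesis by (simp add: Q_complex_simps ring_module_def Ball_def imp_conjL)
qed

text \<open>On x \<otimes> y with x in F_q and y in F_{p-q} the coordinate is x_j y. If q is below
  the weight w of generator j then x_j = 0; otherwise p - q \<le> p - w, and y already lies in
  F_{p-w}.\<close>

lemma tensor_coords_filt:
  assumes t: "t \<in> carrier (tensor R (restrict_module (free_module R (Q_index i)) (filt (Q_complex R r) q i))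
      (restrict_module (piece A m) (filt A (p - q) m)))" (is "_ \<in> carrier (tensor R ?FQ ?FA)")
    and j: "j \<in> Q_index i"
  shows "tensor_coords R (Q_index i) (piece A m)
      (tensor_map R ?FQ ?FA (free_module R (Q_index i)) (piece A m) (\<lambda>a. a) (\<lambda>b. b) t) j
    \<in> filt A (p - Q_weight r i j) m"
proof -
  interpret Am: module R "piece A m" by (rule piece_module)
  have FQ: "module R ?FQ" by (rule module_restrict[OF free_Q_module Q_filt_submodule])
  have FA: "module R ?FA" by (rule module_restrict[OF piece_module filt_submodule])
  have sub: "filt (Q_complex R r) q i \<subseteq> carrier (free_module R (Q_index i))" "filt A (p - q) m \<subseteq> carrier (piece A m)"
    using Am.submoduleE(1)[OF filt_submodule] by (auto simp: Q_complex_simps)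
  note f = module_hom_restrict[OF module_hom_ident sub(1)] and g = module_hom_restrict[OF module_hom_ident sub(2)]
  note h = module_hom_compose[OF tensor_map_hom[OF FQ FA free_Q_module piece_module f g]
      tensor_coord_hom[OF piece_module j]]
  note K = submodule_vimage[OF tensor_module[OF FQ FA] piece_module h filt_submodule[of "p - Q_weight r i j" m]]
  interpret K: module R "tensor R ?FQ ?FA" by (rule tensor_module[OF FQ FA])
  have "t \<in> {t \<in> carrier (tensor R ?FQ ?FA). tensor_coords R (Q_index i) (piece A m)
      (tensor_map R ?FQ ?FA (free_module R (Q_index i)) (piece A m) (\<lambda>a. a) (\<lambda>b. b) t) j
    \<in> filt A (p - Q_weight r i j) m}" (is "_ \<in> ?K")
    using FQ FA t
  proof (induction rule: tensor_induct)
    case zero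
    show ?case using subgroup.one_closed[OF submodule.axioms(1)[OF K]] by simp
  next
    case (add s t)
    show ?case using K.submoduleE(5)[OF K] add by blast
  next
    case (elem x y)
    then have x: "x \<in> filt (Q_complex R r) q i" and y: "y \<in> filt A (p - q) m"
      by (simp_all add: restrict_module_def)
    then have xc: "x \<in> carrier (free_module R (Q_index i))" and yc: "y \<in> carrier (piece A m)" using sub by auto
    have "x j \<odot>\<^bsub>piece A m\<^esub> y \<in> filt A (p - Q_weight r i j) m"
    proof (cases "q < Q_weight r i j")
      case True
      then have "x j = \<zero>" using x j by (simp add: Q_complex_simps)
      then show ?thesis
        using yc subgroup.one_closed[OF submodule.axioms(1)[OF filt_submodule[of "p - Q_weight r i j" m]]] by simp
    next
      case False
      then have "y \<in> filt A (p - Q_weight r i j) m" using filt_le[of "p - q" _ y m] y by simp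
      moreover have "x j \<in> carrier R" using xc j by (simp add: free_module_carrier)
      ultimately show ?thesis using Am.submoduleE(4)[OF filt_submodule] by blast
    qed
    then show ?case
      using elem xc yc j tensor_elem_hom(3)[OF FQ FA elem]
      by (simp add: tensor_map_elem[OF FQ FA free_Q_module piece_module f g] tensor_coords_elem[OF piece_module])
  qed
  then show ?thesis by simp
qed

text \<open>The tensor of a generator with \<open>a\<close> lies in a single term of the sum
  defining F_p: the one whose index is the weight of that generator.\<close>

lemma Q_tensor_filt_generator:
  assumes j: "j \<in> Q_index i" and a: "a \<in> filt A (p - Q_weight r i j) (n - i)"
  shows "single UNIV (\<lambda>i. tensor R (free_module R (Q_index i)) (piece A (n - i))) i
      (tensor_elem R (free_module R (Q_index i)) (piece A (n - i)) (free_gen R (Q_index i) j) a)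
    \<in> tensor_filt R (Q_complex R r) A p n"
proof -
  \<comment> \<open>The weight is the lowest filtration step containing the generator, and it leaves
    exactly F_{p-q} for \<open>a\<close>.\<close>
  let ?q = "Q_weight r i j"
  define FQ where "FQ k = restrict_module (free_module R (Q_index k)) (filt (Q_complex R r) ?q k)" for k
  define FA where "FA k = restrict_module (piece A k) (filt A (p - ?q) k)" for k
  have FQ: "module R (FQ k)" for k unfolding FQ_def by (rule module_restrict[OF free_Q_module Q_filt_submodule])
  have FA: "module R (FA k)" for k unfolding FA_def by (rule module_restrict[OF piece_module filt_submodule])
  have sub: "filt (Q_complex R r) ?q k \<subseteq> carrier (free_module R (Q_index k))" "filt A (p - ?q) k \<subseteq> carrier (piece A k)" for k
    using module.submoduleE(1)[OF piece_module filt_submodule] by (auto simp: Q_complex_simps)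
  have f: "module_hom R (FQ k) (free_module R (Q_index k)) (\<lambda>a. a)"
    and g: "module_hom R (FA k) (piece A k) (\<lambda>a. a)" for k
    unfolding FQ_def FA_def by (rule module_hom_restrict[OF module_hom_ident sub(1)],
        rule module_hom_restrict[OF module_hom_ident sub(2)])
  let ?M = "\<lambda>k. tensor R (FQ k) (FA (n - k))"
  let ?N = "\<lambda>k. tensor R (free_module R (Q_index k)) (piece A (n - k))"
  have M: "module R (?M k)" for k by (rule tensor_module[OF FQ FA])
  let ?e = "tensor_elem R (FQ i) (FA (n - i)) (free_gen R (Q_index i) j) a"
  let ?h = "single UNIV ?M i ?e"
  have e: "free_gen R (Q_index i) j \<in> carrier (FQ i)" and a': "a \<in> carrier (FA (n - i))"
    using a free_gen_closed[OF is_cring, of "Q_index i" j]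
    by (auto simp: FQ_def FA_def restrict_module_def Q_complex_simps free_gen_def single_def ring_module_def)
  have h: "?h \<in> carrier (graded_tensor R FQ FA n)"
    unfolding graded_tensor_def by (rule single_closed[where M = ?M and j = i, OF M tensor_elem_hom(3)[OF FQ FA e a']])
  have "graded_tensor_map R FQ FA (\<lambda>i. free_module R (Q_index i)) (piece A) (\<lambda>k a. a) (\<lambda>k b. b) n ?h k =
      single UNIV ?N i (tensor_elem R (free_module R (Q_index i)) (piece A (n - i)) (free_gen R (Q_index i) j) a) k" for k
    using tensor_map_elem[OF FQ FA free_Q_module piece_module f g e a']
      module_hom_zero[OF M tensor_Q_module tensor_map_hom[OF FQ FA free_Q_module piece_module f g]]
    by (auto simp: graded_tensor_map_def single_def)
  then have eq: "graded_tensor_map R FQ FA (\<lambda>i. free_module R (Q_index i)) (piece A) (\<lambda>k a. a) (\<lambda>k b. b) n ?h =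
      single UNIV ?N i (tensor_elem R (free_module R (Q_index i)) (piece A (n - i)) (free_gen R (Q_index i) j) a)"
    by (rule ext)
  have "single UNIV ?N i (tensor_elem R (free_module R (Q_index i)) (piece A (n - i)) (free_gen R (Q_index i) j) a)
    \<in> graded_tensor_map R FQ FA (\<lambda>i. free_module R (Q_index i)) (piece A) (\<lambda>k a. a) (\<lambda>k b. b) n `
      carrier (graded_tensor R FQ FA n)"
    unfolding eq[symmetric] using h by (rule imageI)
  then show ?thesis
    unfolding tensor_filt_def Let_def Q_complex_simps(1) FQ_def FA_def by (intro hull_inc UN_I[of ?q]) auto
qed

text \<open>From left to right, the coordinate conditions cut out a submodule containing all
  generators of F_p, hence the hull. From right to left, \<open>h\<close> is a finite sum of
  generators tensored with its coordinates, and each such term belongs to the hull.\<close>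

lemma tensor_filt_coord_iff:
  "h \<in> tensor_filt R (Q_complex R r) A p n \<longleftrightarrow>
    h \<in> carrier (Q_tensor n) \<and> (\<forall>i. \<forall>j\<in>Q_index i. coord n i j h \<in> filt A (p - Q_weight r i j) (n - i))"
    (is "_ \<longleftrightarrow> h \<in> carrier _ \<and> ?P h")
proof
  let ?G = "\<Union>q. graded_tensor_map R (\<lambda>k. restrict_module (free_module R (Q_index k)) (filt (Q_complex R r) q k))
              (\<lambda>k. restrict_module (piece A k) (filt A (p - q) k)) (\<lambda>i. free_module R (Q_index i)) (piece A)
              (\<lambda>k a. a) (\<lambda>k b. b) n `
                carrier (graded_tensor R (\<lambda>k. restrict_module (free_module R (Q_index k)) (filt (Q_complex R r) q k))
              (\<lambda>k. restrict_module (piece A k) (filt A (p - q) k)) n)"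
  interpret T: module R "Q_tensor n" by (rule Q_tensor_module)
  have gen: "h \<in> carrier (Q_tensor n) \<and> ?P h" if "h \<in> ?G" for h
  proof -
    from that obtain q h' where h': "h' \<in> carrier (graded_tensor R
        (\<lambda>k. restrict_module (free_module R (Q_index k)) (filt (Q_complex R r) q k))
        (\<lambda>k. restrict_module (piece A k) (filt A (p - q) k)) n)"
      and h: "h = graded_tensor_map R (\<lambda>k. restrict_module (free_module R (Q_index k)) (filt (Q_complex R r) q k))
              (\<lambda>k. restrict_module (piece A k) (filt A (p - q) k)) (\<lambda>i. free_module R (Q_index i)) (piece A)
              (\<lambda>k a. a) (\<lambda>k b. b) n h'" by blast
    have FQ: "module R (restrict_module (free_module R (Q_index k)) (filt (Q_complex R r) q k))" for k
      by (rule module_restrict[OF free_Q_module Q_filt_submodule])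
    have FA: "module R (restrict_module (piece A k) (filt A (p - q) k))" for k
      by (rule module_restrict[OF piece_module filt_submodule])
    have sub: "filt (Q_complex R r) q k \<subseteq> carrier (free_module R (Q_index k))" "filt A (p - q) k \<subseteq> carrier (piece A k)" for k
      using module.submoduleE(1)[OF piece_module filt_submodule] by (auto simp: Q_complex_simps)
    have h'i: "h' i \<in> carrier (tensor R (restrict_module (free_module R (Q_index i)) (filt (Q_complex R r) q i))
        (restrict_module (piece A (n - i)) (filt A (p - q) (n - i))))" for i
      using h' by (simp add: graded_tensor_def direct_sum_carrier)
    show ?thesis
      unfolding Q_tensor_carrier h graded_tensor_map_def coord_def
      using tensor_coords_filt[OF h'i]
        module_hom_closed[OF tensor_map_hom[OF FQ FA free_Q_module piece_module
            module_hom_restrict[OF module_hom_ident sub(1)] module_hom_restrict[OF module_hom_ident sub(2)]] h'i]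
      by blast
  qed
  have eq: "tensor_filt R (Q_complex R r) A p n = (\<lambda>K. submodule K R (Q_tensor n)) hull ?G"
    unfolding tensor_filt_def Let_def Q_complex_simps(1) ..
  {
    have K: "submodule {h \<in> carrier (Q_tensor n). coord n i j h \<in> filt A (p - Q_weight r i j) (n - i)} R (Q_tensor n)"
      if "j \<in> Q_index i" for i j
      by (rule submodule_vimage[OF Q_tensor_module piece_module coord_hom[OF that] filt_submodule])
    have "submodule {h \<in> carrier (Q_tensor n). ?P h} R (Q_tensor n)"
      using submodule_Collect_ball[OF Q_tensor_module,
          of "Sigma UNIV Q_index" n "\<lambda>(i, j) h. coord n i j h \<in> filt A (p - Q_weight r i j) (n - i)"] K
      by (auto simp: Sigma_def)
    moreover have "?G \<subseteq> {h \<in> carrier (Q_tensor n). ?P h}" using gen by blast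
    ultimately have "tensor_filt R (Q_complex R r) A p n \<subseteq> {h \<in> carrier (Q_tensor n). ?P h}"
      unfolding eq by (intro hull_minimal)
    then show "h \<in> tensor_filt R (Q_complex R r) A p n \<Longrightarrow> h \<in> carrier (Q_tensor n) \<and> ?P h" by blast
  }
  {
    assume h: "h \<in> carrier (Q_tensor n) \<and> ?P h"
    let ?N = "\<lambda>i. tensor R (free_module R (Q_index i)) (piece A (n - i))"
    let ?K = "tensor_filt R (Q_complex R r) A p n"
    have "?G \<subseteq> carrier (Q_tensor n)" using gen by blast
    then have "submodule ?K R (Q_tensor n)"
      unfolding eq by (rule submodule_hull[OF Q_tensor_module])
    then have K: "submodule ?K R (direct_sum UNIV ?N)"
      by (simp only: graded_tensor_def)
    show "h \<in> ?K"
    proof (rule direct_sum_mem_submodule[OF tensor_Q_module is_cring K])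
      show "h \<in> carrier (direct_sum UNIV ?N)" using h by (simp add: graded_tensor_def)
      fix i
      let ?c = "tensor_coords R (Q_index i) (piece A (n - i)) (h i)"
      note hm = module_hom_compose[OF tensor_of_coords_hom[OF piece_module] single_hom[where I = UNIV and M = ?N, OF tensor_Q_module]]
      have S: "module R (direct_sum (Q_index i) (\<lambda>_. piece A (n - i)))" by (rule direct_sum_module[OF is_cring piece_module])
      have hi: "h i \<in> carrier (?N i)" using h by (simp add: Q_tensor_carrier)
      \<comment> \<open>The decomposition has two levels: \<open>h\<close> is split over the degrees
        i, and each h i over the generators j. For the inner level the families v whose tensor lands
        in F_p form a submodule, so only families with a single entry need inspection.\<close>
      have "?c \<in> {v \<in> carrier (direct_sum (Q_index i) (\<lambda>_. piece A (n - i))).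
          single UNIV ?N i (tensor_of_coords R (Q_index i) (piece A (n - i)) v) \<in> ?K}" (is "_ \<in> ?L")
      proof (rule direct_sum_mem_submodule[OF piece_module is_cring])
        show "submodule ?L R (direct_sum (Q_index i) (\<lambda>_. piece A (n - i)))"
          by (rule submodule_vimage[OF S direct_sum_module[OF is_cring tensor_Q_module] hm K])
        show "?c \<in> carrier (direct_sum (Q_index i) (\<lambda>_. piece A (n - i)))"
          by (rule module_hom_closed[OF tensor_coords_hom[OF piece_module] hi])
        fix j assume j: "j \<in> Q_index i"
        have cj: "?c j \<in> filt A (p - Q_weight r i j) (n - i)" using h j by (simp add: coord_def)
        then have cc: "?c j \<in> carrier (piece A (n - i))"
          using module.submoduleE(1)[OF piece_module filt_submodule] by blast
        show "single (Q_index i) (\<lambda>_. piece A (n - i)) j (?c j) \<in> ?L"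
          using Q_tensor_filt_generator[OF j cj] tensor_of_coords_single[OF piece_module j cc]
            single_closed[where I = "Q_index i" and M = "\<lambda>_. piece A (n - i)" and j = j, OF piece_module cc] by simp
      qed
      then show "single UNIV ?N i (h i) \<in> ?K"
        using tensor_of_coords_coords[OF piece_module hi] by simp
    qed
  }
qed

end

section \<open>Pages\<close>

context filtered_complex
begin

lemma
  shows filt_carrier: "x \<in> filt A p n \<Longrightarrow> x \<in> carrier (piece A n)"
    and filt_zero: "\<zero>\<^bsub>piece A n\<^esub> \<in> filt A p n"
    and filt_uminus: "x \<in> filt A p n \<Longrightarrow> \<ominus>\<^bsub>piece A n\<^esub> x \<in> filt A p n"
    and filt_add: "x \<in> filt A p n \<Longrightarrow> y \<in> filt A p n \<Longrightarrow> x \<oplus>\<^bsub>piece A n\<^esub> y \<in> filt A p n"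
    and filt_minus: "x \<in> filt A p n \<Longrightarrow> y \<in> filt A p n \<Longrightarrow> x \<ominus>\<^bsub>piece A n\<^esub> y \<in> filt A p n"
proof -
  interpret An: module R "piece A n" by (rule piece_module)
  note s = filt_submodule[of p n]
  show "x \<in> filt A p n \<Longrightarrow> x \<in> carrier (piece A n)" using An.submoduleE(1)[OF s] by auto
  show "\<zero>\<^bsub>piece A n\<^esub> \<in> filt A p n" using subgroup.one_closed[OF submodule.axioms(1)[OF s]] by simp
  show "x \<in> filt A p n \<Longrightarrow> \<ominus>\<^bsub>piece A n\<^esub> x \<in> filt A p n" by (rule An.submoduleE(3)[OF s])
  show "x \<in> filt A p n \<Longrightarrow> y \<in> filt A p n \<Longrightarrow> x \<oplus>\<^bsub>piece A n\<^esub> y \<in> filt A p n"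
    by (rule An.submoduleE(5)[OF s])
  show "x \<in> filt A p n \<Longrightarrow> y \<in> filt A p n \<Longrightarrow> x \<ominus>\<^bsub>piece A n\<^esub> y \<in> filt A p n"
    unfolding An.M.minus_eq by (intro An.submoduleE(3,5)[OF s])
qed

lemma differential_closed: "x \<in> carrier (piece A n) \<Longrightarrow> differential A n x \<in> carrier (piece A (n + 1))"
  by (rule module_hom_closed[OF differential_hom])

lemma differential_zero: "differential A n \<zero>\<^bsub>piece A n\<^esub> = \<zero>\<^bsub>piece A (n + 1)\<^esub>"
  by (rule module_hom_zero[OF piece_module piece_module differential_hom])

lemma cycles_submodule: "submodule (cycles A k p n) R (piece A n)"
proof -
  have "cycles A k p n = filt A p n \<inter> {x \<in> carrier (piece A n). differential A n x \<in> filt A (p - int k) (n + 1)}"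
    using filt_carrier by (auto simp: cycles_def)
  then show ?thesis
    using submodule_Int[OF piece_module filt_submodule
        submodule_vimage[OF piece_module piece_module differential_hom filt_submodule]] by simp
qed

lemma boundaries_submodule: "submodule (boundaries A k p n) R (piece A n)"
proof (cases k)
  case (Suc l)
  have "module_hom R (piece A (n - 1)) (piece A n) (differential A (n - 1))"
    using differential_hom[of "n - 1"] by simp
  then show ?thesis
    unfolding Suc boundaries.simps
    by (intro submodule_set_add submodule_image[OF piece_module[of "n - 1"]] piece_module cycles_submodule)
qed (simp add: filt_submodule)

text \<open>The index p + k is chosen so that the k-cycle condition puts dc in F_p, and ddc = 0 lies
  in every step. For the other summand, (p - 1) - k = p - (k + 1).\<close>

lemma boundaries_subset_cycles: "boundaries A (Suc k) p n \<subseteq> cycles A (Suc k) p n"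
proof
  fix z assume "z \<in> boundaries A (Suc k) p n"
  then obtain c y where c: "c \<in> cycles A k (p + int k) (n - 1)" and y: "y \<in> cycles A k (p - 1) n"
    and z: "z = differential A (n - 1) c \<oplus>\<^bsub>piece A n\<^esub> y"
    by (auto simp: set_add_def')
  have cc: "c \<in> carrier (piece A (n - 1))" using c filt_carrier by (auto simp: cycles_def)
  have "differential A (n - 1) c \<in> cycles A (Suc k) p n"
    using c differential_square[OF cc] filt_zero by (simp add: cycles_def)
  moreover have "y \<in> cycles A (Suc k) p n"
    using y filt_le[of "p - 1" p y n] by (simp add: cycles_def algebra_simps)
  ultimately show "z \<in> cycles A (Suc k) p n"
    unfolding z by (rule module.submoduleE(5)[OF piece_module cycles_submodule])
qed

end

lemma morphism_cycles:
  assumes f: "morphism R A B f" and x: "x \<in> cycles A k p n"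
  shows "f n x \<in> cycles B k p n"
proof -
  interpret A: filtered_complex R A using f by (simp add: morphism_def)
  show ?thesis
    using f x A.filt_carrier[of x p n] by (auto simp: morphism_def cycles_def image_subset_iff) (metis)
qed

lemma morphism_boundaries:
  assumes f: "morphism R A B f" and x: "x \<in> boundaries A (Suc k) p n"
  shows "f n x \<in> boundaries B (Suc k) p n"
proof -
  interpret A: filtered_complex R A using f by (simp add: morphism_def)
  from x obtain c y where c: "c \<in> cycles A k (p + int k) (n - 1)" and y: "y \<in> cycles A k (p - 1) n"
    and x': "x = differential A (n - 1) c \<oplus>\<^bsub>piece A n\<^esub> y"
    by (auto simp: set_add_def')
  have cc: "c \<in> carrier (piece A (n - 1))" and yc: "y \<in> carrier (piece A n)"
    using c y A.filt_carrier by (auto simp: cycles_def)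
  have fh: "module_hom R (piece A n) (piece B n) (f n)"
    and d: "f (n - 1 + 1) (differential A (n - 1) c) = differential B (n - 1) (f (n - 1) c)"
    using f cc unfolding morphism_def by blast+
  have "f n x = differential B (n - 1) (f (n - 1) c) \<oplus>\<^bsub>piece B n\<^esub> f n y"
    using module_hom_add[OF fh _ yc] A.differential_closed[OF cc] d by (simp add: x')
  then show ?thesis
    using morphism_cycles[OF f c] morphism_cycles[OF f y] by (auto simp: set_add_def')
qed

text \<open>Reduces the comparison of pages to two statements about elements; compatibility with
  cycles and boundaries is automatic for a morphism.\<close>

lemma page_map_iso:
  assumes f: "morphism R A B f"
    and surj: "\<And>y. y \<in> cycles B (Suc k) p n \<Longrightarrow> \<exists>x\<in>cycles A (Suc k) p n. f n x = y"
    and inj: "\<And>x. x \<in> cycles A (Suc k) p n \<Longrightarrow> f n x \<in> boundaries B (Suc k) p n \<Longrightarrow>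
      x \<in> boundaries A (Suc k) p n"
  shows "module_iso R (page A (Suc k) p n) (page B (Suc k) p n) (page_map B f (Suc k) p n)"
proof -
  interpret A: filtered_complex R A using f by (simp add: morphism_def)
  interpret B: filtered_complex R B using f by (simp add: morphism_def)
  let ?Z = "restrict_module (piece A n) (cycles A (Suc k) p n)"
  let ?W = "restrict_module (piece B n) (cycles B (Suc k) p n)"
  have fh: "module_hom R (piece A n) (piece B n) (f n)"
    using f unfolding morphism_def by blast
  have sub: "x \<in> cycles A (Suc k) p n \<Longrightarrow> x \<in> carrier (piece A n)" for x
    using A.filt_carrier by (auto simp: cycles_def)
  have "module_iso R (quotient_module ?Z (boundaries A (Suc k) p n)) (quotient_module ?W (boundaries B (Suc k) p n))
      (\<lambda>X. \<Union>x\<in>X. boundaries B (Suc k) p n +>\<^bsub>?W\<^esub> f n x)"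
  proof (rule quotient_map_iso)
    show "module R ?Z" "module R ?W"
      by (rule module_restrict[OF A.piece_module A.cycles_submodule],
          rule module_restrict[OF B.piece_module B.cycles_submodule])
    show "module_hom R ?Z ?W (f n)"
      using fh sub morphism_cycles[OF f]
      by (intro module_homI) (auto simp: restrict_module_def module_hom_add module_hom_smult)
    show "submodule (boundaries A (Suc k) p n) R ?Z"
      by (rule submodule_restrict[OF A.piece_module A.cycles_submodule A.boundaries_submodule A.boundaries_subset_cycles])
    show "submodule (boundaries B (Suc k) p n) R ?W"
      by (rule submodule_restrict[OF B.piece_module B.cycles_submodule B.boundaries_submodule B.boundaries_subset_cycles])
    show "f n ` boundaries A (Suc k) p n \<subseteq> boundaries B (Suc k) p n"
      using morphism_boundaries[OF f] by blast
  qed (use surj inj in \<open>auto simp: restrict_module_def\<close>)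
  \<comment> \<open>Restricting a module changes only its carrier, so cosets formed among the cycles
    are the cosets in the full piece used by \<open>page_map\<close>.\<close>
  then show ?thesis
    unfolding page_def page_map_def[abs_def] by (simp add: restrict_module_def a_r_coset_def r_coset_def)
qed

section \<open>The projection onto \<open>A\<close>\<close>

text \<open>Recovers d\<beta>_j from \<alpha>_{j-1} + \<alpha>_j and the cycle expression
  \<alpha>_{j-1} + \<alpha>_j - d\<beta>_j.\<close>

lemma (in abelian_group) minus_minus_eq:
  "x \<in> carrier G \<Longrightarrow> y \<in> carrier G \<Longrightarrow> x \<ominus> (x \<ominus> y) = y"
  by (simp add: minus_eq minus_add r_neg2)

lemma (in abelian_group) add_minus_cancel_left:
  "x \<in> carrier G \<Longrightarrow> y \<in> carrier G \<Longrightarrow> x \<oplus> y \<ominus> x = y"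
  by (simp add: minus_eq a_comm[of x y] a_assoc r_neg)

lemma (in abelian_group) minus_zero_right: "x \<in> carrier G \<Longrightarrow> x \<ominus> \<zero> = x"
  using add_minus_cancel_left[of \<zero> x] by simp

lemma (in abelian_group) add_minus_minus_cancel_left:
  "x \<in> carrier G \<Longrightarrow> y \<in> carrier G \<Longrightarrow> w \<in> carrier G \<Longrightarrow> (x \<oplus> y \<ominus> w) \<ominus> x = y \<ominus> w"
  using add_minus_cancel_left[of x "y \<ominus> w"] by (simp add: minus_eq a_assoc)

lemma (in abelian_group) minus_add_cancel_right:
  "x \<in> carrier G \<Longrightarrow> y \<in> carrier G \<Longrightarrow> y \<ominus> (x \<oplus> y) = \<ominus> x"
  by (simp add: minus_eq minus_add a_comm[of "\<ominus> x"] r_neg2)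

context filtered_complex
begin

section \<open>Coordinates specialised to the two nonzero degrees of Q_rS\<close>

lemma tensor_complex_simps:
  "piece (tensor_complex R (Q_complex R r) A) = Q_tensor"
  "differential (tensor_complex R (Q_complex R r) A) = tensor_differential R (Q_complex R r) A"
  "filt (tensor_complex R (Q_complex R r) A) = tensor_filt R (Q_complex R r) A"
  by (simp_all add: tensor_complex_def Q_complex_simps)

lemma Q_index_cases:
  assumes "j \<in> Q_index i"
  obtains "i = 0" | "i = 1" "1 \<le> j"
  using assms by (auto simp: Q_index_def split: if_splits)

lemma coord_0_hom: "module_hom R (Q_tensor n) (piece A n) (coord n 0 j)"
  using coord_hom[of j 0 n] by (simp add: Q_index_def)

lemma coord_1_hom: "1 \<le> j \<Longrightarrow> module_hom R (Q_tensor n) (piece A (n - 1)) (coord n 1 j)"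
  using coord_hom[of j 1 n] by (simp add: Q_index_def)

lemmas coord_0_closed = module_hom_closed[OF coord_0_hom]
lemmas coord_1_closed = module_hom_closed[OF coord_1_hom]

lemma coord_eqI':
  assumes "h \<in> carrier (Q_tensor n)" "h' \<in> carrier (Q_tensor n)"
    and "\<And>j. coord n 0 j h = coord n 0 j h'" "\<And>j. 1 \<le> j \<Longrightarrow> coord n 1 j h = coord n 1 j h'"
  shows "h = h'"
  using assms(1,2)
proof (rule coord_eqI)
  show "coord n i j h = coord n i j h'" if "j \<in> Q_index i" for i j
    using that by (rule Q_index_cases) (simp_all add: assms(3,4))
qed

lemma coord_exists':
  assumes "\<And>j. a j \<in> carrier (piece A n)" "\<And>j. 1 \<le> j \<Longrightarrow> b j \<in> carrier (piece A (n - 1))"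
    and "finite {j. a j \<noteq> \<zero>\<^bsub>piece A n\<^esub>}" "finite {j. 1 \<le> j \<and> b j \<noteq> \<zero>\<^bsub>piece A (n - 1)\<^esub>}"
  obtains h where "h \<in> carrier (Q_tensor n)" "\<And>j. coord n 0 j h = a j" "\<And>j. 1 \<le> j \<Longrightarrow> coord n 1 j h = b j"
proof -
  \<comment> \<open>For i outside 0 and 1 the value \<open>b\<close> lives in the wrong piece, but
    \<open>Q_index i\<close> is empty there and nothing is demanded.\<close>
  let ?v = "\<lambda>i::int. if i = 0 then a else b"
  have "\<exists>h\<in>carrier (Q_tensor n). \<forall>i. \<forall>j\<in>Q_index i. coord n i j h = ?v i j"
  proof (rule coord_exists)
    show "?v i j \<in> carrier (piece A (n - i))" if "j \<in> Q_index i" for i j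
      using that by (rule Q_index_cases) (simp_all add: assms(1,2))
    show "finite {j \<in> Q_index i. ?v i j \<noteq> \<zero>\<^bsub>piece A (n - i)\<^esub>}" for i
      using assms(3,4) by (cases "i = 0"; cases "i = 1") (simp_all add: Q_index_def)
  qed
  then obtain h where "h \<in> carrier (Q_tensor n)" "\<And>i j. j \<in> Q_index i \<Longrightarrow> coord n i j h = ?v i j" by blast
  then show thesis by (intro that[of h]) (auto simp: Q_index_def)
qed

lemma coord_1_finite: "h \<in> carrier (Q_tensor n) \<Longrightarrow> finite {j. 1 \<le> j \<and> coord n 1 j h \<noteq> \<zero>\<^bsub>piece A (n - 1)\<^esub>}"
  using coord_finite[of h n 1] by (simp add: Q_index_def)

text \<open>The weights -j and -r-j enter with a minus sign, so the conditions become weaker as j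
  grows; this is what leaves room for tails of the differential.\<close>

lemma tensor_filt_iff:
  "h \<in> tensor_filt R (Q_complex R r) A p n \<longleftrightarrow>
    h \<in> carrier (Q_tensor n) \<and> (\<forall>j. coord n 0 j h \<in> filt A (p + int j) n) \<and>
    (\<forall>j\<ge>1. coord n 1 j h \<in> filt A (p + int r + int j) (n - 1))"
proof -
  have "(\<forall>i. \<forall>j\<in>Q_index i. coord n i j h \<in> filt A (p - Q_weight r i j) (n - i)) \<longleftrightarrow>
    (\<forall>j\<in>Q_index 0. coord n 0 j h \<in> filt A (p - Q_weight r 0 j) (n - 0)) \<and>
    (\<forall>j\<in>Q_index 1. coord n 1 j h \<in> filt A (p - Q_weight r 1 j) (n - 1))"
    by (metis Q_index_cases)
  also have "\<dots> \<longleftrightarrow> (\<forall>j. coord n 0 j h \<in> filt A (p + int j) n) \<and>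
    (\<forall>j\<ge>1. coord n 1 j h \<in> filt A (p + int r + int j) (n - 1))"
    by (auto simp: Q_index_def Q_weight_def algebra_simps)
  finally show ?thesis by (simp add: tensor_filt_coord_iff)
qed

section \<open>The tensor product as a filtered complex\<close>

lemma tensor_differential_closed:
  "h \<in> carrier (Q_tensor n) \<Longrightarrow> Q_differential r n h \<in> carrier (Q_tensor (n + 1))"
  by (rule module_hom_closed[OF Q_tensor_differential_hom])

text \<open>At index 1 the result is d\<alpha>_{j-1} + d\<alpha>_j - d(\<alpha>_{j-1} + \<alpha>_j -
  d\<beta>_j). The Koszul sign makes the \<alpha> terms cancel, and dd\<beta>_j = 0.\<close>

lemma tensor_differential_square:
  assumes h: "h \<in> carrier (Q_tensor n)"
  shows "Q_differential r (n + 1) (Q_differential r n h) = \<zero>\<^bsub>Q_tensor (n + 1 + 1)\<^esub>"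
proof (rule coord_eqI')
  interpret T: module R "Q_tensor (n + 1 + 1)" by (rule Q_tensor_module)
  interpret A1: module R "piece A (n + 1)" by (rule piece_module)
  note dh = tensor_differential_closed[OF h]
  show "Q_differential r (n + 1) (Q_differential r n h) \<in> carrier (Q_tensor (n + 1 + 1))"
    by (rule tensor_differential_closed[OF dh])
  show "\<zero>\<^bsub>Q_tensor (n + 1 + 1)\<^esub> \<in> carrier (Q_tensor (n + 1 + 1))" by (rule T.M.zero_closed)
  show "coord (n + 1 + 1) 0 j (Q_differential r (n + 1) (Q_differential r n h)) =
      coord (n + 1 + 1) 0 j \<zero>\<^bsub>Q_tensor (n + 1 + 1)\<^esub>" for j
    unfolding coord_differential_0[OF dh] coord_differential_0[OF h]
      module_hom_zero[OF Q_tensor_module piece_module coord_0_hom]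
    by (rule differential_square[OF coord_0_closed[OF h]])
  fix j :: nat assume j: "1 \<le> j"
  define X Y Z where "X = coord n 0 (j - 1) h" and "Y = coord n 0 j h" and "Z = coord n 1 j h"
  have XY: "X \<in> carrier (piece A n)" "Y \<in> carrier (piece A n)" and Z: "Z \<in> carrier (piece A (n - 1))"
    using coord_0_closed[OF h] coord_1_closed[OF j h] by (simp_all add: X_def Y_def Z_def)
  define W where "W = differential A (n - 1) Z"
  have W: "W \<in> carrier (piece A n)" using differential_closed[OF Z] by (simp add: W_def)
  have dW: "differential A n W = \<zero>\<^bsub>piece A (n + 1)\<^esub>" using differential_square[OF Z] by (simp add: W_def)
  interpret An: module R "piece A n" by (rule piece_module)
  have "differential A n (X \<oplus>\<^bsub>piece A n\<^esub> Y \<ominus>\<^bsub>piece A n\<^esub> W) =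
      differential A n X \<oplus>\<^bsub>piece A (n + 1)\<^esub> differential A n Y"
    using XY W dW differential_closed
    by (simp add: An.M.minus_eq module_hom_add[OF differential_hom]
        module_hom_uminus[OF piece_module piece_module differential_hom] A1.M.minus_eq)
  then have "coord (n + 1 + 1) 1 j (Q_differential r (n + 1) (Q_differential r n h)) = \<zero>\<^bsub>piece A (n + 1)\<^esub>"
    unfolding coord_differential_1[OF dh j] coord_differential_0[OF h] coord_differential_1[OF h j]
      X_def[symmetric] Y_def[symmetric] Z_def[symmetric] W_def[symmetric]
    using XY differential_closed by (simp add: A1.M.minus_eq A1.M.r_neg)
  then show "coord (n + 1 + 1) 1 j (Q_differential r (n + 1) (Q_differential r n h)) =
      coord (n + 1 + 1) 1 j \<zero>\<^bsub>Q_tensor (n + 1 + 1)\<^esub>"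
    unfolding module_hom_zero[OF Q_tensor_module piece_module coord_1_hom[OF j, of "n + 1 + 1"]]
    by (simp only: add_diff_cancel_right')
qed

lemma Q_tensor_filtered_complex: "filtered_complex R (tensor_complex R (Q_complex R r) A)"
proof (rule filtered_complex.intro[OF is_cring filtered_complex_axioms.intro], unfold tensor_complex_simps)
  fix p n
  show "module R (Q_tensor n)" by (rule Q_tensor_module)
  show "module_hom R (Q_tensor n) (Q_tensor (n + 1)) (Q_differential r n)" by (rule Q_tensor_differential_hom)
  show "Q_differential r (n + 1) (Q_differential r n h) = \<zero>\<^bsub>Q_tensor (n + 1 + 1)\<^esub>"
    if "h \<in> carrier (Q_tensor n)" for h
    using that by (rule tensor_differential_square)
  have "tensor_filt R (Q_complex R r) A p n = {h \<in> carrier (Q_tensor n). \<forall>(i, j)\<in>Sigma UNIV Q_index.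
      coord n i j h \<in> filt A (p - Q_weight r i j) (n - i)}"
    by (auto simp: tensor_filt_coord_iff)
  moreover have "submodule \<dots> R (Q_tensor n)"
    by (rule submodule_Collect_ball[OF Q_tensor_module])
      (auto intro: submodule_vimage[OF Q_tensor_module piece_module coord_hom filt_submodule])
  ultimately show "submodule (tensor_filt R (Q_complex R r) A p n) R (Q_tensor n)" by simp
  show "tensor_filt R (Q_complex R r) A p n \<subseteq> tensor_filt R (Q_complex R r) A (p + 1) n"
    using filt_le[of "p + int j" "p + 1 + int j" for j] filt_le[of "p + int r + int j" "p + 1 + int r + int j" for j]
    by (auto simp: tensor_filt_iff)
  show "Q_differential r n ` tensor_filt R (Q_complex R r) A p n \<subseteq> tensor_filt R (Q_complex R r) A p (n + 1)"
  proof clarify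
    fix h assume "h \<in> tensor_filt R (Q_complex R r) A p n"
    then have h: "h \<in> carrier (Q_tensor n)" and h0: "\<And>j. coord n 0 j h \<in> filt A (p + int j) n"
      and h1: "\<And>j. 1 \<le> j \<Longrightarrow> coord n 1 j h \<in> filt A (p + int r + int j) (n - 1)"
      by (auto simp: tensor_filt_iff)
    show "Q_differential r n h \<in> tensor_filt R (Q_complex R r) A p (n + 1)"
      unfolding tensor_filt_iff
    proof (intro conjI allI impI tensor_differential_closed[OF h])
      show "coord (n + 1) 0 j (Q_differential r n h) \<in> filt A (p + int j) (n + 1)" for j
        unfolding coord_differential_0[OF h] using h0 filt_differential by blast
      fix j :: nat assume j: "1 \<le> j"
      have "differential A (n - 1) (coord n 1 j h) \<in> filt A (p + int r + int j) n"
        using filt_differential[of "n - 1" "p + int r + int j"] h1[OF j] by auto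
      \<comment> \<open>These coordinates lie in F_{p+j-1} and F_{p+j}, with r + 1 and r steps to
        spare: the drops in weight along the differential of Q_rS.\<close>
      moreover have "coord n 0 (j - 1) h \<in> filt A (p + int r + int j) n" "coord n 0 j h \<in> filt A (p + int r + int j) n"
        using j by (auto intro: filt_le[OF _ h0])
      ultimately show "coord (n + 1) 1 j (Q_differential r n h) \<in> filt A (p + int r + int j) (n + 1 - 1)"
        unfolding coord_differential_1[OF h j] by (simp add: filt_add filt_minus)
    qed
  qed
qed

text \<open>The unit isomorphism reads only the component \<open>h 0\<close>, so degree 1 of Q_rS is
  discarded. On an elementary tensor u \<otimes> a of degree 0 both sides give u_0 a, and both are
  linear.\<close>

lemma Q_proj_coord:
  assumes h: "h \<in> carrier (Q_tensor n)"
  shows "compose_morphism (left_unitor R A)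
      (tensor_morphism R (Q_complex R r) A (base R 0 0) A (Q_proj R) id_morphism) n h = coord n 0 0 h"
proof -
  let ?RM = "ring_module R" and ?F = "free_module R (Q_index 0)" and ?An = "piece A n"
  interpret An: module R ?An by (rule piece_module)
  have RM: "module R ?RM" by (rule ring_module_module[OF is_cring])
  have j: "0 \<in> Q_index 0" by (simp add: Q_index_def)
  have t: "h 0 \<in> carrier (tensor R ?F ?An)"
    using h[unfolded Q_tensor_carrier, rule_format, of 0] by simp
  have pr: "module_hom R ?F ?RM (Q_proj R 0)"
    unfolding Q_proj_def[abs_def] free_module_def using direct_sum_component_hom[OF j, of R "\<lambda>_. ?RM"] by simp
  have idh: "module_hom R ?An ?An (id_morphism n)"
    unfolding id_morphism_def by (rule module_hom_ident)
  have bil: "module_bilinear R ?RM ?An ?An (\<lambda>c a. c \<odot>\<^bsub>?An\<^esub> a)"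
    unfolding module_bilinear_def using module_hom_smult_left[OF piece_module] module_hom_smult_right[OF piece_module]
    by (simp add: ring_module_def)
  have "tensor_lift R ?RM ?An ?An (\<lambda>c a. c \<odot>\<^bsub>?An\<^esub> a)
      (tensor_map R ?F ?An ?RM ?An (Q_proj R 0) (id_morphism n) (h 0)) = tensor_coords R (Q_index 0) ?An (h 0) 0"
  proof (rule tensor_hom_eqI[OF free_Q_module piece_module piece_module
        module_hom_compose[OF tensor_map_hom[OF free_Q_module piece_module RM piece_module pr idh]
          tensor_lift_hom[OF RM piece_module piece_module bil]]
        tensor_coord_hom[OF piece_module j] _ t])
    fix u a assume u: "u \<in> carrier ?F" and a: "a \<in> carrier ?An"
    show "tensor_lift R ?RM ?An ?An (\<lambda>c a. c \<odot>\<^bsub>?An\<^esub> a)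
      (tensor_map R ?F ?An ?RM ?An (Q_proj R 0) (id_morphism n) (tensor_elem R ?F ?An u a)) =
      tensor_coords R (Q_index 0) ?An (tensor_elem R ?F ?An u a) 0"
      unfolding tensor_map_elem[OF free_Q_module piece_module RM piece_module pr idh u a]
        tensor_lift_elem[OF RM piece_module piece_module bil module_hom_closed[OF pr u] module_hom_closed[OF idh a]]
        tensor_coords_elem[OF piece_module u a]
      using j by (simp add: id_morphism_def Q_proj_def)
  qed
  then show ?thesis
    by (simp add: compose_morphism_def left_unitor_def tensor_morphism_def graded_tensor_map_def coord_def
        Q_complex_simps base_def)
qed

lemma Q_proj_morphism:
  "morphism R (tensor_complex R (Q_complex R r) A) A (compose_morphism (left_unitor R A)
      (tensor_morphism R (Q_complex R r) A (base R 0 0) A (Q_proj R) id_morphism))"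
    (is "morphism R _ A ?f")
proof -
  have "module_hom R (Q_tensor n) (piece A n) (?f n)" for n
    using coord_0_hom[of n 0] module.axioms(2)[OF Q_tensor_module[of n]]
    by (intro module_homI)
      (auto simp: Q_proj_coord module_hom_closed module_hom_add module_hom_smult abelian_group_def
        abelian_monoid.a_closed module.smult_closed[OF Q_tensor_module])
  moreover have "?f (n + 1) (Q_differential r n h) = differential A n (?f n h)" if "h \<in> carrier (Q_tensor n)" for n h
    using that by (simp add: Q_proj_coord tensor_differential_closed coord_differential_0)
  \<comment> \<open>Generator 0 has weight 0, so F_p of the tensor product constrains \<alpha>_0 to
    F_p with no shift.\<close>
  moreover have "?f n ` tensor_filt R (Q_complex R r) A p n \<subseteq> filt A p n" for p n
    by (auto simp: tensor_filt_iff Q_proj_coord) (metis add.right_neutral of_nat_0)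
  ultimately show ?thesis
    unfolding morphism_def tensor_complex_simps using Q_tensor_filtered_complex filtered_complex_axioms by blast
qed

text \<open>For k = r + 1 the last condition places \<alpha>_{j-1} + \<alpha>_j - d\<beta>_j in
  F_{p-1+j}, one step below the place of \<alpha>_j. That gain of one step drives the injectivity
  argument.\<close>

lemma cycles_tensor_iff:
  "h \<in> cycles (tensor_complex R (Q_complex R r) A) k p n \<longleftrightarrow>
    h \<in> tensor_filt R (Q_complex R r) A p n \<and>
    (\<forall>j. differential A n (coord n 0 j h) \<in> filt A (p - int k + int j) (n + 1)) \<and>
    (\<forall>j\<ge>1. coord n 0 (j - 1) h \<oplus>\<^bsub>piece A n\<^esub> coord n 0 j h \<ominus>\<^bsub>piece A n\<^esub>
      differential A (n - 1) (coord n 1 j h) \<in> filt A (p - int k + int r + int j) n)"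
proof (cases "h \<in> carrier (Q_tensor n)")
  case True
  then show ?thesis
    unfolding cycles_def tensor_complex_simps
    using tensor_filt_iff[of "Q_differential r n h" r "p - int k" "n + 1"]
    by (simp add: tensor_differential_closed coord_differential_0 coord_differential_1)
qed (simp add: cycles_def tensor_complex_simps tensor_filt_iff)

section \<open>Surjectivity and injectivity on page r + 1\<close>

lemma Q_proj_cycles_surj:
  assumes z: "z \<in> cycles A (Suc r) p n"
  shows "\<exists>h\<in>cycles (tensor_complex R (Q_complex R r) A) (Suc r) p n. coord n 0 0 h = z"
proof -
  interpret An: module R "piece A n" by (rule piece_module)
  have zf: "z \<in> filt A p n" and dz: "differential A n z \<in> filt A (p - int (Suc r)) (n + 1)"
    using z by (simp_all add: cycles_def)
  have zc: "z \<in> carrier (piece A n)" using zf by (rule filt_carrier)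
  have fin: "finite {j::nat. (if j = 0 then z else \<zero>\<^bsub>piece A n\<^esub>) \<noteq> \<zero>\<^bsub>piece A n\<^esub>}"
    by (rule finite_subset[of _ "{0}"]) auto
  obtain h where h: "h \<in> carrier (Q_tensor n)"
    and h0: "\<And>j. coord n 0 j h = (if j = 0 then z else \<zero>\<^bsub>piece A n\<^esub>)"
    and h1: "\<And>j. 1 \<le> j \<Longrightarrow> coord n 1 j h = \<zero>\<^bsub>piece A (n - 1)\<^esub>"
    by (rule coord_exists'[of "\<lambda>j. if j = 0 then z else \<zero>\<^bsub>piece A n\<^esub>" n "\<lambda>j. \<zero>\<^bsub>piece A (n - 1)\<^esub>"])
      (use zc filt_zero[THEN filt_carrier] fin in auto)
  have d0: "differential A (n - 1) \<zero>\<^bsub>piece A (n - 1)\<^esub> = \<zero>\<^bsub>piece A n\<^esub>" using differential_zero[of "n - 1"] by simp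
  have "h \<in> tensor_filt R (Q_complex R r) A p n"
    unfolding tensor_filt_iff using h h0 h1 zf filt_zero by auto
  moreover have "differential A n (coord n 0 j h) \<in> filt A (p - int (Suc r) + int j) (n + 1)" for j
    using dz by (simp add: h0 differential_zero filt_zero)
  \<comment> \<open>Only j = 1 can give a nonzero entry, namely z, and there p - (r + 1) + r + 1 =
    p. The weight -r-1 of the differential of generator 0 is thus just low enough.\<close>
  moreover have "coord n 0 (j - 1) h \<oplus>\<^bsub>piece A n\<^esub> coord n 0 j h \<ominus>\<^bsub>piece A n\<^esub>
      differential A (n - 1) (coord n 1 j h) \<in> filt A (p - int (Suc r) + int r + int j) n" if "1 \<le> j" for j
    using that zc zf by (auto simp: h0 h1 d0 An.M.minus_zero_right filt_zero)
  ultimately show ?thesis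
    using h0[of 0] by (intro bexI[of _ h]) (auto simp: cycles_tensor_iff)
qed

lemma Q_proj_boundaries_inj:
  assumes h: "h \<in> cycles (tensor_complex R (Q_complex R r) A) (Suc r) p n"
    and b: "coord n 0 0 h \<in> boundaries A (Suc r) p n"
  shows "h \<in> boundaries (tensor_complex R (Q_complex R r) A) (Suc r) p n"
proof -
  let ?T = "tensor_complex R (Q_complex R r) A"
  interpret T: filtered_complex R ?T by (rule Q_tensor_filtered_complex)
  interpret An: module R "piece A n" by (rule piece_module)
  interpret A1: module R "piece A (n - 1)" by (rule piece_module)
  interpret Tn: module R "Q_tensor n" by (rule Q_tensor_module)
  let ?\<alpha> = "\<lambda>j. coord n 0 j h" and ?\<beta> = "\<lambda>j. coord n 1 j h" and ?d = "differential A (n - 1)"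
  \<comment> \<open>The index in \<gamma> is p - (r + 1) + r + j = p - 1 + j.\<close>
  from h have hf: "h \<in> tensor_filt R (Q_complex R r) A p n"
    and \<gamma>: "\<And>j. 1 \<le> j \<Longrightarrow> ?\<alpha> (j - 1) \<oplus>\<^bsub>piece A n\<^esub> ?\<alpha> j \<ominus>\<^bsub>piece A n\<^esub> ?d (?\<beta> j) \<in> filt A (p - 1 + int j) n"
    by (auto simp: cycles_tensor_iff algebra_simps)
  have hc: "h \<in> carrier (Q_tensor n)" and \<alpha>: "\<And>j. ?\<alpha> j \<in> filt A (p + int j) n"
    and \<beta>: "\<And>j. 1 \<le> j \<Longrightarrow> ?\<beta> j \<in> filt A (p + int r + int j) (n - 1)"
    using hf by (auto simp: tensor_filt_iff)
  have \<alpha>c: "?\<alpha> j \<in> carrier (piece A n)" for j by (rule filt_carrier[OF \<alpha>])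
  have \<beta>c: "?\<beta> j \<in> carrier (piece A (n - 1))" if "1 \<le> j" for j by (rule filt_carrier[OF \<beta>[OF that]])
  have d\<beta>c: "?d (?\<beta> j) \<in> carrier (piece A n)" if "1 \<le> j" for j using differential_closed[OF \<beta>c[OF that]] by simp
  have \<alpha>': "?\<alpha> (j - 1) \<in> filt A (p - 1 + int j) n" if "1 \<le> j" for j
    using \<alpha>[of "j - 1"] that by (simp add: of_nat_diff algebra_simps)
  \<comment> \<open>The filtration of \<beta>_j alone gives only F_{p+r+j}. The cycle condition
    improves this by r steps, which is what makes x below an r-cycle.\<close>
  have d\<beta>: "?d (?\<beta> j) \<in> filt A (p + int j) n" if j: "1 \<le> j" for j
  proof -
    have "?\<alpha> (j - 1) \<oplus>\<^bsub>piece A n\<^esub> ?\<alpha> j \<ominus>\<^bsub>piece A n\<^esub>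
      (?\<alpha> (j - 1) \<oplus>\<^bsub>piece A n\<^esub> ?\<alpha> j \<ominus>\<^bsub>piece A n\<^esub> ?d (?\<beta> j)) \<in> filt A (p + int j) n"
      by (rule filt_minus[OF filt_add[OF filt_le[OF _ \<alpha>'[OF j]] \<alpha>] filt_le[OF _ \<gamma>[OF j]]]) simp_all
    then show ?thesis unfolding An.M.minus_minus_eq[OF An.M.a_closed[OF \<alpha>c \<alpha>c] d\<beta>c[OF j]] .
  qed
  from b obtain c z where c: "c \<in> cycles A r (p + int r) (n - 1)" and z: "z \<in> cycles A r (p - 1) n"
    and \<alpha>0: "?\<alpha> 0 = ?d c \<oplus>\<^bsub>piece A n\<^esub> z"
    by (auto simp: set_add_def')
  have cf: "c \<in> filt A (p + int r) (n - 1)" and dc: "?d c \<in> filt A p n" and zf: "z \<in> filt A (p - 1) n"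
    using c z by (simp_all add: cycles_def)
  have cc: "c \<in> carrier (piece A (n - 1))" by (rule filt_carrier[OF cf])
  \<comment> \<open>Raising the filtration index to p + r turns the condition F_{p+r+j} known for
    \<beta>_j into the one for the coordinate of x at the degree 0 generator j. At index 0, where
    there is no \<beta>, the bounding element c of \<alpha>_0 fits.\<close>
  obtain x where x: "x \<in> carrier (Q_tensor (n - 1))"
    and x0: "\<And>j. coord (n - 1) 0 j x = (if j = 0 then c else ?\<beta> j)"
    and x1: "\<And>j. 1 \<le> j \<Longrightarrow> coord (n - 1) 1 j x = \<zero>\<^bsub>piece A (n - 1 - 1)\<^esub>"
  proof (rule coord_exists'[of "\<lambda>j. if j = 0 then c else ?\<beta> j" "n - 1" "\<lambda>j. \<zero>\<^bsub>piece A (n - 1 - 1)\<^esub>"])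
    have "{j. (if j = 0 then c else ?\<beta> j) \<noteq> \<zero>\<^bsub>piece A (n - 1)\<^esub>} \<subseteq>
        insert 0 {j. 1 \<le> j \<and> ?\<beta> j \<noteq> \<zero>\<^bsub>piece A (n - 1)\<^esub>}" by auto
    then show "finite {j. (if j = 0 then c else ?\<beta> j) \<noteq> \<zero>\<^bsub>piece A (n - 1)\<^esub>}"
      by (rule finite_subset) (use coord_1_finite[OF hc] in simp)
  qed (use cc \<beta>c filt_zero[THEN filt_carrier] in auto)
  have d0: "differential A (n - 1 - 1) \<zero>\<^bsub>piece A (n - 1 - 1)\<^esub> = \<zero>\<^bsub>piece A (n - 1)\<^esub>"
    using differential_zero[of "n - 1 - 1"] by simp
  have x0f: "coord (n - 1) 0 j x \<in> filt A (p + int r + int j) (n - 1)" for j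
    using cf \<beta>[of j] by (simp add: x0)
  have x0c: "coord (n - 1) 0 j x \<in> carrier (piece A (n - 1))" for j by (rule filt_carrier[OF x0f])
  let ?dx = "Q_differential r (n - 1) x"
  have dxc: "?dx \<in> carrier (Q_tensor n)" using tensor_differential_closed[OF x] by simp
  have dx0: "coord n 0 j ?dx = ?d (coord (n - 1) 0 j x)" for j
    using coord_differential_0[OF x] by simp
  \<comment> \<open>Subtracting dx cancels \<beta>_j itself and introduces the preceding coordinate
    of x, the contribution of the tail of the differential.\<close>
  have dx1: "coord n 1 j ?dx = coord (n - 1) 0 (j - 1) x \<oplus>\<^bsub>piece A (n - 1)\<^esub> ?\<beta> j" if j: "1 \<le> j" for j
  proof -
    have "coord n 1 j ?dx = coord (n - 1) 0 (j - 1) x \<oplus>\<^bsub>piece A (n - 1)\<^esub> coord (n - 1) 0 j x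
        \<ominus>\<^bsub>piece A (n - 1)\<^esub> differential A (n - 1 - 1) (coord (n - 1) 1 j x)"
      using coord_differential_1[OF x j] by simp
    also have "\<dots> = coord (n - 1) 0 (j - 1) x \<oplus>\<^bsub>piece A (n - 1)\<^esub> coord (n - 1) 0 j x"
      unfolding x1[OF j] d0 by (rule A1.M.minus_zero_right) (simp add: x0c)
    finally show ?thesis using j x0[of j] by simp
  qed
  have x0f': "coord (n - 1) 0 (j - 1) x \<in> filt A (p - 1 + int r + int j) (n - 1)" if "1 \<le> j" for j
    using x0f[of "j - 1"] that by (simp add: of_nat_diff algebra_simps)
  have xZ: "x \<in> cycles ?T r (p + int r) (n - 1)"
    unfolding cycles_def tensor_complex_simps
  proof (intro CollectI conjI)
    show "x \<in> tensor_filt R (Q_complex R r) A (p + int r) (n - 1)"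
      unfolding tensor_filt_iff using x x0f x1 filt_zero by simp
    \<comment> \<open>At j = 0 this is the r-cycle condition on c; for larger j it is the improved
      bound on d\<beta>_j.\<close>
    have "coord n 0 j ?dx \<in> filt A (p + int j) n" for j
      using dc d\<beta>[of j] by (simp add: dx0 x0)
    moreover have "coord n 1 j ?dx \<in> filt A (p + int r + int j) (n - 1)" if "1 \<le> j" for j
      unfolding dx1[OF that] using filt_le[OF _ x0f'[OF that]] \<beta>[OF that] by (intro filt_add) auto
    ultimately show "?dx \<in> tensor_filt R (Q_complex R r) A (p + int r - int r) (n - 1 + 1)"
      using dxc by (simp add: tensor_filt_iff)
  qed
  let ?y = "h \<ominus>\<^bsub>Q_tensor n\<^esub> ?dx"
  have yc: "?y \<in> carrier (Q_tensor n)" using hc dxc by simp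
  have coord_y: "coord n 0 j ?y = ?\<alpha> j \<ominus>\<^bsub>piece A n\<^esub> coord n 0 j ?dx"
    and coord_y1: "1 \<le> j \<Longrightarrow> coord n 1 j ?y = ?\<beta> j \<ominus>\<^bsub>piece A (n - 1)\<^esub> coord n 1 j ?dx" for j
    using hc dxc
    by (simp_all add: Tn.M.minus_eq An.M.minus_eq A1.M.minus_eq module_hom_add[OF coord_0_hom] module_hom_add[OF coord_1_hom]
        module_hom_uminus[OF Q_tensor_module piece_module coord_0_hom]
        module_hom_uminus[OF Q_tensor_module piece_module coord_1_hom])
  have yZ: "?y \<in> cycles ?T r (p - 1) n"
    unfolding cycles_def tensor_complex_simps
  proof (intro CollectI conjI)
    have "coord n 0 j ?y \<in> filt A (p - 1 + int j) n" for j
    proof (cases "j = 0")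
      case True
      have "?\<alpha> 0 \<ominus>\<^bsub>piece A n\<^esub> ?d c = z"
        unfolding \<alpha>0 using filt_carrier[OF dc] filt_carrier[OF zf] by (rule An.M.add_minus_cancel_left)
      then show ?thesis using True zf by (simp add: coord_y dx0 x0)
    next
      case False
      then have j: "1 \<le> j" by simp
      \<comment> \<open>Here \<alpha>_j - d\<beta>_j equals the cycle expression minus
        \<alpha>_{j-1}. Both of these lie in F_{p-1+j}, whereas \<alpha>_j and d\<beta>_j separately
        are only known to lie in F_{p+j}.\<close>
      show ?thesis
        using False filt_minus[OF \<gamma>[OF j] \<alpha>'[OF j]] An.M.add_minus_minus_cancel_left[OF \<alpha>c[of "j - 1"] \<alpha>c[of j] d\<beta>c[OF j]]
        by (simp add: coord_y dx0 x0)
    qed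
    \<comment> \<open>What remains is -x_{j-1}. Its index p + r + (j - 1) is exactly the one
      required at p - 1, so the equations x_{j-1} + x_j = \<beta>_j need hold only up to this
      error.\<close>
    moreover have "coord n 1 j ?y \<in> filt A (p - 1 + int r + int j) (n - 1)" if j: "1 \<le> j" for j
      using A1.M.minus_add_cancel_right[OF x0c \<beta>c[OF j]] filt_uminus[OF x0f'[OF j]]
      by (simp add: coord_y1[OF j] dx1[OF j])
    ultimately show "?y \<in> tensor_filt R (Q_complex R r) A (p - 1) n"
      using yc by (simp add: tensor_filt_iff)
    interpret Tn1: module R "Q_tensor (n + 1)" by (rule Q_tensor_module)
    \<comment> \<open>Since ddx = 0, the (r+1)-cycle condition on h at p becomes the r-cycle
      condition on the remainder at p - 1: p - (r + 1) = (p - 1) - r.\<close>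
    have "Q_differential r n ?y = Q_differential r n h"
      using hc dxc tensor_differential_square[OF x, of r] tensor_differential_closed[OF hc, of r]
      by (simp add: Tn.M.minus_eq module_hom_add[OF Q_tensor_differential_hom]
          module_hom_uminus[OF Q_tensor_module Q_tensor_module Q_tensor_differential_hom])
    then show "Q_differential r n ?y \<in> tensor_filt R (Q_complex R r) A (p - 1 - int r) (n + 1)"
      using h by (simp add: cycles_def tensor_complex_simps algebra_simps)
  qed
  have "h = ?dx \<oplus>\<^bsub>Q_tensor n\<^esub> ?y"
    using hc dxc by (simp add: Tn.M.minus_eq Tn.M.a_lcomm Tn.M.r_neg)
  then show ?thesis
    using xZ yZ unfolding boundaries.simps tensor_complex_simps set_add_def' by blast
qed

end

theorem proposition5p2p3:
  fixes R :: "('r, 'x) ring_scheme"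
    and A :: "('r, 'm) fcomplex"
    and r :: nat
    and S :: "nat set"
  assumes "cring R"
    and "S \<subseteq> {0..r}"
    and "r \<in> S"
    and "filtered_complex R A"
  shows "weak_equivalence R S (tensor_complex R (Q_complex R r) A) A
    (compose_morphism (left_unitor R A)
      (tensor_morphism R (Q_complex R r) A (base R 0 0) A (Q_proj R) id_morphism))"
    (is "weak_equivalence R S ?T A ?f")
proof -
  interpret filtered_complex R A by fact
  \<comment> \<open>Being contained in {0..r} makes \<open>S\<close> finite, so \<open>Max\<close>
    is a genuine maximum and the page to compare is r + 1.\<close>
  have max: "Max S = r"
    using assms(2,3) finite_subset[OF assms(2)] by (intro Max_eqI) auto
  have proj: "?f n h = coord n 0 0 h" if "h \<in> cycles ?T k p n" for k p n h
    using that by (intro Q_proj_coord) (auto simp: cycles_def tensor_complex_simps tensor_filt_iff)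
  have "module_iso R (page ?T (Suc r) p n) (page A (Suc r) p n) (page_map A ?f (Suc r) p n)" for p n
  proof (rule page_map_iso[OF Q_proj_morphism])
    show "\<exists>h\<in>cycles ?T (Suc r) p n. ?f n h = z" if "z \<in> cycles A (Suc r) p n" for z
      using Q_proj_cycles_surj[OF that] proj by auto
    show "h \<in> boundaries ?T (Suc r) p n"
      if "h \<in> cycles ?T (Suc r) p n" "?f n h \<in> boundaries A (Suc r) p n" for h
      using that by (intro Q_proj_boundaries_inj) (simp_all add: proj)
  qed
  then show ?thesis
    unfolding weak_equivalence_def quasi_isomorphism_def max using Q_proj_morphism by simp
qed

end
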